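(* Fix $0<\alpha<1/2$ and let $(A_N)_{N\ge1}$ be any sequence of $N\times N$ matrices of the form $A_N=\operatorname{diag}(1,\dots,1,0,\dots,0)$ such that, for some $\epsilon>0$, $|\operatorname{rank}(A_N)-N^\alpha|\le N^{\alpha/2-\epsilon}$. Let $\mathbf{u}_1,\dots,\mathbf{u}_N$ be the $\ell^2$-normalized eigenvectors of an $N\times N$ GOE matrix. Then, as $N\to\infty$, $$\Big(\frac{\sqrt{\log N}}{N^{\alpha/2}}\Big)\max_{i=1}^N N\langle\mathbf{u}_i,A_N\mathbf{u}_i\rangle-N^{\alpha/2}\sqrt{\log N}-2\log N+\frac{\log\log N}{2}+\frac{\log(4\pi)}{2}\to\Lambda$$ in distribution, where $\mathbb P(\Lambda\le x)=\exp(-e^{-x})$.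
   Context: The $N\times N$ GOE consists of real symmetric random matrices whose entries are centered Gaussians, independent up to symmetry, with $\mathbb{E}[H_{ij}^2]=\frac1N(1+\delta_{ij})$. *)

theory Defs
  imports "HOL-Probability.Probability"
begin

definition goe_index :: "nat \<Rightarrow> (nat \<times> nat) set" where
  "goe_index N = {(i, j). i \<le> j \<and> j < N}"

definition goe_space :: "nat \<Rightarrow> ((nat \<times> nat) \<Rightarrow> real) measure" where
  "goe_space N = PiM (goe_index N) (\<lambda>_. std_normal_distribution)"

definition goe_matrix :: "nat \<Rightarrow> ((nat \<times> nat) \<Rightarrow> real) \<Rightarrow> nat \<Rightarrow> nat \<Rightarrow> real" where
  "goe_matrix N g i j =
     (if i < N \<and> j < N then
        (if i < j then g (i, j) / sqrt (real N)
         else if j < i then g (j, i) / sqrt (real N)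
         else sqrt 2 * g (i, i) / sqrt (real N))
      else 0)"

definition unit_eigenvector :: "nat \<Rightarrow> (nat \<Rightarrow> nat \<Rightarrow> real) \<Rightarrow> (nat \<Rightarrow> real) \<Rightarrow> bool" where
  "unit_eigenvector N H u \<longleftrightarrow>
     (\<Sum>k<N. (u k)\<^sup>2) = 1 \<and>
     (\<exists>ev. \<forall>i<N. (\<Sum>j<N. H i j * u j) = ev * u i)"

definition diag_proj :: "nat \<Rightarrow> nat \<Rightarrow> nat \<Rightarrow> nat \<Rightarrow> real" where
  "diag_proj N r i j = (if i = j \<and> i < r \<and> i < N then 1 else 0)"

definition quad_form :: "nat \<Rightarrow> (nat \<Rightarrow> nat \<Rightarrow> real) \<Rightarrow> (nat \<Rightarrow> real) \<Rightarrow> real" where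
  "quad_form N A u = (\<Sum>i<N. \<Sum>j<N. u i * A i j * u j)"

text \<open>max over the eigenvectors u_i of H of N <u_i, A u_i>; since the quantity is
  invariant under u -> -u and the GOE spectrum is a.s. simple, this is the maximum
  over all unit eigenvectors.\<close>
definition max_overlap :: "nat \<Rightarrow> (nat \<Rightarrow> nat \<Rightarrow> real) \<Rightarrow> (nat \<Rightarrow> nat \<Rightarrow> real) \<Rightarrow> real" where
  "max_overlap N A H = Sup {real N * quad_form N A u | u. unit_eigenvector N H u}"

end

theory Submission
  imports Defs "HOL-Real_Asymp.Real_Asymp"
begin

text \<open>Conjugating by a fixed orthogonal matrix does not change the law of the GOE, so the first
  \<open>r\<close> coordinates may be replaced by the row space of an independent \<open>r \<times> N\<close> Gaussian array \<open>G\<close>,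
  and the overlap of a unit vector \<open>u\<close> by the squared length of the projection of \<open>u\<close> onto it.
  Outside an event of small probability all squared singular values of \<open>G\<close> are \<open>(1 + O(\<delta>)) N\<close> with
  \<open>\<delta> = N powr (-1/4)\<close>, so \<open>N\<close> times that squared length is \<open>(1 + O(\<delta>)) |G u|\<^sup>2\<close>. For a fixed matrix with
  simple spectrum and eigenbasis \<open>w\<^sub>j\<close> the vectors \<open>G w\<^sub>j\<close> are again independent standard Gaussian
  vectors, so the maximum is, up to the factor \<open>1 + O(\<delta>)\<close>, a maximum of \<open>N\<close> independent chi-squared
  variables with \<open>r\<close> degrees of freedom. The factor is harmless because \<open>\<alpha> < 1/2\<close>, and the Gumbel limit
  follows from the tail asymptotics of the chi-squared law at distance of order \<open>sqrt (r ln N)\<close> from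
  its mean.\<close>

section \<open>Orthonormal families and the spectral theorem\<close>

text \<open>The exponent in \<open>N powr (-1/4)\<close> balances two demands on \<delta> =
  N^(-\<beta>). A union bound over a net of (8r+1)^r points, against deviations of probability
  exp(-c N \<delta>^2), needs 1 - 2\<beta> > \<alpha>. A relative error \<delta> moves the threshold
  by about \<delta> N^\<alpha>, which must be small against the window N^(\<alpha>/2) / sqrt(ln N)
  of the Gumbel limit; this needs \<beta> > \<alpha>/2. Some \<beta> satisfies both exactly when
  \<alpha> < 1/2, and then \<beta> = 1/4 does. The same window explains the rank hypothesis:
  exchanging r and N^\<alpha> shifts the centre by at most N^(\<alpha>/2 - \<epsilon>). Two
  obstacles shape the rest. No eigenbasis is chosen measurably in the matrix; events quantify over
  all unit eigenvectors, and their measurability comes from projecting closed sets along the compact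
  unit sphere. Gaussian invariance is proved without a change of variables in several dimensions:
  the two laws are compared on Gaussian bumps, whose integrals depend only on the norm of the
  centre.\<close>

definition ip :: "nat \<Rightarrow> (nat \<Rightarrow> real) \<Rightarrow> (nat \<Rightarrow> real) \<Rightarrow> real" where
  "ip n u v = (\<Sum>i<n. u i * v i)"

definition mv :: "nat \<Rightarrow> (nat \<Rightarrow> nat \<Rightarrow> real) \<Rightarrow> (nat \<Rightarrow> real) \<Rightarrow> nat \<Rightarrow> real" where
  "mv n H u i = (\<Sum>j<n. H i j * u j)"

definition orthonormal :: "nat \<Rightarrow> nat \<Rightarrow> (nat \<Rightarrow> nat \<Rightarrow> real) \<Rightarrow> bool" where
  "orthonormal n k w \<longleftrightarrow> (\<forall>a<k. \<forall>b<k. ip n (w a) (w b) = (if a = b then 1 else 0))"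

lemma ip_commute: "ip n u v = ip n v u"
  by (simp add: ip_def mult.commute)

lemma ip_add_left: "ip n (\<lambda>i. u i + v i) x = ip n u x + ip n v x"
  by (simp add: ip_def distrib_right sum.distrib)

lemma ip_diff_left: "ip n (\<lambda>i. u i - v i) x = ip n u x - ip n v x"
  by (simp add: ip_def left_diff_distrib sum_subtractf)

lemma ip_scale_left: "ip n (\<lambda>i. c * u i) x = c * ip n u x"
  by (simp add: ip_def sum_distrib_left mult.assoc)

lemma ip_sum_left: "ip n (\<lambda>i. \<Sum>a\<in>A. f a i) x = (\<Sum>a\<in>A. ip n (f a) x)"
  unfolding ip_def by (subst sum.swap) (simp add: sum_distrib_right)

lemma ip_add_right: "ip n x (\<lambda>i. u i + v i) = ip n x u + ip n x v"
  and ip_diff_right: "ip n x (\<lambda>i. u i - v i) = ip n x u - ip n x v"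
  and ip_scale_right: "ip n x (\<lambda>i. c * u i) = c * ip n x u"
  and ip_sum_right: "ip n x (\<lambda>i. \<Sum>a\<in>A. f a i) = (\<Sum>a\<in>A. ip n x (f a))"
  by (simp_all add: ip_commute[of n x] ip_add_left ip_diff_left ip_scale_left ip_sum_left)

lemmas ip_simps = ip_add_left ip_diff_left ip_scale_left ip_sum_left
  ip_add_right ip_diff_right ip_scale_right ip_sum_right

text \<open>Vectors are total functions of which only the values below \<open>n\<close> count, so
  agreement below \<open>n\<close> stands in for equality in all that follows.\<close>

lemma ip_cong: "(\<And>i. i < n \<Longrightarrow> u i = u' i) \<Longrightarrow> (\<And>i. i < n \<Longrightarrow> v i = v' i) \<Longrightarrow> ip n u v = ip n u' v'"
  by (simp add: ip_def)

lemma ip_nonneg: "0 \<le> ip n u u"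
  by (auto simp: ip_def intro!: sum_nonneg)

lemma ip_self_eq_0D: "ip n u u = 0 \<Longrightarrow> i < n \<Longrightarrow> u i = 0"
  unfolding ip_def by (subst (asm) sum_nonneg_eq_0_iff) auto

lemma ip_mv_sym:
  assumes "\<And>i j. i < n \<Longrightarrow> j < n \<Longrightarrow> H i j = H j i"
  shows "ip n (mv n H u) v = ip n u (mv n H v)"
proof -
  have "ip n (mv n H u) v = (\<Sum>i<n. \<Sum>j<n. H i j * u j * v i)"
    by (simp add: ip_def mv_def sum_distrib_right)
  also have "\<dots> = (\<Sum>j<n. \<Sum>i<n. H i j * u j * v i)" by (rule sum.swap)
  also have "\<dots> = ip n u (mv n H v)"
    using assms by (auto simp: ip_def mv_def sum_distrib_left intro!: sum.cong)
  finally show ?thesis .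
qed

lemma orthonormalD: "orthonormal n k w \<Longrightarrow> a < k \<Longrightarrow> b < k \<Longrightarrow> ip n (w a) (w b) = (if a = b then 1 else 0)"
  by (simp add: orthonormal_def)

section \<open>Projection off an orthonormal family\<close>

definition residual :: "nat \<Rightarrow> nat \<Rightarrow> (nat \<Rightarrow> nat \<Rightarrow> real) \<Rightarrow> (nat \<Rightarrow> real) \<Rightarrow> nat \<Rightarrow> real" where
  "residual n k w v i = v i - (\<Sum>a<k. ip n (w a) v * w a i)"

lemma ip_residual_left:
  "ip n (residual n k w v) x = ip n v x - (\<Sum>a<k. ip n (w a) v * ip n (w a) x)"
  unfolding residual_def[abs_def] by (simp only: ip_diff_left ip_sum_left ip_scale_left)

lemma ip_residual_right:
  "ip n x (residual n k w v) = ip n x v - (\<Sum>a<k. ip n (w a) v * ip n x (w a))"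
  by (simp add: ip_commute[of n x] ip_residual_left)

lemma ip_residual:
  assumes "orthonormal n k w" "b < k"
  shows "ip n (w b) (residual n k w v) = 0"
proof -
  have "ip n (w b) (residual n k w v) = ip n (w b) v - (\<Sum>a<k. ip n (w a) v * ip n (w b) (w a))"
    by (rule ip_residual_right)
  also have "(\<Sum>a<k. ip n (w a) v * ip n (w b) (w a)) = (\<Sum>a<k. if a = b then ip n (w a) v else 0)"
    using assms by (intro sum.cong) (auto simp: orthonormalD)
  finally show ?thesis using assms by simp
qed

lemma ip_residual_self:
  assumes "orthonormal n k w"
  shows "ip n (residual n k w v) (residual n k w v) = ip n v v - (\<Sum>a<k. (ip n (w a) v)\<^sup>2)"
proof -
  have "ip n (residual n k w v) (residual n k w v)
      = ip n v (residual n k w v) - (\<Sum>a<k. ip n (w a) v * ip n (w a) (residual n k w v))"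
    by (rule ip_residual_left)
  also have "\<dots> = ip n v (residual n k w v)" using ip_residual[OF assms] by simp
  also have "\<dots> = ip n v v - (\<Sum>a<k. ip n (w a) v * ip n v (w a))"
    by (simp add: ip_residual_right)
  finally show ?thesis by (simp add: power2_eq_square ip_commute[of n v "w _"])
qed

definition unitv :: "nat \<Rightarrow> nat \<Rightarrow> real" where
  "unitv i = (\<lambda>j. if j = i then 1 else 0)"

lemma ip_unitv: "i < n \<Longrightarrow> ip n u (unitv i) = u i"
  by (simp add: ip_def unitv_def if_distrib[of "\<lambda>x. _ * x"] cong: if_cong)

text \<open>Summing over the coordinate vectors computes the trace of the projection onto the orthogonal
  complement of the family. This takes the place of dimension theory below.\<close>

lemma trace_residual:
  assumes "orthonormal n k w"
  shows "(\<Sum>i<n. ip n (residual n k w (unitv i)) (residual n k w (unitv i))) = real n - real k"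
proof -
  have "(\<Sum>i<n. ip n (residual n k w (unitv i)) (residual n k w (unitv i)))
     = (\<Sum>i<n. 1 - (\<Sum>a<k. w a i * w a i))"
    by (intro sum.cong refl, subst ip_residual_self[OF assms])
       (simp add: ip_unitv power2_eq_square, simp add: unitv_def)
  also have "\<dots> = real n - (\<Sum>a<k. ip n (w a) (w a))"
    unfolding ip_def by (subst sum.swap) (simp add: sum_subtractf)
  also have "\<dots> = real n - real k" using assms by (simp add: orthonormalD)
  finally show ?thesis .
qed

text \<open>The trace \<open>real n - real k\<close> is positive, so some coordinate vector has a
  nonzero residual, which only has to be normalized.\<close>

lemma ex_unit_orthogonal:
  assumes "orthonormal n k w" "k < n"
  shows "\<exists>u. ip n u u = 1 \<and> (\<forall>a<k. ip n (w a) u = 0)"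
proof -
  have "\<exists>i<n. ip n (residual n k w (unitv i)) (residual n k w (unitv i)) \<noteq> 0"
  proof (rule ccontr)
    assume "\<not> ?thesis"
    then have "(\<Sum>i<n. ip n (residual n k w (unitv i)) (residual n k w (unitv i))) = 0" by simp
    with trace_residual[OF assms(1)] assms(2) show False by simp
  qed
  then obtain i where i: "ip n (residual n k w (unitv i)) (residual n k w (unitv i)) \<noteq> 0" by blast
  define v where "v = residual n k w (unitv i)"
  have pos: "ip n v v > 0" using i ip_nonneg[of n v] by (simp add: v_def)
  show ?thesis
  proof (intro exI[of _ "\<lambda>j. 1 / sqrt (ip n v v) * v j"] conjI allI impI)
    show "ip n (\<lambda>j. 1 / sqrt (ip n v v) * v j) (\<lambda>j. 1 / sqrt (ip n v v) * v j) = 1"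
      using pos by (simp only: ip_scale_left ip_scale_right) (simp add: divide_simps)
    show "ip n (w a) (\<lambda>j. 1 / sqrt (ip n v v) * v j) = 0" if "a < k" for a
      using ip_residual[OF assms(1) that] by (simp only: ip_simps v_def)
  qed
qed

text \<open>For a family of \<open>n\<close> vectors the trace is 0 and its summands are
  nonnegative, so every coordinate vector has residual 0. The projection is self-adjoint and
  idempotent, which carries this over to an arbitrary \<open>v\<close>.\<close>

lemma residual_complete:
  assumes "orthonormal n n w" "i < n"
  shows "residual n n w v i = 0"
proof -
  have "(\<Sum>i<n. ip n (residual n n w (unitv i)) (residual n n w (unitv i))) = 0"
    using trace_residual[OF assms(1)] by simp
  then have 0: "ip n (residual n n w (unitv i)) (residual n n w (unitv i)) = 0" if "i < n" for i
    using that by (subst (asm) sum_nonneg_eq_0_iff) (auto simp: ip_nonneg)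
  have "residual n n w v i = ip n (residual n n w v) (unitv i)" using assms(2) by (simp add: ip_unitv)
  also have "\<dots> = ip n (residual n n w v) (residual n n w (unitv i))
      + (\<Sum>a<n. ip n (w a) (unitv i) * ip n (residual n n w v) (w a))"
    by (simp add: ip_residual_right)
  also have "(\<Sum>a<n. ip n (w a) (unitv i) * ip n (residual n n w v) (w a)) = 0"
    using ip_residual[OF assms(1)] by (simp add: ip_commute[of n "residual n n w v" "w _"])
  also have "ip n (residual n n w v) (residual n n w (unitv i)) = ip n (residual n n w v) (\<lambda>_. 0)"
    using ip_self_eq_0D[OF 0[OF assms(2)]] by (intro ip_cong) auto
  finally show ?thesis by (simp add: ip_def)
qed

lemma orthonormal_expand:
  assumes "orthonormal n n w" "i < n"
  shows "v i = (\<Sum>a<n. ip n (w a) v * w a i)"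
  using residual_complete[OF assms, of v] by (simp add: residual_def)

lemma orthonormal_parseval:
  assumes "orthonormal n n w"
  shows "(\<Sum>a<n. (ip n (w a) v)\<^sup>2) = ip n v v"
proof -
  have "ip n (residual n n w v) (residual n n w v) = 0"
    using residual_complete[OF assms] by (simp add: ip_def)
  then show ?thesis using ip_residual_self[OF assms, of v] by simp
qed

text \<open>Expanding \<open>unitv j\<close> in the family: this is the passage from a one-sided to
  a two-sided inverse of an orthogonal matrix.\<close>

lemma orthonormal_columns:
  assumes "orthonormal n n w" "i < n" "j < n"
  shows "(\<Sum>a<n. w a i * w a j) = (if i = j then 1 else 0)"
proof -
  have "unitv j i = (\<Sum>a<n. w a j * w a i)"
    using orthonormal_expand[OF assms(1,2), of "unitv j"] assms(3) by (simp add: ip_unitv)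
  then show ?thesis by (simp add: unitv_def mult.commute)
qed

section \<open>The spectral theorem by maximizing a quadratic form on the sphere\<close>

definition sphere_fun :: "nat \<Rightarrow> (nat \<Rightarrow> real) set" where
  "sphere_fun n = {u. (\<forall>i\<in>{n..}. u i = 0) \<and> ip n u u = 1}"

lemma continuous_on_ip [continuous_intros]:
  assumes "\<And>i. continuous_on S (\<lambda>x. f x i)" "\<And>i. continuous_on S (\<lambda>x. g x i)"
  shows "continuous_on S (\<lambda>x. ip n (f x) (g x))"
  unfolding ip_def by (intro continuous_intros assms)

lemma continuous_on_apply_id [continuous_intros]: "continuous_on S (\<lambda>u :: 'a \<Rightarrow> 'b::topological_space. u i)"
  by (rule continuous_on_product_then_coordinatewise[OF continuous_on_id])

lemma continuous_on_mv:
  "(\<And>i. continuous_on S (\<lambda>x. f x i)) \<Longrightarrow> continuous_on S (\<lambda>x. mv n H (f x) i)"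
  unfolding mv_def by (intro continuous_on_sum continuous_on_mult continuous_on_const)

text \<open>Forcing the coordinates from \<open>n\<close> on to be 0 places the set in a product of
  intervals, which is compact by Tychonoff.\<close>

lemma compact_sphere_fun: "compact (sphere_fun n)"
proof -
  have "compactin (product_topology (\<lambda>_. euclidean) UNIV) (PiE UNIV (\<lambda>i::nat. {-1..1::real}))"
    unfolding compactin_PiE compactin_euclidean_iff by simp
  then have box: "compact (PiE UNIV (\<lambda>i::nat. {-1..1::real}))"
    unfolding euclidean_product_topology compactin_euclidean_iff .
  have sub: "sphere_fun n \<subseteq> PiE UNIV (\<lambda>i::nat. {-1..1::real})"
  proof
    fix u assume u: "u \<in> sphere_fun n"
    have "u i \<in> {-1..1}" for i
    proof (cases "i < n")
      case True
      have "u i * u i \<le> (\<Sum>j<n. u j * u j)"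
        using True by (intro member_le_sum[of i "{..<n}" "\<lambda>j. u j * u j"]) auto
      then have "(u i)\<^sup>2 \<le> 1\<^sup>2" using u by (simp add: sphere_fun_def ip_def power2_eq_square)
      then show ?thesis by (simp only: power2_le_iff_abs_le zero_le_one) auto
    qed (use u in \<open>auto simp: sphere_fun_def not_less\<close>)
    then show "u \<in> PiE UNIV (\<lambda>i::nat. {-1..1::real})" by auto
  qed
  have "closed (\<Inter>i\<in>{n..}. {u :: nat \<Rightarrow> real. u i = 0})"
    by (intro closed_INT ballI closed_Collect_eq continuous_on_apply_id continuous_on_const)
  moreover have "closed {u. ip n u u = 1}"
    by (intro closed_Collect_eq continuous_on_ip continuous_on_apply_id continuous_on_const)
  moreover have "sphere_fun n = (\<Inter>i\<in>{n..}. {u. u i = 0}) \<inter> {u. ip n u u = 1}"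
    by (auto simp: sphere_fun_def)
  ultimately have "closed (sphere_fun n)" by (simp add: closed_Int)
  then show ?thesis
    using compact_Int_closed[OF box, of "sphere_fun n"] unfolding inf.absorb2[OF sub] by blast
qed

text \<open>The first-order condition at a maximum without derivatives. The choice
  \<open>t = a / c\<close> with \<open>c = \<bar>b\<bar> + 1\<close> makes the linear term exceed
  the quadratic one unless \<open>a = 0\<close>.\<close>

lemma quadratic_perturbation:
  fixes a b :: real
  assumes "\<And>t. 2 * t * a \<le> t\<^sup>2 * b"
  shows "a = 0"
proof (rule ccontr)
  assume a: "a \<noteq> 0"
  define c where "c = \<bar>b\<bar> + 1"
  have "2 * (a / c) * a \<le> (a / c)\<^sup>2 * b" by (rule assms)
  also have "\<dots> \<le> (a / c)\<^sup>2 * c" by (intro mult_left_mono) (auto simp: c_def)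
  also have "\<dots> = a\<^sup>2 / c" by (simp add: power2_eq_square c_def)
  also have "2 * (a / c) * a = 2 * a\<^sup>2 / c" by (simp add: power2_eq_square)
  finally have "2 * a\<^sup>2 / c \<le> a\<^sup>2 / c" .
  moreover have "a\<^sup>2 / c > 0" using a by (simp add: c_def)
  ultimately show False by simp
qed

text \<open>A maximizer \<open>u\<close> of the quadratic form among unit vectors orthogonal to the
  family is an eigenvector. The defect \<open>mv n H u i - l * u i\<close> is orthogonal to
  \<open>u\<close> by the choice of \<open>l\<close>, and to the family because that consists of
  eigenvectors; first-order optimality then makes it orthogonal to itself.\<close>

lemma ex_next_eigenvector:
  assumes sym: "\<And>i j. i < n \<Longrightarrow> j < n \<Longrightarrow> H i j = H j i"
    and on: "orthonormal n k w" and kn: "k < n"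
    and eig: "\<And>a. a < k \<Longrightarrow> \<exists>l. \<forall>i<n. mv n H (w a) i = l * w a i"
  shows "\<exists>u l. ip n u u = 1 \<and> (\<forall>a<k. ip n (w a) u = 0) \<and> (\<forall>i<n. mv n H u i = l * u i)"
proof -
  define S where "S = sphere_fun n \<inter> {u. \<forall>a\<in>{..<k}. ip n (w a) u = 0}"
  have "closed {u. \<forall>a\<in>{..<k}. ip n (w a) u = 0}"
    unfolding Collect_ball_eq
    by (intro closed_INT ballI closed_Collect_eq continuous_on_ip continuous_on_apply_id continuous_on_const)
  then have "compact S" unfolding S_def by (intro compact_Int_closed compact_sphere_fun)
  moreover have "S \<noteq> {}"
  proof -
    obtain u where u: "ip n u u = 1" "\<forall>a<k. ip n (w a) u = 0"
      using ex_unit_orthogonal[OF on kn] by blast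
    define u' where "u' = (\<lambda>i. if i < n then u i else 0)"
    have "ip n u' u' = ip n u u" "ip n v u' = ip n v u" for v
      by (auto intro!: ip_cong simp: u'_def)
    then have "u' \<in> S" using u by (auto simp: S_def sphere_fun_def u'_def)
    then show ?thesis by blast
  qed
  moreover have "continuous_on S (\<lambda>u. ip n u (mv n H u))"
    by (intro continuous_on_ip continuous_on_mv continuous_on_apply_id)
  ultimately obtain u where uS: "u \<in> S" and umax: "\<forall>v\<in>S. ip n v (mv n H v) \<le> ip n u (mv n H u)"
    using continuous_attains_sup by blast
  define l where "l = ip n u (mv n H u)"
  have u1: "ip n u u = 1" and u0: "\<And>a. a < k \<Longrightarrow> ip n (w a) u = 0"
    using uS by (auto simp: S_def sphere_fun_def)
  have mv_add: "mv n H (\<lambda>i. f i + c * g i) = (\<lambda>i. mv n H f i + c * mv n H g i)" for f g c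
    by (auto simp: mv_def distrib_left sum.distrib sum_distrib_left mult_ac)
  have mvs: "mv n H (\<lambda>i. c * g i) = (\<lambda>i. c * mv n H g i)" for g c
    by (auto simp: mv_def sum_distrib_left mult_ac)
  \<comment> \<open>Homogeneity extends the bound from the sphere to all vectors orthogonal to the
    family, so the perturbed vector below need not be normalized.\<close>
  have gen: "ip n x (mv n H x) \<le> l * ip n x x" if x: "\<And>a. a < k \<Longrightarrow> ip n (w a) x = 0" for x
  proof (cases "ip n x x = 0")
    case True
    then have "\<And>i. i < n \<Longrightarrow> x i = 0" using ip_self_eq_0D by blast
    then show ?thesis by (simp add: ip_def)
  next
    case False
    then have pos: "ip n x x > 0" using ip_nonneg[of n x] by simp
    define c where "c = 1 / sqrt (ip n x x)"
    define x' where "x' = (\<lambda>i. if i < n then c * x i else 0)"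
    have e: "ip n x' y = ip n (\<lambda>i. c * x i) y" "ip n y x' = ip n y (\<lambda>i. c * x i)" for y
      by (auto intro!: ip_cong simp: x'_def)
    have e2: "mv n H x' = mv n H (\<lambda>i. c * x i)" by (auto simp: mv_def x'_def)
    have c2: "c * c * ip n x x = 1" using pos by (simp add: c_def)
    have "x' \<in> S" using x c2 by (simp add: S_def sphere_fun_def e ip_simps) (auto simp: x'_def mult_ac)
    then have "ip n x' (mv n H x') \<le> l" using umax by (simp add: l_def)
    then have "c * c * ip n x (mv n H x) \<le> l * (c * c * ip n x x)"
      using c2 by (simp add: e e2 mvs ip_simps mult_ac)
    moreover have "c * c > 0" using c2 by (metis mult_zero_left not_real_square_gt_zero zero_neq_one)
    ultimately show ?thesis
      by (metis mult.left_commute mult_le_cancel_left_pos)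
  qed
  \<comment> \<open>\<open>gen\<close> for \<open>u + t * v\<close> with arbitrary real
    \<open>t\<close> leaves a term linear in \<open>t\<close>, whose coefficient has to
    vanish.\<close>
  have orth: "ip n (mv n H u) v = 0"
    if v: "\<And>a. a < k \<Longrightarrow> ip n (w a) v = 0" and uv: "ip n u v = 0" for v
  proof -
    have "2 * t * ip n (mv n H u) v \<le> t\<^sup>2 * (l * ip n v v - ip n v (mv n H v))" for t
    proof -
      have "ip n (\<lambda>i. u i + t * v i) (mv n H (\<lambda>i. u i + t * v i))
          \<le> l * ip n (\<lambda>i. u i + t * v i) (\<lambda>i. u i + t * v i)"
        by (rule gen) (simp add: ip_simps u0 v)
      moreover have "ip n u (mv n H v) = ip n (mv n H u) v" using ip_mv_sym[OF sym] by simp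
      moreover have "ip n v (mv n H u) = ip n (mv n H u) v" by (rule ip_commute)
      ultimately show ?thesis
        using u1 uv ip_commute[of n v u] l_def unfolding mv_add
        by (simp add: ip_simps algebra_simps power2_eq_square)
    qed
    then show ?thesis by (rule quadratic_perturbation)
  qed
  define v where "v = (\<lambda>i. mv n H u i - l * u i)"
  have va: "ip n (w a) v = 0" if ak: "a < k" for a
  proof -
    obtain m where m: "\<forall>i<n. mv n H (w a) i = m * w a i" using eig[OF ak] by metis
    have "ip n (w a) (mv n H u) = ip n (mv n H (w a)) u" using ip_mv_sym[OF sym] by simp
    also have "\<dots> = ip n (\<lambda>i. m * w a i) u" using m by (intro ip_cong) auto
    finally show ?thesis using u0[OF ak] by (simp add: v_def ip_simps)
  qed
  have uv: "ip n u v = 0" by (simp add: v_def ip_simps u1 l_def)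
  have "ip n v v = ip n (mv n H u) v - l * ip n u v"
    unfolding v_def by (simp add: ip_diff_left ip_scale_left)
  then have "ip n v v = 0" using orth[OF va uv] uv by simp
  then have "\<forall>i<n. mv n H u i = l * u i" using ip_self_eq_0D[of n v] by (auto simp: v_def)
  then show ?thesis using u1 u0 by blast
qed

text \<open>Starting from a given family serves two purposes. With the empty family this is the
  spectral theorem; with \<open>H = 0\<close>, for which every vector is an eigenvector, it
  completes an arbitrary orthonormal family to a basis.\<close>

lemma orthonormal_eigenbasis_extend:
  assumes sym: "\<And>i j. i < n \<Longrightarrow> j < n \<Longrightarrow> H i j = H j i"
    and "orthonormal n k w" "k \<le> n"
    and "\<And>a. a < k \<Longrightarrow> \<exists>l. \<forall>i<n. mv n H (w a) i = l * w a i"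
  shows "\<exists>w'. orthonormal n n w' \<and> (\<forall>a<k. w' a = w a)
     \<and> (\<forall>a<n. \<exists>l. \<forall>i<n. mv n H (w' a) i = l * w' a i)"
  using assms(2-4)
proof (induction "n - k" arbitrary: k w)
  case 0
  then show ?case by auto
next
  case (Suc d)
  then have kn: "k < n" by simp
  obtain u l where u: "ip n u u = 1" "\<forall>a<k. ip n (w a) u = 0" "\<forall>i<n. mv n H u i = l * u i"
    using ex_next_eigenvector[OF sym Suc.prems(1) kn Suc.prems(3)] by blast
  define w1 where "w1 = w(k := u)"
  have "orthonormal n (Suc k) w1"
    using Suc.prems(1) u by (auto simp: orthonormal_def w1_def less_Suc_eq ip_commute[of n u "w _"])
  moreover have "\<exists>l. \<forall>i<n. mv n H (w1 a) i = l * w1 a i" if "a < Suc k" for a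
    using that u Suc.prems(3) by (auto simp: w1_def less_Suc_eq)
  moreover have "d = n - Suc k" "Suc k \<le> n" using Suc.hyps(2) kn by auto
  ultimately have "\<exists>w'. orthonormal n n w' \<and> (\<forall>a<Suc k. w' a = w1 a) \<and>
      (\<forall>a<n. \<exists>l. \<forall>i<n. mv n H (w' a) i = l * w' a i)"
    using Suc.hyps(1)[of "Suc k" w1] by blast
  then obtain w' where w': "orthonormal n n w'" "\<forall>a<Suc k. w' a = w1 a"
      "\<forall>a<n. \<exists>l. \<forall>i<n. mv n H (w' a) i = l * w' a i"
    by blast
  have "w' a = w a" if "a < k" for a using w'(2) that by (simp add: w1_def)
  then show ?case using w'(1,3) by blast
qed

lemma spectral_theorem:
  assumes "\<And>i j. i < n \<Longrightarrow> j < n \<Longrightarrow> H i j = H j i"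
  obtains w l where "orthonormal n n w" "\<And>a i. a < n \<Longrightarrow> i < n \<Longrightarrow> mv n H (w a) i = l a * w a i"
proof -
  have "orthonormal n 0 (\<lambda>_ _. 0)" by (simp add: orthonormal_def)
  then obtain w where w: "orthonormal n n w" "\<forall>a<n. \<exists>l. \<forall>i<n. mv n H (w a) i = l * w a i"
    using orthonormal_eigenbasis_extend[where H = H and n = n and k = 0, OF assms] by blast
  then obtain l where "\<forall>a<n. \<forall>i<n. mv n H (w a) i = l a * w a i" by metis
  then show ?thesis using that w(1) by blast
qed

lemma orthonormal_extend:
  assumes "orthonormal n k w" "k \<le> n"
  obtains w' where "orthonormal n n w'" "\<And>a. a < k \<Longrightarrow> w' a = w a"
proof -
  have "\<exists>l. \<forall>i<n. mv n (\<lambda>_ _. 0) (w a) i = l * w a i" for a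
    by (intro exI[of _ 0]) (simp add: mv_def)
  then show ?thesis
    using orthonormal_eigenbasis_extend[where H = "\<lambda>_ _. 0" and n = n, OF _ assms] that by auto
qed

section \<open>Invariance of Gaussian measures under orthogonal maps\<close>

abbreviation gaussian :: "'i set \<Rightarrow> ('i \<Rightarrow> real) measure" where
  "gaussian I \<equiv> PiM I (\<lambda>_. std_normal_distribution)"

lemma sets_gaussian: "sets (gaussian I) = sets (PiM I (\<lambda>_. borel))"
  by (rule sets_PiM_cong) auto

lemma space_gaussian: "space (gaussian I) = (\<Pi>\<^sub>E i\<in>I. UNIV)"
  by (simp add: space_PiM)

lemma measurable_gaussian_cong: "measurable (gaussian I) M = measurable (PiM I (\<lambda>_. borel)) M"
  by (rule measurable_cong_sets) (auto simp: sets_gaussian)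

interpretation std_normal: prob_space std_normal_distribution
  using real_dist_normal_dist by (simp add: real_distribution_def)

interpretation gaussian: product_prob_space "\<lambda>_. std_normal_distribution" I for I :: "'i set"
  by standard

lemma prob_space_gaussian: "prob_space (gaussian I)"
  by (rule gaussian.prob_space_axioms)

section \<open>Gaussian bumps as test functions\<close>

lemma nn_integral_std_normal_bump:
  fixes s b :: real
  assumes s: "s > 0"
  shows "(\<integral>\<^sup>+x. ennreal (exp (- ((x - b)\<^sup>2 / (2 * s)))) \<partial>std_normal_distribution)
    = ennreal (exp (- (b\<^sup>2 / (2 * (1 + s)))))
      * (\<integral>\<^sup>+x. ennreal (exp (- ((1 + 1 / s) * x\<^sup>2 / 2)) / sqrt (2 * pi)) \<partial>lborel)"
proof -
  define g where "g x = exp (- ((1 + 1 / s) * x\<^sup>2 / 2)) / sqrt (2 * pi)" for x :: real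
  have [measurable]: "g \<in> borel_measurable borel" and g0: "g x \<ge> 0" for x
    by (auto simp: g_def[abs_def])
  \<comment> \<open>Completing the square splits off the dependence on \<open>b\<close> as the
    factor \<open>exp (- (b\<^sup>2 / (2 * (1 + s))))\<close>. The remaining integral is rid of
    \<open>b\<close> by translation and is left unevaluated, since only its independence of
    \<open>b\<close> matters.\<close>
  have sq: "x\<^sup>2 / 2 + (x - b)\<^sup>2 / (2 * s) = (1 + 1 / s) * (x - b / (1 + s))\<^sup>2 / 2 + b\<^sup>2 / (2 * (1 + s))" for x
  proof -
    have "1 + s \<noteq> 0" "s \<noteq> 0" using s by auto
    then show ?thesis by (simp add: divide_simps power2_eq_square) algebra
  qed
  have pt: "std_normal_density x * exp (- ((x - b)\<^sup>2 / (2 * s))) = exp (- (b\<^sup>2 / (2 * (1 + s)))) * g (x - b / (1 + s))" for x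
  proof -
    have "std_normal_density x * exp (- ((x - b)\<^sup>2 / (2 * s)))
        = exp (- (x\<^sup>2 / 2 + (x - b)\<^sup>2 / (2 * s))) / sqrt (2 * pi)"
      by (simp add: std_normal_density_def exp_add[symmetric])
    also have "\<dots> = exp (- (b\<^sup>2 / (2 * (1 + s)))) * g (x - b / (1 + s))"
      unfolding sq g_def by (simp add: exp_add[symmetric])
    finally show ?thesis .
  qed
  have "(\<integral>\<^sup>+x. ennreal (exp (- ((x - b)\<^sup>2 / (2 * s)))) \<partial>std_normal_distribution)
      = (\<integral>\<^sup>+x. ennreal (std_normal_density x * exp (- ((x - b)\<^sup>2 / (2 * s)))) \<partial>lborel)"
    by (subst nn_integral_density) (auto simp: ennreal_mult)
  also have "\<dots> = ennreal (exp (- (b\<^sup>2 / (2 * (1 + s))))) * (\<integral>\<^sup>+x. ennreal (g (x - b / (1 + s))) \<partial>lborel)"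
    unfolding pt by (subst nn_integral_cmult[symmetric]) (auto simp: ennreal_mult g0)
  also have "(\<integral>\<^sup>+x. ennreal (g (x - b / (1 + s))) \<partial>lborel) = (\<integral>\<^sup>+x. ennreal (g x) \<partial>lborel)"
    by (subst nn_integral_real_affine[where c = 1 and t = "b / (1 + s)"]) (auto simp: g_def)
  finally show ?thesis by (simp add: g_def)
qed

abbreviation bump :: "'i set \<Rightarrow> real \<Rightarrow> ('i \<Rightarrow> real) \<Rightarrow> ('i \<Rightarrow> real) \<Rightarrow> ennreal" where
  "bump I s a x \<equiv> ennreal (exp (- ((\<Sum>i\<in>I. (x i - a i)\<^sup>2) / (2 * s))))"

text \<open>The bump factorizes over the coordinates, so its integral depends on the centre
  \<open>a\<close> only through the Euclidean norm. Orthogonal invariance rests on this.\<close>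

lemma nn_integral_gaussian_bump:
  fixes s :: real
  assumes s: "s > 0" and I: "finite I"
  shows "(\<integral>\<^sup>+x. bump I s a x \<partial>gaussian I)
    = ennreal (exp (- ((\<Sum>i\<in>I. (a i)\<^sup>2) / (2 * (1 + s)))))
      * (\<integral>\<^sup>+x. ennreal (exp (- ((1 + 1 / s) * x\<^sup>2 / 2)) / sqrt (2 * pi)) \<partial>lborel) ^ card I"
proof -
  have e: "ennreal (exp (- ((\<Sum>i\<in>I. f i) / c))) = (\<Prod>i\<in>I. ennreal (exp (- (f i / c))))" for f :: "'a \<Rightarrow> real" and c
    by (subst prod_ennreal) (auto simp: exp_sum[OF I, symmetric] sum_divide_distrib sum_negf)
  have "(\<integral>\<^sup>+x. bump I s a x \<partial>gaussian I)
    = (\<Prod>i\<in>I. \<integral>\<^sup>+x. ennreal (exp (- ((x - a i)\<^sup>2 / (2 * s)))) \<partial>std_normal_distribution)"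
    unfolding e by (rule gaussian.product_nn_integral_prod[OF I]) auto
  then show ?thesis unfolding nn_integral_std_normal_bump[OF s] e by (simp add: prod.distrib)
qed

text \<open>Here the centre \<open>a\<close> of the density is integrated, with the point
  \<open>t\<close> fixed; the substitution \<open>a = t - \<sigma> * y\<close> turns the half-line
  into a tail of the standard normal law.\<close>

lemma nn_integral_normal_density_atMost:
  fixes \<sigma> t c :: real
  assumes "\<sigma> > 0"
  shows "(\<integral>\<^sup>+a. ennreal (normal_density 0 \<sigma> (t - a)) * indicator {..c} a \<partial>lborel)
    = ennreal (measure std_normal_distribution {(t - c) / \<sigma>..})"
proof -
  have "(\<integral>\<^sup>+a. ennreal (normal_density 0 \<sigma> (t - a)) * indicator {..c} a \<partial>lborel)
      = ennreal \<sigma> * (\<integral>\<^sup>+y. ennreal (normal_density 0 \<sigma> (\<sigma> * y)) * indicator {..c} (t + (- \<sigma>) * y) \<partial>lborel)"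
    using assms by (subst nn_integral_real_affine[where c = "- \<sigma>" and t = t]) auto
  also have "\<dots> = (\<integral>\<^sup>+y. ennreal (std_normal_density y) * indicator {(t - c) / \<sigma>..} y \<partial>lborel)"
  proof (subst nn_integral_cmult[symmetric], simp, intro nn_integral_cong)
    fix y :: real
    have "\<sigma> * normal_density 0 \<sigma> (\<sigma> * y) = std_normal_density y"
      using assms by (simp add: normal_density_def real_sqrt_mult power_mult_distrib)
    moreover have "indicator {..c} (t + (- \<sigma>) * y) = (indicator {(t - c) / \<sigma>..} y :: ennreal)"
      using assms by (auto simp: indicator_def field_simps)
    ultimately show "ennreal \<sigma> * (ennreal (normal_density 0 \<sigma> (\<sigma> * y)) * indicator {..c} (t + (- \<sigma>) * y))
        = ennreal (std_normal_density y) * indicator {(t - c) / \<sigma>..} y"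
      using assms by (simp add: mult.assoc[symmetric] ennreal_mult[symmetric])
  qed
  also have "\<dots> = emeasure std_normal_distribution {(t - c) / \<sigma>..}"
    by (subst emeasure_density) auto
  finally show ?thesis by (simp add: std_normal.emeasure_eq_measure)
qed

text \<open>The truth value \<open>P\<close> merges the limits 0 and 1 into one statement, so that
  the limit can be read as an indicator. The half-lines swallow every point or recede from every
  point, and dominated convergence applies.\<close>

lemma std_normal_atLeast_tendsto:
  fixes f :: "nat \<Rightarrow> real"
  assumes "(P \<and> filterlim f at_bot sequentially) \<or> (\<not> P \<and> filterlim f at_top sequentially)"
  shows "(\<lambda>n. measure std_normal_distribution {f n..}) \<longlonglongrightarrow> (if P then 1 else 0)"
proof -
  have "(\<lambda>n. \<integral>x. (indicator {f n..} x :: real) \<partial>std_normal_distribution)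
      \<longlonglongrightarrow> (\<integral>x. (if P then 1 else (0::real)) \<partial>std_normal_distribution)"
  proof (rule integral_dominated_convergence[where w = "\<lambda>_. 1"])
    show "AE x in std_normal_distribution. (\<lambda>n. indicator {f n..} x) \<longlonglongrightarrow> (if P then 1 else (0::real))"
    proof (rule AE_I2)
      fix x
      show "(\<lambda>n. indicator {f n..} x) \<longlonglongrightarrow> (if P then 1 else (0::real))"
      proof (rule tendsto_eventually)
        show "\<forall>\<^sub>F n in sequentially. indicator {f n..} x = (if P then 1 else (0::real))"
        proof (cases P)
          case True
          then have "\<forall>\<^sub>F n in sequentially. f n \<le> x"
            using assms by (auto simp: filterlim_at_bot)
          then show ?thesis by eventually_elim (simp add: True)
        next
          case False
          then have "\<forall>\<^sub>F n in sequentially. x < f n"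
            using assms by (auto simp: filterlim_at_top_dense)
          then show ?thesis by eventually_elim (simp add: False)
        qed
      qed
    qed
  qed (auto simp: indicator_def)
  moreover have "measure std_normal_distribution UNIV = 1" using std_normal.prob_space by simp
  ultimately show ?thesis by (auto split: if_splits)
qed

text \<open>Lower orthants are closed under intersection, so two probability measures that agree on
  this generator are equal.\<close>

lemma sigma_PiM_atMost:
  assumes I: "finite I"
  shows "sets (PiM I (\<lambda>_. borel :: real measure)) =
    sigma_sets (\<Pi>\<^sub>E i\<in>I. UNIV) {Pi\<^sub>E I (\<lambda>i. {..b i :: real}) | b. True}"
  (is "_ = sigma_sets ?S ?E")
proof -
  have "sets (PiM I (\<lambda>_. borel :: real measure)) =
      sets (PiM I (\<lambda>_. sigma UNIV (range (\<lambda>a::real. {..a}))))"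
    by (simp add: borel_eq_atMost)
  also have "\<dots> = sets (sigma (\<Pi>\<^sub>E i\<in>I. UNIV) {Pi\<^sub>E I A | A. \<forall>i\<in>I. A i \<in> range (\<lambda>a::real. {..a})})"
  proof -
    have "sets (PiM I (\<lambda>i. sigma ((\<lambda>_. UNIV) i) ((\<lambda>_. range (\<lambda>a::real. {..a})) i))) =
      sets (sigma (Pi\<^sub>E I (\<lambda>_. UNIV)) {{f\<in>Pi\<^sub>E I (\<lambda>_. UNIV). \<forall>i\<in>j. f i \<in> A i} |A j. j \<in> {I} \<and> A \<in> Pi j (\<lambda>_. range (\<lambda>a::real. {..a}))})"
    proof (rule sets_PiM_sigma)
      show "\<exists>S\<subseteq>range (\<lambda>a::real. {..a}). countable S \<and> UNIV = \<Union> S" if "i \<in> I" for i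
        by (rule exI[of _ "range (\<lambda>n::nat. {..real n})"]) (auto intro: real_arch_simple)
    qed (use I in auto)
    also have "{{f\<in>Pi\<^sub>E I (\<lambda>_. UNIV). \<forall>i\<in>j. f i \<in> A i} |A j. j \<in> {I} \<and> A \<in> Pi j (\<lambda>_. range (\<lambda>a::real. {..a}))}
       = {Pi\<^sub>E I A | A. \<forall>i\<in>I. A i \<in> range (\<lambda>a::real. {..a})}"
    proof -
      have "{f\<in>Pi\<^sub>E I (\<lambda>_. UNIV). \<forall>i\<in>I. f i \<in> A i} = Pi\<^sub>E I A" for A :: "'a \<Rightarrow> real set" by (auto simp: PiE_def extensional_def)
      then show ?thesis by (auto simp: Pi_iff)
    qed
    finally show ?thesis .
  qed
  also have "\<dots> = sigma_sets ?S {Pi\<^sub>E I A | A. \<forall>i\<in>I. A i \<in> range (\<lambda>a::real. {..a})}"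
    by (rule sets_measure_of) auto
  also have "{Pi\<^sub>E I A | A. \<forall>i\<in>I. A i \<in> range (\<lambda>a::real. {..a})} = ?E"
  proof (intro equalityI subsetI)
    fix X assume "X \<in> {Pi\<^sub>E I A | A. \<forall>i\<in>I. A i \<in> range (\<lambda>a::real. {..a})}"
    then obtain A where A: "X = Pi\<^sub>E I A" "\<forall>i\<in>I. A i \<in> range (\<lambda>a::real. {..a})" by blast
    then have "\<forall>i\<in>I. \<exists>a. A i = {..a}" by blast
    then obtain b where "\<forall>i\<in>I. A i = {..b i}" by metis
    then have "X = Pi\<^sub>E I (\<lambda>i. {..b i})" using A(1) by (auto intro!: PiE_cong)
    then show "X \<in> ?E" by blast
  qed auto
  finally show ?thesis .
qed

text \<open>Averaging Gaussian bumps over their centres in a slightly enlarged box gives functions which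
  converge to the indicator of the box as the width of the bumps vanishes.\<close>

lemma emeasure_box_limit:
  fixes \<mu> :: "('i \<Rightarrow> real) measure"
  assumes I: "finite I" and "prob_space \<mu>" and sets: "sets \<mu> = sets (PiM I (\<lambda>_. borel))"
  shows "(\<lambda>n. \<integral>\<^sup>+a. (\<integral>\<^sup>+x. (\<Prod>i\<in>I. ennreal (normal_density 0 (1 / (real (Suc n))\<^sup>2) (x i - a i))) \<partial>\<mu>)
        * (\<Prod>i\<in>I. indicator {..b i + 1 / real (Suc n)} (a i)) \<partial>PiM I (\<lambda>_. lborel))
    \<longlonglongrightarrow> emeasure \<mu> (Pi\<^sub>E I (\<lambda>i. {..b i}))"
proof -
  interpret \<mu>: prob_space \<mu> by fact
  interpret lb: product_sigma_finite "\<lambda>_::'i. lborel :: real measure" by standard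
  interpret lbI: finite_product_sigma_finite "\<lambda>_::'i. lborel :: real measure" I by standard fact
  interpret pair_sigma_finite \<mu> "PiM I (\<lambda>_. lborel :: real measure)" by standard
  note sets[measurable_cong]
  \<comment> \<open>The width has the order of the square of the enlargement
    \<open>1 / real (Suc n)\<close> of the box. Hence at a boundary point \<open>t = b i\<close> the
    normalized distance is \<open>- real (Suc n)\<close>, and the limit there is 1 as the closed box
    demands, not 1/2.\<close>
  define \<sigma> where "\<sigma> n = 1 / (real (Suc n))\<^sup>2" for n
  define b' where "b' n i = b i + 1 / real (Suc n)" for n i
  have \<sigma>: "\<sigma> n > 0" for n by (simp add: \<sigma>_def)
  define k where "k n i t = measure std_normal_distribution {(t - b' n i) / \<sigma> n..}" for n i t
  have space: "space \<mu> = (\<Pi>\<^sub>E i\<in>I. UNIV)" using sets_eq_imp_space_eq[OF sets] by (simp add: space_PiM)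
  have F: "(\<integral>\<^sup>+a. (\<integral>\<^sup>+x. (\<Prod>i\<in>I. ennreal (normal_density 0 (\<sigma> n) (x i - a i))) \<partial>\<mu>)
        * (\<Prod>i\<in>I. indicator {..b' n i} (a i)) \<partial>PiM I (\<lambda>_. lborel))
     = (\<integral>\<^sup>+x. ennreal (\<Prod>i\<in>I. k n i (x i)) \<partial>\<mu>)" for n
  proof -
    have "(\<integral>\<^sup>+a. (\<integral>\<^sup>+x. (\<Prod>i\<in>I. ennreal (normal_density 0 (\<sigma> n) (x i - a i))) \<partial>\<mu>)
        * (\<Prod>i\<in>I. indicator {..b' n i} (a i)) \<partial>PiM I (\<lambda>_. lborel))
      = (\<integral>\<^sup>+a. (\<integral>\<^sup>+x. (\<Prod>i\<in>I. ennreal (normal_density 0 (\<sigma> n) (x i - a i)) * indicator {..b' n i} (a i)) \<partial>\<mu>)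
         \<partial>PiM I (\<lambda>_. lborel))"
      by (intro nn_integral_cong) (simp add: prod.distrib nn_integral_multc)
    also have "\<dots> = (\<integral>\<^sup>+x. (\<integral>\<^sup>+a. (\<Prod>i\<in>I. ennreal (normal_density 0 (\<sigma> n) (x i - a i)) * indicator {..b' n i} (a i)) 
         \<partial>PiM I (\<lambda>_. lborel)) \<partial>\<mu>)"
      by (rule Fubini') (use I in measurable)
    also have "\<dots> = (\<integral>\<^sup>+x. ennreal (\<Prod>i\<in>I. k n i (x i)) \<partial>\<mu>)"
    proof (intro nn_integral_cong)
      fix x
      have "(\<integral>\<^sup>+a. (\<Prod>i\<in>I. ennreal (normal_density 0 (\<sigma> n) (x i - a i)) * indicator {..b' n i} (a i)) 
         \<partial>PiM I (\<lambda>_. lborel)) = (\<Prod>i\<in>I. \<integral>\<^sup>+a. ennreal (normal_density 0 (\<sigma> n) (x i - a)) * indicator {..b' n i} a \<partial>lborel)"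
        by (rule lb.product_nn_integral_prod[OF I]) auto
      then show "(\<integral>\<^sup>+a. (\<Prod>i\<in>I. ennreal (normal_density 0 (\<sigma> n) (x i - a i)) * indicator {..b' n i} (a i)) 
         \<partial>PiM I (\<lambda>_. lborel)) = ennreal (\<Prod>i\<in>I. k n i (x i))"
        by (simp add: nn_integral_normal_density_atMost[OF \<sigma>] k_def prod_ennreal)
    qed
    finally show ?thesis .
  qed
  have klim: "(\<lambda>n. k n i t) \<longlonglongrightarrow> (if t \<le> b i then 1 else 0)" for i t
    unfolding k_def
  proof (rule std_normal_atLeast_tendsto)
    have eq: "(t - b' n i) / \<sigma> n = (t - b i) * (real (Suc n))\<^sup>2 - real (Suc n)" for n
    proof -
      have "(t - (b i + 1 / m)) / (1 / m\<^sup>2) = (t - b i) * m\<^sup>2 - m" if "m \<noteq> 0" for m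
        using that by (simp add: power2_eq_square field_simps)
      from this[of "real (Suc n)"] show ?thesis by (simp add: \<sigma>_def b'_def)
    qed
    show "t \<le> b i \<and> (LIM n sequentially. (t - b' n i) / \<sigma> n :> at_bot) \<or>
        \<not> t \<le> b i \<and> (LIM n sequentially. (t - b' n i) / \<sigma> n :> at_top)"
    proof (cases "t \<le> b i")
      case True
      have "LIM n sequentially. - real (Suc n) :> at_bot" by real_asymp
      moreover have "(t - b i) * (real (Suc n))\<^sup>2 - real (Suc n) \<le> - real (Suc n)" for n
        using True by (simp add: mult_nonpos_nonneg)
      ultimately show ?thesis unfolding eq using True
        by (auto intro: filterlim_at_bot_mono)
    next
      case False
      define c where "c = t - b i"
      have "c > 0" using False by (simp add: c_def)
      then have "LIM n sequentially. c * (real (Suc n))\<^sup>2 - real (Suc n) :> at_top" by real_asymp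
      then show ?thesis unfolding eq using False by (simp add: c_def)
    qed
  qed
  have P: "(\<Prod>i\<in>I. if x i \<le> b i then 1 else (0::real)) = (if \<forall>i\<in>I. x i \<le> b i then 1 else 0)" for x
    using I by induction auto
  have "(\<lambda>n. \<integral>\<^sup>+x. ennreal (\<Prod>i\<in>I. k n i (x i)) \<partial>\<mu>)
      \<longlonglongrightarrow> (\<integral>\<^sup>+x. ennreal (\<Prod>i\<in>I. if x i \<le> b i then 1 else 0) \<partial>\<mu>)"
  proof (rule nn_integral_dominated_convergence[where w = "\<lambda>_. 1"])
    have "(\<lambda>x. k n i (x i)) \<in> borel_measurable \<mu>" if "i \<in> I" for n i
    proof -
      \<comment> \<open>Measurability in \<open>t\<close> comes from monotonicity: a tail
        probability decreases as its left end moves right.\<close>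
      have "mono (\<lambda>t. - k n i t)" unfolding k_def
        by (intro monoI le_imp_neg_le std_normal.finite_measure_mono)
           (auto intro!: divide_right_mono less_imp_le[OF \<sigma>])
      then have "(\<lambda>t. - k n i t) \<in> borel_measurable borel" by (rule borel_measurable_mono)
      then have [measurable]: "k n i \<in> borel_measurable borel" by simp
      then show ?thesis using that by measurable
    qed
    then show "(\<lambda>x. ennreal (\<Prod>i\<in>I. k n i (x i))) \<in> borel_measurable \<mu>" for n by measurable
    show "(\<lambda>x. ennreal (\<Prod>i\<in>I. if x i \<le> b i then 1 else 0)) \<in> borel_measurable \<mu>"
      by measurable
    show "AE x in \<mu>. ennreal (\<Prod>i\<in>I. k n i (x i)) \<le> 1" for n
      by (rule AE_I2) (auto intro!: prod_le_1 simp: k_def)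
    show "AE x in \<mu>. (\<lambda>n. ennreal (\<Prod>i\<in>I. k n i (x i))) \<longlonglongrightarrow> ennreal (\<Prod>i\<in>I. if x i \<le> b i then 1 else 0)"
      by (intro AE_I2 tendsto_ennrealI tendsto_prod klim)
  qed (auto simp: \<mu>.emeasure_space_1)
  also have "(\<integral>\<^sup>+x. ennreal (\<Prod>i\<in>I. if x i \<le> b i then 1 else 0) \<partial>\<mu>)
      = (\<integral>\<^sup>+x. indicator (Pi\<^sub>E I (\<lambda>i. {..b i})) x \<partial>\<mu>)"
    unfolding P by (intro nn_integral_cong) (auto simp: space indicator_def PiE_iff)
  also have "\<dots> = emeasure \<mu> (Pi\<^sub>E I (\<lambda>i. {..b i}))"
    by (rule nn_integral_indicator) (use I in \<open>auto simp: sets intro!: sets_PiM_I_finite\<close>)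
  finally show ?thesis unfolding F[symmetric] by (simp add: \<sigma>_def b'_def)
qed

text \<open>A product of normal densities of deviation \<sigma> is a constant multiple of a bump of
  width \<open>\<sigma>\<^sup>2\<close>. So the averages that approximate the probability of an
  orthant are the same for both measures, and so are their limits.\<close>

lemma measure_eqI_gaussian_bumps:
  fixes \<mu> \<nu> :: "('i \<Rightarrow> real) measure"
  assumes I: "finite I" and "prob_space \<mu>" "prob_space \<nu>"
    and sets: "sets \<mu> = sets (PiM I (\<lambda>_. borel))" "sets \<nu> = sets (PiM I (\<lambda>_. borel))"
    and eq: "\<And>s a. s > 0 \<Longrightarrow> (\<integral>\<^sup>+x. bump I s a x \<partial>\<mu>)
      = (\<integral>\<^sup>+x. bump I s a x \<partial>\<nu>)"
  shows "\<mu> = \<nu>"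
proof (rule measure_eqI_generator_eq[where \<Omega> = "\<Pi>\<^sub>E i\<in>I. UNIV" and E = "{Pi\<^sub>E I (\<lambda>i. {..b i :: real}) | b. True}"
    and A = "\<lambda>n. Pi\<^sub>E I (\<lambda>_. {..real n})"])
  interpret \<mu>: prob_space \<mu> by fact
  show "Int_stable {Pi\<^sub>E I (\<lambda>i. {..b i :: real}) | b. True}"
  proof (rule Int_stableI)
    fix X Y :: "('i \<Rightarrow> real) set" assume "X \<in> {Pi\<^sub>E I (\<lambda>i. {..b i :: real}) | b. True}" "Y \<in> {Pi\<^sub>E I (\<lambda>i. {..b i :: real}) | b. True}"
    then obtain b c :: "'i \<Rightarrow> real" where bc: "X = Pi\<^sub>E I (\<lambda>i. {..b i})" "Y = Pi\<^sub>E I (\<lambda>i. {..c i})" by auto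
    then have "X \<inter> Y = Pi\<^sub>E I (\<lambda>i. {..min (b i) (c i)})" by (auto simp: PiE_iff)
    then show "X \<inter> Y \<in> {Pi\<^sub>E I (\<lambda>i. {..b i :: real}) | b. True}"
      by (auto intro: exI[of _ "\<lambda>i. min (b i) (c i)"])
  qed
  show "(\<Union>n. Pi\<^sub>E I (\<lambda>_. {..real n})) = (\<Pi>\<^sub>E i\<in>I. UNIV)"
  proof (intro equalityI subsetI)
    fix x :: "'i \<Rightarrow> real" assume x: "x \<in> (\<Pi>\<^sub>E i\<in>I. UNIV)"
    obtain n where n: "(\<Sum>i\<in>I. \<bar>x i\<bar>) \<le> real n" using real_arch_simple by blast
    have "x i \<le> real n" if "i \<in> I" for i
    proof -
      have "\<bar>x i\<bar> \<le> (\<Sum>i\<in>I. \<bar>x i\<bar>)" using I that by (intro member_le_sum) auto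
      then show ?thesis using n by linarith
    qed
    then show "x \<in> (\<Union>n. Pi\<^sub>E I (\<lambda>_. {..real n}))" using x by (auto simp: PiE_iff)
  qed (auto simp: PiE_iff)
  fix X assume "X \<in> {Pi\<^sub>E I (\<lambda>i. {..b i :: real}) | b. True}"
  then obtain b where X: "X = Pi\<^sub>E I (\<lambda>i. {..b i})" by blast
  have "(\<integral>\<^sup>+x. (\<Prod>i\<in>I. ennreal (normal_density 0 \<sigma> (x i - a i))) \<partial>\<mu>)
      = (\<integral>\<^sup>+x. (\<Prod>i\<in>I. ennreal (normal_density 0 \<sigma> (x i - a i))) \<partial>\<nu>)" if \<sigma>: "\<sigma> > 0" for a \<sigma>
  proof -
    have *: "(\<Prod>i\<in>I. ennreal (normal_density 0 \<sigma> (x i - a i)))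
      = ennreal ((1 / sqrt (2 * pi * \<sigma>\<^sup>2)) ^ card I) * bump I (\<sigma>\<^sup>2) a x" for x
      using I by (simp add: prod_ennreal normal_density_def prod_dividef exp_sum[OF I, symmetric]
          sum_divide_distrib sum_negf ennreal_mult[symmetric] power_divide)
    have m: "(\<lambda>x. bump I (\<sigma>\<^sup>2) a x) \<in> borel_measurable (PiM I (\<lambda>_. borel))"
      by measurable
    show ?thesis unfolding *
      using eq[of "\<sigma>\<^sup>2"] \<sigma> m
      by (subst (1 2) nn_integral_cmult) (auto simp: measurable_cong_sets[OF sets(1) refl] measurable_cong_sets[OF sets(2) refl])
  qed
  then have "(\<integral>\<^sup>+x. (\<Prod>i\<in>I. ennreal (normal_density 0 (1 / (real (Suc n))\<^sup>2) (x i - a i))) \<partial>\<mu>)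
      = (\<integral>\<^sup>+x. (\<Prod>i\<in>I. ennreal (normal_density 0 (1 / (real (Suc n))\<^sup>2) (x i - a i))) \<partial>\<nu>)" for n a
    by simp
  then show "emeasure \<mu> X = emeasure \<nu> X"
    using emeasure_box_limit[OF I assms(2) sets(1), of b] emeasure_box_limit[OF I assms(3) sets(2), of b]
    unfolding X by (auto intro: LIMSEQ_unique)
qed (auto simp: sets sigma_PiM_atMost[OF I] PiE_iff prob_space.emeasure_space_1[OF assms(2)]
    finite_measure.emeasure_finite[OF prob_space.finite_measure[OF assms(2)]])

text \<open>Orthogonality is encoded by a map \<open>L'\<close> that is both adjoint and inverse to
  \<open>L\<close> on \<open>I\<close>; this form fits vectors, arrays and symmetric matrices alike.
  Composition with \<open>L\<close> moves a bump from centre \<open>a\<close> to centre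
  \<open>L' a\<close> of equal norm, and the integral of a bump sees only that norm.\<close>

theorem gaussian_orthogonal_invariant:
  fixes L L' :: "('i \<Rightarrow> real) \<Rightarrow> 'i \<Rightarrow> real"
  assumes I: "finite I"
    and L: "L \<in> measurable (PiM I (\<lambda>_. borel)) (PiM I (\<lambda>_. borel))"
    and adj: "\<And>x y. (\<Sum>i\<in>I. L x i * y i) = (\<Sum>i\<in>I. x i * L' y i)"
    and LL': "\<And>x i. i \<in> I \<Longrightarrow> L' (L x) i = x i" "\<And>x i. i \<in> I \<Longrightarrow> L (L' x) i = x i"
  shows "distr (gaussian I) (gaussian I) L = gaussian I"
proof (rule measure_eqI_gaussian_bumps[OF I])
  have Lm[measurable]: "L \<in> measurable (gaussian I) (gaussian I)"
    using L by (simp add: measurable_cong_sets[OF sets_gaussian sets_gaussian])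
  show "prob_space (distr (gaussian I) (gaussian I) L)"
    by (rule prob_space.prob_space_distr[OF prob_space_gaussian Lm])
  show "prob_space (gaussian I)" by (rule prob_space_gaussian)
  fix s :: real and a :: "'i \<Rightarrow> real" assume s: "s > 0"
  have norm1: "(\<Sum>i\<in>I. (L x i)\<^sup>2) = (\<Sum>i\<in>I. (x i)\<^sup>2)" for x
    using adj[of x "L x"] LL'(1) by (simp add: power2_eq_square)
  have norm2: "(\<Sum>i\<in>I. (L' a i)\<^sup>2) = (\<Sum>i\<in>I. (a i)\<^sup>2)"
    using adj[of "L' a" a] LL'(2) by (simp add: power2_eq_square)
  have e: "(\<Sum>i\<in>I. (L x i - a i)\<^sup>2) = (\<Sum>i\<in>I. (x i - L' a i)\<^sup>2)" for x
  proof -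
    have "(\<Sum>i\<in>I. (L x i - a i)\<^sup>2) = (\<Sum>i\<in>I. (L x i)\<^sup>2) + (\<Sum>i\<in>I. (a i)\<^sup>2) - 2 * (\<Sum>i\<in>I. L x i * a i)"
      by (simp add: power2_diff sum.distrib sum_subtractf sum_distrib_left mult.assoc)
    also have "\<dots> = (\<Sum>i\<in>I. (x i)\<^sup>2) + (\<Sum>i\<in>I. (L' a i)\<^sup>2) - 2 * (\<Sum>i\<in>I. x i * L' a i)"
      using norm1 norm2 adj by simp
    also have "\<dots> = (\<Sum>i\<in>I. (x i - L' a i)\<^sup>2)"
      by (simp add: power2_diff sum.distrib sum_subtractf sum_distrib_left mult.assoc)
    finally show ?thesis .
  qed
  have "(\<integral>\<^sup>+x. bump I s a x \<partial>distr (gaussian I) (gaussian I) L)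
      = (\<integral>\<^sup>+x. bump I s (L' a) x \<partial>gaussian I)"
    by (subst nn_integral_distr) (auto simp: e)
  then show "(\<integral>\<^sup>+x. bump I s a x \<partial>distr (gaussian I) (gaussian I) L)
      = (\<integral>\<^sup>+x. bump I s a x \<partial>gaussian I)"
    using nn_integral_gaussian_bump[OF s I] norm2 by simp
qed (auto simp: sets_gaussian)

section \<open>Simplicity of the spectrum\<close>

text \<open>Projection along a compact factor is a closed map. With the unit sphere as
  \<open>K\<close>, conditions asserting that some eigenvector exists become closed, hence
  measurable.\<close>

lemma closed_compact_exists:
  fixes K :: "'b::topological_space set" and C :: "('a::topological_space \<times> 'b) set"
  assumes K: "compact K" and C: "closed C"
  shows "closed {x. \<exists>u\<in>K. (x, u) \<in> C}"
proof -
  have "closed_map (prod_topology euclidean (top_of_set K)) (euclidean :: 'a topology) fst"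
    by (rule Abstract_Topological_Spaces.closed_map_fst) (use K in \<open>simp add: compact_space_subtopology\<close>)
  moreover have "closedin (prod_topology euclidean (top_of_set K)) (C \<inter> (UNIV \<times> K))"
  proof -
    have "prod_topology euclidean (top_of_set K) = top_of_set (UNIV \<times> K :: ('a \<times> 'b) set)"
      by (simp add: prod_topology_subtopology)
    then show ?thesis using C closedin_closed_Int[of C "UNIV \<times> K"] by (simp add: Int_commute)
  qed
  ultimately have "closed (fst ` (C \<inter> (UNIV \<times> K)))"
    by (simp add: closed_map_def)
  moreover have "fst ` (C \<inter> (UNIV \<times> K)) = {x. \<exists>u\<in>K. (x, u) \<in> C}" by force
  ultimately show ?thesis by simp
qed

text \<open>Points of the product space are constantly \<open>undefined\<close> outside
  \<open>I\<close>, so every coordinate is measurable, and over a countable index type this gives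
  measurability into the full function space. Topological arguments there thus apply to the Gaussian
  measure.\<close>

lemma measurable_gaussian_borel:
  "(\<lambda>x. x) \<in> measurable (gaussian (I :: 'i::countable set)) borel"
proof (rule measurable_coordinatewise_then_product)
  fix i
  show "(\<lambda>x. x i) \<in> borel_measurable (gaussian I)"
  proof (cases "i \<in> I")
    case True
    then show ?thesis by measurable
  next
    case False
    have "(\<lambda>x. undefined :: real) \<in> borel_measurable (gaussian I)" by simp
    then show ?thesis
      by (rule measurable_cong[THEN iffD1, rotated]) (use False in \<open>auto simp: space_gaussian PiE_iff extensional_def\<close>)
  qed
qed

lemma sets_gaussian_closed:
  assumes "closed {x :: 'i::countable \<Rightarrow> real. P x}"
  shows "{x \<in> space (gaussian I). P x} \<in> sets (gaussian I)"
proof -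
  have "(\<lambda>x. x) -` {x. P x} \<inter> space (gaussian I) \<in> sets (gaussian I)"
    by (rule measurable_sets[OF measurable_gaussian_borel]) (use assms in auto)
  then show ?thesis by (simp add: vimage_def Int_def conj_commute)
qed

text \<open>With the other coordinates fixed, at most one value of coordinate \<open>i0\<close>
  solves the equation, and the normal law has no atoms.\<close>

lemma AE_gaussian_linear_nonzero:
  assumes I: "finite I" and i0: "i0 \<in> I" "c i0 \<noteq> 0"
  shows "AE x in gaussian I. (\<Sum>i\<in>I. c i * x i) \<noteq> (0::real)"
proof -
  define J where "J = I - {i0}"
  have J: "finite J" "i0 \<notin> J" "I = insert i0 J" using I i0 by (auto simp: J_def)
  define B where "B = {x \<in> space (gaussian I). (\<Sum>i\<in>I. c i * x i) = 0}"
  have B[measurable]: "B \<in> sets (gaussian I)" unfolding B_def by measurable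
  have "emeasure (gaussian I) B = (\<integral>\<^sup>+x. indicator B x \<partial>gaussian (insert i0 J))"
    using B J(3) by simp
  also have "\<dots> = (\<integral>\<^sup>+x. (\<integral>\<^sup>+y. indicator B (x(i0 := y)) \<partial>std_normal_distribution) \<partial>gaussian J)"
    by (rule gaussian.product_nn_integral_insert[OF J(1,2)]) (use B J(3) in simp)
  also have "\<dots> = (\<integral>\<^sup>+x. 0 \<partial>gaussian J)"
  proof (intro nn_integral_cong)
    fix x
    define a where "a = - (\<Sum>i\<in>J. c i * x i) / c i0"
    have "y = a" if "x(i0 := y) \<in> B" for y
    proof -
      have "(\<Sum>i\<in>J. c i * (x(i0 := y)) i) = (\<Sum>i\<in>J. c i * x i)"
        using J(2) by (intro sum.cong) auto
      then have "c i0 * y + (\<Sum>i\<in>J. c i * x i) = 0"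
        using that J by (simp add: B_def)
      then show ?thesis using i0(2) by (simp add: a_def field_simps)
    qed
    then have "(\<integral>\<^sup>+y. indicator B (x(i0 := y)) \<partial>std_normal_distribution)
       \<le> (\<integral>\<^sup>+y. indicator {a} y \<partial>std_normal_distribution)"
      by (intro nn_integral_mono) (auto simp: indicator_def)
    also have "\<dots> = 0" by (simp add: emeasure_density)
    finally show "(\<integral>\<^sup>+y. indicator B (x(i0 := y)) \<partial>std_normal_distribution) = 0" by simp
  qed
  finally have "B \<in> null_sets (gaussian I)" using B by (simp add: null_setsI)
  then show ?thesis by (rule AE_I') (auto simp: B_def)
qed

section \<open>Unit eigenvectors and simple spectra\<close>

definition eigvec :: "nat \<Rightarrow> (nat \<Rightarrow> nat \<Rightarrow> real) \<Rightarrow> real \<Rightarrow> (nat \<Rightarrow> real) \<Rightarrow> bool" where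
  "eigvec n H l u \<longleftrightarrow> ip n u u = 1 \<and> (\<forall>i<n. mv n H u i = l * u i)"

lemma unit_eigenvector_iff: "unit_eigenvector n H u \<longleftrightarrow> (\<exists>l. eigvec n H l u)"
  by (auto simp: unit_eigenvector_def eigvec_def ip_def mv_def power2_eq_square)

lemma eigvec_rayleigh: "eigvec n H l u \<Longrightarrow> l = ip n u (mv n H u)"
proof -
  assume u: "eigvec n H l u"
  then have "ip n u (mv n H u) = ip n u (\<lambda>i. l * u i)" by (intro ip_cong) (auto simp: eigvec_def)
  then show ?thesis using u by (simp add: ip_simps eigvec_def)
qed

lemma eigvec_cong: "(\<And>i. i < n \<Longrightarrow> u i = v i) \<Longrightarrow> eigvec n H l u \<longleftrightarrow> eigvec n H l v"
  by (simp add: eigvec_def ip_def mv_def)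

text \<open>The eigenvalue is recovered as the Rayleigh quotient and irrelevant coordinates are set
  to 0. What remains is existence over a compact set of a point satisfying equations continuous in
  all data, as \<open>closed_compact_exists\<close> expects.\<close>

lemma ex_eigvec_sphere:
  assumes P: "\<And>u v. (\<And>i. i < n \<Longrightarrow> u i = v i) \<Longrightarrow> P u \<longleftrightarrow> P v"
  shows "(\<exists>u l. eigvec n H l u \<and> P u) \<longleftrightarrow>
    (\<exists>u\<in>sphere_fun n. (\<forall>i\<in>{..<n}. mv n H u i = ip n u (mv n H u) * u i) \<and> P u)" (is "?l \<longleftrightarrow> ?r")
proof
  assume ?l
  then obtain u l where u: "eigvec n H l u" "P u" by blast
  define v where "v i = (if i < n then u i else 0)" for i
  have v: "eigvec n H l v" using eigvec_cong[of n u v H l] u(1) by (simp add: v_def)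
  have "P v" using P[of u v] u(2) by (simp add: v_def)
  moreover have "v \<in> sphere_fun n" using v by (auto simp: sphere_fun_def v_def eigvec_def)
  moreover have "mv n H v i = ip n v (mv n H v) * v i" if "i < n" for i
    using v eigvec_rayleigh[OF v] that by (simp add: eigvec_def)
  ultimately show ?r by auto
qed (auto simp: eigvec_def sphere_fun_def)

text \<open>For a symmetric matrix a repeated eigenvalue is one with two orthogonal unit
  eigenvectors; this phrasing avoids multiplicities and eigenspaces.\<close>

definition simple_spectrum :: "nat \<Rightarrow> (nat \<Rightarrow> nat \<Rightarrow> real) \<Rightarrow> bool" where
  "simple_spectrum n H \<longleftrightarrow> \<not> (\<exists>u v l. eigvec n H l u \<and> eigvec n H l v \<and> ip n u v = 0)"

text \<open>A two-dimensional eigenspace contains a vector with vanishing last coordinate. Hence a repeated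
  eigenvalue can only appear when the new column is orthogonal to an eigenvector of the leading minor,
  and a minor with simple spectrum has only finitely many of these up to sign.\<close>

lemma not_simple_spectrum_SucD:
  assumes "\<not> simple_spectrum (Suc n) H"
  shows "\<exists>v l. eigvec n H l v \<and> (\<Sum>i<n. H n i * v i) = 0"
proof -
  obtain u v l where u: "eigvec (Suc n) H l u" and v: "eigvec (Suc n) H l v" and uv: "ip (Suc n) u v = 0"
    using assms by (auto simp: simple_spectrum_def)
  have "\<exists>x. x n = 0 \<and> eigvec (Suc n) H l x"
  proof (cases "u n = 0")
    case False
    define m where "m = (u n)\<^sup>2 + (v n)\<^sup>2"
    have m: "m > 0" using False by (simp add: m_def add_pos_nonneg)
    \<comment> \<open>The combination that kills coordinate \<open>n\<close>. Since \<open>u\<close>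
      and \<open>v\<close> are orthonormal, its squared length before scaling is
      \<open>m\<close>.\<close>
    define x where "x = (\<lambda>i. 1 / sqrt m * (v n * u i - u n * v i))"
    have "ip (Suc n) x x = 1 / m * ((v n)\<^sup>2 * ip (Suc n) u u + (u n)\<^sup>2 * ip (Suc n) v v - 2 * u n * v n * ip (Suc n) u v)"
      using m unfolding x_def by (simp only: ip_simps ip_commute[of "Suc n" v u]) (simp add: power2_eq_square algebra_simps)
    then have "ip (Suc n) x x = 1" using u v uv m False by (simp add: eigvec_def m_def add.commute)
    moreover have mvx: "mv (Suc n) H x i = 1 / sqrt m * (v n * mv (Suc n) H u i - u n * mv (Suc n) H v i)" for i
      unfolding mv_def x_def by (simp add: sum_distrib_left sum_subtractf sum_divide_distrib algebra_simps diff_divide_distrib add_divide_distrib)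
    have "mv (Suc n) H x i = l * x i" if "i < Suc n" for i
    proof -
      have "mv (Suc n) H u i = l * u i" "mv (Suc n) H v i = l * v i" using u v that by (auto simp: eigvec_def)
      then show ?thesis unfolding mvx by (simp add: x_def algebra_simps)
    qed
    ultimately have "eigvec (Suc n) H l x" by (simp add: eigvec_def)
    moreover have "x n = 0" by (simp add: x_def)
    ultimately show ?thesis by blast
  qed (use u in blast)
  then obtain x where x: "x n = 0" "ip (Suc n) x x = 1" "\<forall>i<Suc n. mv (Suc n) H x i = l * x i"
    by (auto simp: eigvec_def)
  have "mv (Suc n) H x i = mv n H x i" for i using x(1) by (simp add: mv_def)
  then have "eigvec n H l x" "mv n H x n = 0" using x by (auto simp: eigvec_def ip_def)
  then show ?thesis by (auto simp: mv_def)
qed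

text \<open>An eigenvector \<open>u\<close> with nonzero components along both \<open>w a\<close>
  and \<open>w b\<close> would force \<open>l a = m = l b\<close>, giving two orthogonal
  eigenvectors for one eigenvalue. So it lies along a single basis vector and, by Parseval, equals
  it up to sign.\<close>

lemma simple_spectrum_eigvec:
  assumes sym: "\<And>i j. i < n \<Longrightarrow> j < n \<Longrightarrow> H i j = H j i"
    and simple: "simple_spectrum n H" and w: "orthonormal n n w"
    and eig: "\<And>a i. a < n \<Longrightarrow> i < n \<Longrightarrow> mv n H (w a) i = l a * w a i"
    and u: "eigvec n H m u"
  shows "\<exists>a<n. \<exists>c. c\<^sup>2 = 1 \<and> (\<forall>i<n. u i = c * w a i)"
proof -
  have wa: "eigvec n H (l a) (w a)" if "a < n" for a
    using that w eig by (auto simp: eigvec_def orthonormal_def)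
  have ml: "(m - l a) * ip n (w a) u = 0" if a: "a < n" for a
  proof -
    have "m * ip n (w a) u = ip n (w a) (mv n H u)"
      using u by (subst ip_scale_right[symmetric]) (auto intro!: ip_cong simp: eigvec_def)
    also have "\<dots> = ip n (mv n H (w a)) u" using ip_mv_sym[OF sym] by simp
    also have "\<dots> = l a * ip n (w a) u"
      using eig[OF a] by (subst ip_scale_left[symmetric]) (auto intro!: ip_cong)
    finally show ?thesis by (simp add: algebra_simps)
  qed
  have "\<exists>a<n. ip n (w a) u \<noteq> 0"
  proof (rule ccontr)
    assume "\<not> ?thesis"
    then have "(\<Sum>a<n. (ip n (w a) u)\<^sup>2) = 0" by simp
    then show False using orthonormal_parseval[OF w, of u] u by (simp add: eigvec_def)
  qed
  then obtain a where a: "a < n" "ip n (w a) u \<noteq> 0" by blast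
  have other: "ip n (w b) u = 0" if b: "b < n" "b \<noteq> a" for b
  proof (rule ccontr)
    assume "ip n (w b) u \<noteq> 0"
    then have "l a = l b" using ml[OF a(1)] ml[OF b(1)] a(2) by simp
    then have "eigvec n H (l a) (w a) \<and> eigvec n H (l a) (w b) \<and> ip n (w a) (w b) = 0"
      using wa[OF a(1)] wa[OF b(1)] w a(1) b by (simp add: orthonormal_def)
    then show False using simple unfolding simple_spectrum_def by blast
  qed
  define c where "c = ip n (w a) u"
  have s: "(\<Sum>b<n. f b) = f a" if "\<And>b. b < n \<Longrightarrow> b \<noteq> a \<Longrightarrow> f b = 0" for f :: "nat \<Rightarrow> real"
  proof -
    have "(\<Sum>b<n. f b) = (\<Sum>b\<in>{a}. f b)" by (rule sum.mono_neutral_right) (use a that in auto)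
    then show ?thesis by simp
  qed
  have "c\<^sup>2 = 1"
    using orthonormal_parseval[OF w, of u] u s[of "\<lambda>b. (ip n (w b) u)\<^sup>2"] other by (simp add: eigvec_def c_def)
  moreover have "u i = c * w a i" if "i < n" for i
    using orthonormal_expand[OF w that, of u] s[of "\<lambda>b. ip n (w b) u * w b i"] other by (simp add: c_def)
  ultimately show ?thesis using a(1) by blast
qed

section \<open>Almost sure simplicity of the GOE spectrum\<close>

lemma finite_goe_index: "finite (goe_index N)"
  by (rule finite_subset[of _ "{..<N} \<times> {..<N}"]) (auto simp: goe_index_def)

lemma goe_space_eq: "goe_space N = gaussian (goe_index N)"
  by (simp add: goe_space_def)

lemma goe_matrix_sym: "goe_matrix N g i j = goe_matrix N g j i"
  by (auto simp: goe_matrix_def)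

lemma continuous_on_goe_matrix [continuous_intros]:
  assumes "\<And>p. continuous_on S (\<lambda>x. f x p)"
  shows "continuous_on S (\<lambda>x. goe_matrix N (f x) i j)"
proof (cases "i < N \<and> j < N")
  case True
  show ?thesis
    by (cases i j rule: linorder_cases)
       (use True in \<open>auto simp: goe_matrix_def intro!: continuous_on_divide continuous_on_mult continuous_on_const assms\<close>)
next
  case False
  then have "(\<lambda>x. goe_matrix N (f x) i j) = (\<lambda>x. 0)" by (auto simp: goe_matrix_def)
  then show ?thesis by (simp only: continuous_on_const)
qed

lemma continuous_on_mv2:
  assumes "\<And>i j. continuous_on S (\<lambda>x. H x i j)" "\<And>i. continuous_on S (\<lambda>x. u x i)"
  shows "continuous_on S (\<lambda>x. mv n (H x) (u x) i)"
  unfolding mv_def by (intro continuous_on_sum continuous_on_mult assms)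

lemma continuous_on_fst_apply: "continuous_on S (\<lambda>x. fst x p)"
  by (rule continuous_on_product_then_coordinatewise) (intro continuous_on_fst continuous_on_id)

lemma continuous_on_snd_apply: "continuous_on S (\<lambda>x. snd x p)"
  by (rule continuous_on_product_then_coordinatewise) (intro continuous_on_snd continuous_on_id)

text \<open>Induction over the leading minors of one fixed matrix. The entries of column
  \<open>n\<close> above the diagonal, indexed by \<open>J\<close>, are independent of the minor of
  size \<open>n\<close>; given that minor, a repeated eigenvalue of the next one makes one of
  \<open>n\<close> nontrivial linear forms in these entries vanish.\<close>

lemma AE_simple_spectrum_minor:
  assumes "n \<le> N"
  shows "AE g in gaussian (goe_index N). simple_spectrum n (goe_matrix N g)"
  using assms
proof (induction n)
  case 0
  show ?case by (simp add: simple_spectrum_def eigvec_def ip_def)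
next
  case (Suc n)
  then have nN: "n < N" by simp
  define J where "J = {..<n} \<times> {n}"
  define R where "R = goe_index N - J"
  have RJ: "R \<inter> J = {}" "finite R" "finite J" "R \<union> J = goe_index N"
    using nN finite_goe_index[of N] by (auto simp: R_def J_def goe_index_def)
  \<comment> \<open>A closed, hence measurable, condition that is implied by failure of simplicity
    for the minor of size \<open>Suc n\<close>.\<close>
  define bad where "bad g \<longleftrightarrow> (\<exists>v l. eigvec n (goe_matrix N g) l v \<and> (\<Sum>i<n. goe_matrix N g n i * v i) = 0)" for g
  have "closed {g. bad g}"
  proof -
    have "closed {x :: (nat \<times> nat \<Rightarrow> real) \<times> (nat \<Rightarrow> real).
       (\<forall>i\<in>{..<n}. mv n (goe_matrix N (fst x)) (snd x) i = ip n (snd x) (mv n (goe_matrix N (fst x)) (snd x)) * snd x i)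
       \<and> (\<Sum>i<n. goe_matrix N (fst x) n i * snd x i) = 0}"
      unfolding Collect_conj_eq Collect_ball_eq
      by (intro closed_Int closed_INT ballI closed_Collect_eq continuous_on_sum continuous_on_mult continuous_on_ip
          continuous_on_mv2 continuous_on_goe_matrix continuous_on_fst_apply continuous_on_snd_apply continuous_on_const)
    from closed_compact_exists[OF compact_sphere_fun[of n] this]
    have "closed {g. \<exists>v\<in>sphere_fun n. (\<forall>i\<in>{..<n}. mv n (goe_matrix N g) v i = ip n v (mv n (goe_matrix N g) v) * v i)
       \<and> (\<Sum>i<n. goe_matrix N g n i * v i) = 0}" by simp
    moreover have "bad g \<longleftrightarrow> (\<exists>v\<in>sphere_fun n. (\<forall>i\<in>{..<n}. mv n (goe_matrix N g) v i = ip n v (mv n (goe_matrix N g) v) * v i)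
       \<and> (\<Sum>i<n. goe_matrix N g n i * v i) = 0)" for g
      unfolding bad_def by (rule ex_eigvec_sphere) (auto intro!: sum.cong)
    ultimately show ?thesis by simp
  qed
  define B where "B = {g \<in> space (gaussian (goe_index N)). bad g}"
  have B[measurable]: "B \<in> sets (gaussian (R \<union> J))"
    unfolding B_def RJ(4) by (rule sets_gaussian_closed) fact
  interpret R: prob_space "gaussian R" by (rule prob_space_gaussian)
  interpret J: prob_space "gaussian J" by (rule prob_space_gaussian)
  interpret pair_sigma_finite "gaussian R" "gaussian J" by standard
  have merge: "distr (gaussian R \<Otimes>\<^sub>M gaussian J) (gaussian (R \<union> J)) (merge R J) = gaussian (goe_index N)"
    unfolding gaussian.distr_merge[OF RJ(1,2,3)] by (simp only: RJ(4))
  have "AE z in gaussian R \<Otimes>\<^sub>M gaussian J. simple_spectrum n (goe_matrix N (merge R J z))"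
  proof (rule AE_distrD[where M' = "gaussian (R \<union> J)"])
    show "AE g in distr (gaussian R \<Otimes>\<^sub>M gaussian J) (gaussian (R \<union> J)) (merge R J). simple_spectrum n (goe_matrix N g)"
      unfolding merge using Suc by simp
  qed measurable
  from AE_pair[OF this]
  have ae: "AE x in gaussian R. AE y in gaussian J. simple_spectrum n (goe_matrix N (merge R J (x, y)))" by simp
  have "emeasure (gaussian (R \<union> J)) B = (\<integral>\<^sup>+x. (\<integral>\<^sup>+y. indicator B (merge R J (x, y)) \<partial>gaussian J) \<partial>gaussian R)"
    using gaussian.product_nn_integral_fold[OF RJ(1,2,3), of "indicator B"] B by simp
  also have "\<dots> = (\<integral>\<^sup>+x. 0 \<partial>gaussian R)"
  proof (rule nn_integral_cong_AE, use ae in eventually_elim)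
    fix x assume x: "AE y in gaussian J. simple_spectrum n (goe_matrix N (merge R J (x, y)))"
    \<comment> \<open>The minor does not see \<open>y\<close>, so its eigenbasis \<open>w\<close>
      can be fixed from \<open>x\<close> alone before \<open>y\<close> is integrated.\<close>
    have minor: "goe_matrix N (merge R J (x, y)) i j = goe_matrix N x i j" if "i < n" "j < n" for y i j
      using that nN by (auto simp: goe_matrix_def merge_def R_def J_def goe_index_def)
    have mv_minor: "mv n (goe_matrix N (merge R J (x, y))) u i = mv n (goe_matrix N x) u i" if "i < n" for y u i
      unfolding mv_def using minor that by (intro sum.cong) auto
    obtain w l where w: "orthonormal n n w" and eig: "\<And>a i. a < n \<Longrightarrow> i < n \<Longrightarrow> mv n (goe_matrix N x) (w a) i = l a * w a i"
      using spectral_theorem[of n "goe_matrix N x"] goe_matrix_sym by metis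
    have "AE y in gaussian J. \<forall>a\<in>{..<n}. (\<Sum>p\<in>J. w a (fst p) * y p) \<noteq> 0"
    proof (subst AE_finite_all[OF finite_lessThan], intro ballI)
      fix a assume a: "a \<in> {..<n}"
      have "\<exists>i<n. w a i \<noteq> 0"
      proof (rule ccontr)
        assume "\<not> ?thesis"
        then have "ip n (w a) (w a) = 0" by (simp add: ip_def)
        then show False using w a by (simp add: orthonormal_def)
      qed
      then obtain i where "i < n" "w a i \<noteq> 0" by blast
      then show "AE y in gaussian J. (\<Sum>p\<in>J. w a (fst p) * y p) \<noteq> 0"
        by (intro AE_gaussian_linear_nonzero[where ?i0.0 = "(i, n)"]) (auto simp: J_def)
    qed
    with x have "AE y in gaussian J. merge R J (x, y) \<notin> B"
    proof eventually_elim
      case (elim y)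
      show ?case
      proof
        assume "merge R J (x, y) \<in> B"
        then obtain v m where v: "eigvec n (goe_matrix N (merge R J (x, y))) m v"
          "(\<Sum>i<n. goe_matrix N (merge R J (x, y)) n i * v i) = 0" by (auto simp: B_def bad_def)
        obtain a c where a: "a < n" "c\<^sup>2 = 1" "\<forall>i<n. v i = c * w a i"
          using simple_spectrum_eigvec[OF goe_matrix_sym elim(1) w _ v(1), of l] mv_minor eig by metis
        have "goe_matrix N (merge R J (x, y)) n i = y (i, n) / sqrt (real N)" if "i < n" for i
          using that nN RJ(1) by (auto simp: goe_matrix_def merge_def J_def)
        then have "0 = (\<Sum>i<n. y (i, n) / sqrt (real N) * (c * w a i))" using v(2) a(3) by simp
        also have "\<dots> = c / sqrt (real N) * (\<Sum>i<n. w a i * y (i, n))"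
          by (simp add: sum_distrib_left mult_ac)
        also have "(\<Sum>i<n. w a i * y (i, n)) = (\<Sum>p\<in>J. w a (fst p) * y p)"
        proof -
          have "J = (\<lambda>i. (i, n)) ` {..<n}" by (auto simp: J_def)
          then show ?thesis by (simp add: sum.reindex inj_on_def)
        qed
        finally show False using elim(2) a(1,2) nN by auto
      qed
    qed
    then show "(\<integral>\<^sup>+y. indicator B (merge R J (x, y)) \<partial>gaussian J) = 0"
      by (subst nn_integral_cong_AE[where v = "\<lambda>_. 0"]) (auto elim!: eventually_mono)
  qed
  finally have "B \<in> null_sets (gaussian (goe_index N))" using B RJ(4) by (simp add: null_setsI)
  then have "AE g in gaussian (goe_index N). \<not> bad g"
    by (rule AE_I') (auto simp: B_def)
  then show ?case
    unfolding bad_def by eventually_elim (use not_simple_spectrum_SucD in blast)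
qed

section \<open>Comparison with independent chi-squared variables\<close>

definition rot :: "nat \<Rightarrow> (nat \<Rightarrow> nat \<Rightarrow> real) \<Rightarrow> (nat \<Rightarrow> real) \<Rightarrow> nat \<Rightarrow> real" where
  "rot n U u i = ip n (U i) u"

definition tr :: "(nat \<Rightarrow> nat \<Rightarrow> real) \<Rightarrow> nat \<Rightarrow> nat \<Rightarrow> real" where
  "tr U i j = U j i"

lemma orthonormal_tr: "orthonormal n n U \<Longrightarrow> orthonormal n n (tr U)"
  using orthonormal_columns[of n U] by (auto simp: orthonormal_def ip_def tr_def)

lemma tr_tr [simp]: "tr (tr U) = U"
  by (simp add: tr_def[abs_def])

lemma rot_tr_rot:
  assumes "orthonormal n n U" "i < n"
  shows "rot n (tr U) (rot n U u) i = u i"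
  using orthonormal_expand[OF assms, of u] by (simp add: rot_def ip_def[of n "tr U i"] tr_def mult.commute)

lemma rot_rot_tr:
  assumes "orthonormal n n U" "i < n"
  shows "rot n U (rot n (tr U) u) i = u i"
  using rot_tr_rot[OF orthonormal_tr[OF assms(1)] assms(2)] by simp

lemma ip_rot_left: "ip n (rot n U u) v = ip n u (rot n (tr U) v)"
  unfolding rot_def ip_def tr_def sum_distrib_left sum_distrib_right
  by (subst sum.swap) (simp add: mult_ac)

lemma ip_rot_rot:
  assumes "orthonormal n n U"
  shows "ip n (rot n U u) (rot n U v) = ip n u v"
  unfolding ip_rot_left by (intro ip_cong refl) (rule rot_tr_rot[OF assms])

lemma rot_cong: "(\<And>i. i < n \<Longrightarrow> u i = v i) \<Longrightarrow> rot n U u = rot n U v"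
  by (auto simp: rot_def[abs_def] ip_def)

section \<open>Conjugation by an orthogonal matrix\<close>

definition conj_mat :: "nat \<Rightarrow> (nat \<Rightarrow> nat \<Rightarrow> real) \<Rightarrow> (nat \<Rightarrow> nat \<Rightarrow> real) \<Rightarrow> nat \<Rightarrow> nat \<Rightarrow> real" where
  "conj_mat n U H i j = (\<Sum>k<n. \<Sum>l<n. U i k * U j l * H k l)"

lemma conj_mat_sym:
  assumes "\<And>k l. k < n \<Longrightarrow> l < n \<Longrightarrow> H k l = H l k"
  shows "conj_mat n U H i j = conj_mat n U H j i"
  unfolding conj_mat_def by (subst sum.swap) (use assms in \<open>auto intro!: sum.cong\<close>)

lemma mv_conj_mat: "mv n (conj_mat n U H) v i = rot n U (mv n H (rot n (tr U) v)) i"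
proof -
  have "mv n (conj_mat n U H) v i = (\<Sum>j<n. \<Sum>k<n. \<Sum>l<n. U i k * H k l * U j l * v j)"
    by (simp add: mv_def conj_mat_def sum_distrib_left sum_distrib_right mult_ac)
  also have "\<dots> = (\<Sum>k<n. \<Sum>l<n. \<Sum>j<n. U i k * H k l * U j l * v j)"
    by (rule trans[OF sum.swap], rule sum.cong[OF refl], rule sum.swap)
  also have "\<dots> = rot n U (mv n H (rot n (tr U) v)) i"
    by (simp add: rot_def ip_def mv_def tr_def sum_distrib_left mult_ac)
  finally show ?thesis .
qed

text \<open>Conjugation rotates each of the two indices separately. Rotations in different indices
  commute, so each can be undone by its transpose.\<close>

lemma conj_mat_tr_conj_mat:
  assumes "orthonormal n n U" "k < n" "l < n"
  shows "conj_mat n (tr U) (conj_mat n U H) k l = H k l"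
proof -
  have c: "conj_mat n U H i j = rot n U (\<lambda>k. rot n U (H k) j) i" for U H i j
    by (simp add: conj_mat_def rot_def ip_def sum_distrib_left mult_ac)
  have s: "rot n U (\<lambda>k. rot n V (\<lambda>l. M k l) j) i = rot n V (\<lambda>l. rot n U (\<lambda>k. M k l) i) j" for U V M i j
    unfolding rot_def ip_def sum_distrib_left by (subst sum.swap) (simp add: mult_ac)
  have "conj_mat n (tr U) (conj_mat n U H) k l
      = rot n (tr U) (\<lambda>i. rot n (tr U) (\<lambda>j. rot n U (\<lambda>k. rot n U (H k) j) i) l) k"
    unfolding c[of "tr U"] c[of U] ..
  also have "\<dots> = rot n (tr U) (\<lambda>i. rot n U (\<lambda>k. rot n (tr U) (rot n U (H k)) l) i) k"
    by (subst s[of _ U]) simp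
  also have "\<dots> = rot n (tr U) (rot n U (\<lambda>k. H k l)) k"
    by (simp add: rot_tr_rot[OF assms(1,3)])
  finally show ?thesis by (simp add: rot_tr_rot[OF assms(1,2)])
qed

lemma eigvec_conj_mat:
  assumes U: "orthonormal n n U" and u: "eigvec n H l u"
  shows "eigvec n (conj_mat n U H) l (rot n U u)"
proof -
  have "mv n (conj_mat n U H) (rot n U u) i = l * rot n U u i" if "i < n" for i
  proof -
    have "mv n H (rot n (tr U) (rot n U u)) = mv n H u"
      using rot_tr_rot[OF U] by (auto simp: mv_def)
    then have "mv n (conj_mat n U H) (rot n U u) i = rot n U (mv n H u) i" by (simp add: mv_conj_mat)
    also have "\<dots> = rot n U (\<lambda>i. l * u i) i" using u by (auto simp: eigvec_def intro!: fun_cong[OF rot_cong])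
    finally show ?thesis by (simp add: rot_def ip_simps)
  qed
  then show ?thesis using u by (simp add: eigvec_def ip_rot_rot[OF U])
qed

lemma eigvec_mat_cong:
  assumes "\<And>i j. i < n \<Longrightarrow> j < n \<Longrightarrow> H i j = H' i j"
  shows "eigvec n H l u \<longleftrightarrow> eigvec n H' l u"
proof -
  have "mv n H u i = mv n H' u i" if "i < n" for i
    unfolding mv_def using assms that by (intro sum.cong) auto
  then show ?thesis by (simp add: eigvec_def)
qed

lemma all_eigvec_conj_mat:
  assumes U: "orthonormal n n U" and P: "\<And>u v. (\<And>i. i < n \<Longrightarrow> u i = v i) \<Longrightarrow> P u \<longleftrightarrow> P v"
  shows "(\<forall>l v. eigvec n (conj_mat n U H) l v \<longrightarrow> P v) \<longleftrightarrow> (\<forall>l u. eigvec n H l u \<longrightarrow> P (rot n U u))" (is "?l \<longleftrightarrow> ?r")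
proof
  assume ?l then show ?r using eigvec_conj_mat[OF U] by blast
next
  assume r: ?r
  show ?l
  proof (intro allI impI)
    fix l v assume v: "eigvec n (conj_mat n U H) l v"
    have "eigvec n (conj_mat n (tr U) (conj_mat n U H)) l (rot n (tr U) v)"
      by (rule eigvec_conj_mat[OF orthonormal_tr[OF U] v])
    then have "eigvec n H l (rot n (tr U) v)"
      using eigvec_mat_cong[of n "conj_mat n (tr U) (conj_mat n U H)" H] conj_mat_tr_conj_mat[OF U] by blast
    then have "P (rot n U (rot n (tr U) v))" using r by blast
    then show "P v" using P[of "rot n U (rot n (tr U) v)" v] rot_rot_tr[OF U] by blast
  qed
qed

section \<open>The GOE as a standard Gaussian vector\<close>

definition goe_vec :: "nat \<Rightarrow> (nat \<Rightarrow> nat \<Rightarrow> real) \<Rightarrow> nat \<times> nat \<Rightarrow> real" where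
  "goe_vec N M = (\<lambda>p\<in>goe_index N. sqrt (real N) * M (fst p) (snd p) / (if fst p = snd p then sqrt 2 else 1))"

lemma goe_matrix_vec:
  assumes "\<And>i j. i < N \<Longrightarrow> j < N \<Longrightarrow> M i j = M j i" "i < N" "j < N"
  shows "goe_matrix N (goe_vec N M) i j = M i j"
  by (cases i j rule: linorder_cases) (use assms in \<open>auto simp: goe_matrix_def goe_vec_def goe_index_def\<close>)

lemma goe_vec_matrix: "p \<in> goe_index N \<Longrightarrow> goe_vec N (goe_matrix N g) p = g p"
  by (cases p) (auto simp: goe_matrix_def goe_vec_def goe_index_def)

text \<open>Each off-diagonal pair occurs twice in the Frobenius sum and each diagonal entry once;
  the division by \<open>sqrt 2\<close> on the diagonal in \<open>goe_vec\<close> compensates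
  exactly. The doubled diagonal variance of the GOE is thus what turns conjugation into an isometry
  of the Gaussian coordinates.\<close>

lemma sum_goe_index_frobenius:
  assumes "\<And>i j. i < N \<Longrightarrow> j < N \<Longrightarrow> A i j = A j i" "\<And>i j. i < N \<Longrightarrow> j < N \<Longrightarrow> B i j = B j i"
  shows "(\<Sum>p\<in>goe_index N. goe_vec N A p * goe_vec N B p) = real N / 2 * (\<Sum>i<N. \<Sum>j<N. A i j * B i j)"
proof -
  define f where "f p = A (fst p) (snd p) * B (fst p) (snd p)" for p
  define D where "D = {p \<in> {..<N} \<times> {..<N}. fst p = snd p}"
  define T where "T = {p \<in> {..<N} \<times> {..<N}. fst p < snd p}"
  define T' where "T' = {p \<in> {..<N} \<times> {..<N}. snd p < fst p}"
  have fin: "finite D" "finite T" "finite T'" by (auto simp: D_def T_def T'_def)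
  have "(\<Sum>i<N. \<Sum>j<N. A i j * B i j) = (\<Sum>p\<in>{..<N} \<times> {..<N}. f p)"
    by (simp add: sum.cartesian_product f_def split_beta)
  also have "{..<N} \<times> {..<N} = D \<union> T \<union> T'" by (auto simp: D_def T_def T'_def)
  also have "(\<Sum>p\<in>D \<union> T \<union> T'. f p) = sum f D + sum f T + sum f T'"
    using fin by (subst sum.union_disjoint, auto simp: D_def T_def T'_def)+
  also have "sum f T' = sum f T"
    by (rule sum.reindex_bij_witness[of _ prod.swap prod.swap]) (use assms in \<open>auto simp: T_def T'_def f_def\<close>)
  finally have 1: "(\<Sum>i<N. \<Sum>j<N. A i j * B i j) = sum f D + 2 * sum f T" by simp
  have "goe_index N = D \<union> T" by (auto simp: D_def T_def goe_index_def)
  moreover have "(\<Sum>p\<in>D. goe_vec N A p * goe_vec N B p) = real N / 2 * sum f D"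
    unfolding sum_distrib_left by (rule sum.cong) (auto simp: goe_vec_def D_def f_def goe_index_def)
  moreover have "(\<Sum>p\<in>T. goe_vec N A p * goe_vec N B p) = real N * sum f T"
    unfolding sum_distrib_left by (rule sum.cong) (auto simp: goe_vec_def T_def f_def goe_index_def)
  moreover have "D \<inter> T = {}" by (auto simp: D_def T_def)
  ultimately have "(\<Sum>p\<in>goe_index N. goe_vec N A p * goe_vec N B p) = real N / 2 * sum f D + real N * sum f T"
    using fin by (simp add: sum.union_disjoint)
  then show ?thesis unfolding 1 by (simp add: algebra_simps)
qed

lemma goe_matrix_measurable [measurable]:
  "(\<lambda>g. goe_matrix N g i j) \<in> borel_measurable (PiM (goe_index N) (\<lambda>_. borel))"
proof (cases "i < N \<and> j < N")
  case True
  then show ?thesis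
    by (cases i j rule: linorder_cases) (auto simp: goe_matrix_def goe_index_def)
qed (auto simp: goe_matrix_def)

lemma frobenius_conj_mat:
  "(\<Sum>i<n. \<Sum>j<n. conj_mat n U A i j * B i j) = (\<Sum>k<n. \<Sum>l<n. A k l * conj_mat n (tr U) B k l)"
proof -
  have "(\<Sum>i<n. \<Sum>j<n. conj_mat n U A i j * B i j) = (\<Sum>i<n. \<Sum>j<n. \<Sum>k<n. \<Sum>l<n. U i k * U j l * A k l * B i j)"
    by (simp add: conj_mat_def sum_distrib_right)
  also have "\<dots> = (\<Sum>k<n. \<Sum>l<n. \<Sum>i<n. \<Sum>j<n. U i k * U j l * A k l * B i j)"
  proof -
    define F where "F i j k l = U i k * U j l * A k l * B i j" for i j k l
    have "(\<Sum>i<n. \<Sum>j<n. \<Sum>k<n. \<Sum>l<n. F i j k l) = (\<Sum>i<n. \<Sum>k<n. \<Sum>j<n. \<Sum>l<n. F i j k l)"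
      by (rule sum.cong[OF refl], rule sum.swap)
    also have "\<dots> = (\<Sum>k<n. \<Sum>i<n. \<Sum>j<n. \<Sum>l<n. F i j k l)" by (rule sum.swap)
    also have "\<dots> = (\<Sum>k<n. \<Sum>i<n. \<Sum>l<n. \<Sum>j<n. F i j k l)"
      by (rule sum.cong[OF refl], rule sum.cong[OF refl], rule sum.swap)
    also have "\<dots> = (\<Sum>k<n. \<Sum>l<n. \<Sum>i<n. \<Sum>j<n. F i j k l)"
      by (rule sum.cong[OF refl], rule sum.swap)
    finally show ?thesis by (simp add: F_def)
  qed
  also have "\<dots> = (\<Sum>k<n. \<Sum>l<n. A k l * conj_mat n (tr U) B k l)"
    by (simp add: conj_mat_def tr_def sum_distrib_left mult_ac)
  finally show ?thesis .
qed

text \<open>Conjugation by \<open>tr U\<close> inverts conjugation by \<open>U\<close> and is its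
  adjoint for the Frobenius pairing, which \<open>goe_vec\<close> carries over to the Gaussian
  coordinates up to a scalar.\<close>

lemma goe_orthogonal_invariant:
  assumes U: "orthonormal N N U"
  shows "distr (gaussian (goe_index N)) (gaussian (goe_index N)) (\<lambda>g. goe_vec N (conj_mat N U (goe_matrix N g)))
    = gaussian (goe_index N)"
proof (rule gaussian_orthogonal_invariant[where L' = "\<lambda>g. goe_vec N (conj_mat N (tr U) (goe_matrix N g))", OF finite_goe_index])
  show "(\<lambda>g. goe_vec N (conj_mat N U (goe_matrix N g)))
      \<in> measurable (PiM (goe_index N) (\<lambda>_. borel)) (PiM (goe_index N) (\<lambda>_. borel))"
    unfolding goe_vec_def conj_mat_def by measurable
  note csym = conj_mat_sym[OF goe_matrix_sym]
  \<comment> \<open>Stated for a general \<open>V\<close>: the second inverse law is the first one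
    with \<open>tr U\<close> in place of \<open>U\<close>.\<close>
  have inv: "goe_vec N (conj_mat N (tr V) (goe_matrix N (goe_vec N (conj_mat N V (goe_matrix N x))))) i = x i"
    if V: "orthonormal N N V" and i: "i \<in> goe_index N" for V x i
  proof -
    have "goe_vec N (conj_mat N (tr V) (goe_matrix N (goe_vec N (conj_mat N V (goe_matrix N x))))) i
        = goe_vec N (goe_matrix N x) i"
    proof -
      have "conj_mat N (tr V) (goe_matrix N (goe_vec N (conj_mat N V (goe_matrix N x)))) k l
          = conj_mat N (tr V) (conj_mat N V (goe_matrix N x)) k l" for k l
        unfolding conj_mat_def[of _ "tr V"] by (intro sum.cong refl, subst goe_matrix_vec[OF csym]) auto
      then show ?thesis using i conj_mat_tr_conj_mat[OF V]
        by (auto simp: goe_vec_def goe_index_def)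
    qed
    then show ?thesis using goe_vec_matrix[OF i] by simp
  qed
  show "goe_vec N (conj_mat N (tr U) (goe_matrix N (goe_vec N (conj_mat N U (goe_matrix N x))))) i = x i"
    if "i \<in> goe_index N" for x i by (rule inv[OF U that])
  show "goe_vec N (conj_mat N U (goe_matrix N (goe_vec N (conj_mat N (tr U) (goe_matrix N x))))) i = x i"
    if "i \<in> goe_index N" for x i using inv[OF orthonormal_tr[OF U] that] by simp
  fix x y
  have "(\<Sum>p\<in>goe_index N. goe_vec N (conj_mat N U (goe_matrix N x)) p * y p)
     = (\<Sum>p\<in>goe_index N. goe_vec N (conj_mat N U (goe_matrix N x)) p * goe_vec N (goe_matrix N y) p)"
    by (simp add: goe_vec_matrix)
  also have "\<dots> = real N / 2 * (\<Sum>i<N. \<Sum>j<N. conj_mat N U (goe_matrix N x) i j * goe_matrix N y i j)"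
    by (rule sum_goe_index_frobenius) (rule csym goe_matrix_sym)+
  also have "\<dots> = real N / 2 * (\<Sum>i<N. \<Sum>j<N. goe_matrix N x i j * conj_mat N (tr U) (goe_matrix N y) i j)"
    by (simp only: frobenius_conj_mat)
  also have "\<dots> = (\<Sum>p\<in>goe_index N. goe_vec N (goe_matrix N x) p * goe_vec N (conj_mat N (tr U) (goe_matrix N y)) p)"
    by (rule sum_goe_index_frobenius[symmetric]) (rule csym goe_matrix_sym)+
  also have "\<dots> = (\<Sum>p\<in>goe_index N. x p * goe_vec N (conj_mat N (tr U) (goe_matrix N y)) p)"
    by (simp add: goe_vec_matrix)
  finally show "(\<Sum>p\<in>goe_index N. goe_vec N (conj_mat N U (goe_matrix N x)) p * y p)
     = (\<Sum>p\<in>goe_index N. x p * goe_vec N (conj_mat N (tr U) (goe_matrix N y)) p)" .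
qed

section \<open>Rotation and currying of Gaussian arrays\<close>

lemma gaussian_rotate_first:
  assumes w: "orthonormal n n w" and K: "finite K"
  shows "distr (gaussian ({..<n} \<times> K)) (gaussian ({..<n} \<times> K))
      (\<lambda>x. \<lambda>p\<in>{..<n} \<times> K. rot n w (\<lambda>i. x (i, snd p)) (fst p)) = gaussian ({..<n} \<times> K)"
proof (rule gaussian_orthogonal_invariant[where L' = "\<lambda>x. \<lambda>p\<in>{..<n} \<times> K. rot n (tr w) (\<lambda>i. x (i, snd p)) (fst p)"])
  show "finite ({..<n} \<times> K)" using K by simp
  show "(\<lambda>x. \<lambda>p\<in>{..<n} \<times> K. rot n w (\<lambda>i. x (i, snd p)) (fst p))
    \<in> measurable (PiM ({..<n} \<times> K) (\<lambda>_. borel)) (PiM ({..<n} \<times> K) (\<lambda>_. borel))"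
    unfolding rot_def ip_def
    by (intro measurable_restrict borel_measurable_sum borel_measurable_times borel_measurable_const measurable_component_singleton) auto
  have inv: "(\<lambda>p\<in>{..<n} \<times> K. rot n (tr v) (\<lambda>i. (\<lambda>p\<in>{..<n} \<times> K. rot n v (\<lambda>i. x (i, snd p)) (fst p)) (i, snd p)) (fst p)) i = x i"
    if v: "orthonormal n n v" and i: "i \<in> {..<n} \<times> K" for v x i
  proof -
    have "rot n (tr v) (\<lambda>j. (\<lambda>p\<in>{..<n} \<times> K. rot n v (\<lambda>i. x (i, snd p)) (fst p)) (j, snd i))
        = rot n (tr v) (rot n v (\<lambda>j. x (j, snd i)))"
      using i by (intro rot_cong) auto
    then show ?thesis using i rot_tr_rot[OF v] by auto
  qed
  show "(\<lambda>p\<in>{..<n} \<times> K. rot n (tr w) (\<lambda>i. (\<lambda>p\<in>{..<n} \<times> K. rot n w (\<lambda>i. x (i, snd p)) (fst p)) (i, snd p)) (fst p)) i = x i"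
    if "i \<in> {..<n} \<times> K" for x i by (rule inv[OF w that])
  show "(\<lambda>p\<in>{..<n} \<times> K. rot n w (\<lambda>i. (\<lambda>p\<in>{..<n} \<times> K. rot n (tr w) (\<lambda>i. x (i, snd p)) (fst p)) (i, snd p)) (fst p)) i = x i"
    if "i \<in> {..<n} \<times> K" for x i using inv[OF orthonormal_tr[OF w] that] by simp
  fix x y :: "nat \<times> 'a \<Rightarrow> real"
  have "(\<Sum>p\<in>{..<n} \<times> K. rot n w (\<lambda>i. x (i, snd p)) (fst p) * y p) = (\<Sum>k\<in>K. ip n (rot n w (\<lambda>i. x (i, k))) (\<lambda>j. y (j, k)))"
    unfolding ip_def by (subst sum.swap) (simp add: sum.cartesian_product split_beta)
  also have "\<dots> = (\<Sum>k\<in>K. ip n (\<lambda>i. x (i, k)) (rot n (tr w) (\<lambda>j. y (j, k))))"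
    by (simp add: ip_rot_left)
  also have "\<dots> = (\<Sum>p\<in>{..<n} \<times> K. x p * rot n (tr w) (\<lambda>i. y (i, snd p)) (fst p))"
    unfolding ip_def by (subst sum.swap) (simp add: sum.cartesian_product split_beta)
  finally show "(\<Sum>p\<in>{..<n} \<times> K. (\<lambda>p\<in>{..<n} \<times> K. rot n w (\<lambda>i. x (i, snd p)) (fst p)) p * y p)
    = (\<Sum>p\<in>{..<n} \<times> K. x p * (\<lambda>p\<in>{..<n} \<times> K. rot n (tr w) (\<lambda>i. y (i, snd p)) (fst p)) p)"
    by simp
qed

lemma gaussian_rotate:
  assumes w: "orthonormal n n w"
  shows "distr (gaussian {..<n}) (gaussian {..<n}) (\<lambda>x. \<lambda>i\<in>{..<n}. rot n w x i) = gaussian {..<n}"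
proof (rule gaussian_orthogonal_invariant[where L' = "\<lambda>x. \<lambda>i\<in>{..<n}. rot n (tr w) x i"])
  show "(\<lambda>x. \<lambda>i\<in>{..<n}. rot n w x i) \<in> measurable (PiM {..<n} (\<lambda>_. borel)) (PiM {..<n} (\<lambda>_. borel))"
    unfolding rot_def ip_def
    by (intro measurable_restrict borel_measurable_sum borel_measurable_times borel_measurable_const measurable_component_singleton) auto
  have inv: "(\<lambda>i\<in>{..<n}. rot n (tr v) (\<lambda>i\<in>{..<n}. rot n v x i) i) i = x i"
    if v: "orthonormal n n v" and i: "i \<in> {..<n}" for v x i
  proof -
    have "rot n (tr v) (\<lambda>i\<in>{..<n}. rot n v x i) = rot n (tr v) (rot n v x)" by (intro rot_cong) auto
    then show ?thesis using i rot_tr_rot[OF v] by auto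
  qed
  show "(\<lambda>i\<in>{..<n}. rot n (tr w) (\<lambda>i\<in>{..<n}. rot n w x i) i) i = x i" if "i \<in> {..<n}" for x i
    by (rule inv[OF w that])
  show "(\<lambda>i\<in>{..<n}. rot n w (\<lambda>i\<in>{..<n}. rot n (tr w) x i) i) i = x i" if "i \<in> {..<n}" for x i
    using inv[OF orthonormal_tr[OF w] that] by simp
  fix x y :: "nat \<Rightarrow> real"
  show "(\<Sum>i\<in>{..<n}. (\<lambda>i\<in>{..<n}. rot n w x i) i * y i) = (\<Sum>i\<in>{..<n}. x i * (\<lambda>i\<in>{..<n}. rot n (tr w) y i) i)"
    using ip_rot_left[of n w x y] by (simp add: ip_def)
qed simp

lemma measurable_curry:
  "(\<lambda>f. \<lambda>p\<in>J \<times> K. f (fst p) (snd p)) \<in> measurable (PiM J (\<lambda>_. gaussian K)) (gaussian (J \<times> K))"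
proof (rule measurable_restrict)
  fix p assume p: "p \<in> J \<times> K"
  have "(\<lambda>f. f (fst p)) \<in> measurable (PiM J (\<lambda>_. gaussian K)) (gaussian K)"
    by (rule measurable_component_singleton) (use p in auto)
  moreover have "(\<lambda>x. x (snd p)) \<in> measurable (gaussian K) std_normal_distribution"
    by (rule measurable_component_singleton) (use p in auto)
  ultimately show "(\<lambda>f. f (fst p) (snd p)) \<in> measurable (PiM J (\<lambda>_. gaussian K)) std_normal_distribution"
    by (rule measurable_compose)
qed

text \<open>Both sides give a box the product of the probabilities of its sides. An array may thus
  be treated as independent Gaussian rows, and expectations of products over rows factorize.\<close>

lemma gaussian_curry:
  assumes J: "finite J" and K: "finite K"
  shows "distr (PiM J (\<lambda>_. gaussian K)) (gaussian (J \<times> K)) (\<lambda>f. \<lambda>p\<in>J \<times> K. f (fst p) (snd p)) = gaussian (J \<times> K)"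
proof (rule gaussian.PiM_eqI)
  interpret JK: product_prob_space "\<lambda>_. gaussian K" J
    by standard (rule prob_space.emeasure_space_1 prob_space_imp_sigma_finite prob_space_gaussian)+
  note m = measurable_curry[of J K]
  show "finite (J \<times> K)" using J K by simp
  show "sets (distr (PiM J (\<lambda>_. gaussian K)) (gaussian (J \<times> K)) (\<lambda>f. \<lambda>p\<in>J \<times> K. f (fst p) (snd p))) = sets (gaussian (J \<times> K))"
    by simp
  fix A :: "_ \<Rightarrow> real set" assume A: "\<And>p. p \<in> J \<times> K \<Longrightarrow> A p \<in> sets std_normal_distribution"
  have "emeasure (distr (PiM J (\<lambda>_. gaussian K)) (gaussian (J \<times> K)) (\<lambda>f. \<lambda>p\<in>J \<times> K. f (fst p) (snd p))) (Pi\<^sub>E (J \<times> K) A)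
     = emeasure (PiM J (\<lambda>_. gaussian K)) (Pi\<^sub>E J (\<lambda>j. Pi\<^sub>E K (\<lambda>k. A (j, k))))"
  proof (subst emeasure_distr[OF m])
    show "Pi\<^sub>E (J \<times> K) A \<in> sets (gaussian (J \<times> K))" using J K A by (intro sets_PiM_I_finite) auto
    have "(\<lambda>f. \<lambda>p\<in>J \<times> K. f (fst p) (snd p)) -` Pi\<^sub>E (J \<times> K) A \<inter> space (PiM J (\<lambda>_. gaussian K)) = Pi\<^sub>E J (\<lambda>j. Pi\<^sub>E K (\<lambda>k. A (j, k)))"
      by (auto simp: space_PiM PiE_iff)
    then show "emeasure (PiM J (\<lambda>_. gaussian K)) ((\<lambda>f. \<lambda>p\<in>J \<times> K. f (fst p) (snd p)) -` Pi\<^sub>E (J \<times> K) A \<inter> space (PiM J (\<lambda>_. gaussian K)))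
       = emeasure (PiM J (\<lambda>_. gaussian K)) (Pi\<^sub>E J (\<lambda>j. Pi\<^sub>E K (\<lambda>k. A (j, k))))" by simp
  qed
  also have "\<dots> = (\<Prod>j\<in>J. emeasure (gaussian K) (Pi\<^sub>E K (\<lambda>k. A (j, k))))"
    using J K A by (intro JK.emeasure_PiM sets_PiM_I_finite) auto
  also have "\<dots> = (\<Prod>j\<in>J. \<Prod>k\<in>K. emeasure std_normal_distribution (A (j, k)))"
    using A by (intro prod.cong refl gaussian.emeasure_PiM[OF K]) auto
  also have "\<dots> = (\<Prod>p\<in>J \<times> K. emeasure std_normal_distribution (A p))"
    by (simp add: prod.cartesian_product split_beta)
  finally show "emeasure (distr (PiM J (\<lambda>_. gaussian K)) (gaussian (J \<times> K)) (\<lambda>f. \<lambda>p\<in>J \<times> K. f (fst p) (snd p))) (Pi\<^sub>E (J \<times> K) A)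
     = (\<Prod>p\<in>J \<times> K. emeasure std_normal_distribution (A p))" .
qed

lemma emeasure_space_gaussian: "emeasure (gaussian I) (space (gaussian I)) = 1"
  by (rule prob_space.emeasure_space_1[OF prob_space_gaussian])

lemma emeasure_gaussian_eq: "emeasure (gaussian I) A = ennreal (measure (gaussian I) A)"
  by (rule finite_measure.emeasure_eq_measure[OF prob_space.finite_measure[OF prob_space_gaussian]])

lemma measure_gaussian_le_1: "measure (gaussian I) A \<le> 1"
  by (rule prob_space.prob_le_1[OF prob_space_gaussian])

lemma emeasure_gaussian_le_1: "emeasure (gaussian I) A \<le> 1"
  using measure_gaussian_le_1[of I A] by (simp add: emeasure_gaussian_eq)

section \<open>Overlaps and a Gaussian frame\<close>

abbreviation gauss_array :: "nat \<Rightarrow> nat \<Rightarrow> (nat \<times> nat \<Rightarrow> real) measure" where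
  "gauss_array N r \<equiv> gaussian ({..<N} \<times> {..<r})"

text \<open>The array is stored transposed: \<open>G (j, k)\<close> has \<open>j < N\<close> and
  \<open>k < r\<close>. So the squared length belongs to the vector of inner products of
  \<open>u\<close> with the \<open>r\<close> columns.\<close>

definition glen :: "nat \<Rightarrow> nat \<Rightarrow> (nat \<times> nat \<Rightarrow> real) \<Rightarrow> (nat \<Rightarrow> real) \<Rightarrow> real" where
  "glen N r G u = (\<Sum>k<r. (ip N (\<lambda>j. G (j, k)) u)\<^sup>2)"

text \<open>All squared singular values lie between \<open>(1 - \<delta>) * real N\<close> and
  \<open>(1 + \<delta>) * real N\<close>, expressed through the quadratic form of the Gram
  matrix.\<close>

definition near_isometry :: "nat \<Rightarrow> nat \<Rightarrow> real \<Rightarrow> (nat \<times> nat \<Rightarrow> real) \<Rightarrow> bool" where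
  "near_isometry N r \<delta> G \<longleftrightarrow> (\<forall>c. (1 - \<delta>) * real N * ip r c c \<le> (\<Sum>j<N. (ip r (\<lambda>k. G (j, k)) c)\<^sup>2)
     \<and> (\<Sum>j<N. (ip r (\<lambda>k. G (j, k)) c)\<^sup>2) \<le> (1 + \<delta>) * real N * ip r c c)"

text \<open>A singular value decomposition: eigenvectors \<open>c a\<close> of the Gram matrix
  \<open>M\<close> are mapped by the array to orthogonal vectors \<open>V a\<close> of squared
  length \<open>\<mu> a\<close>, and after normalization these become the first \<open>r\<close>
  rows of \<open>U\<close>. Then \<open>glen\<close> is the sum of the first \<open>r\<close>
  squared coordinates of the rotated vector with weights \<open>\<mu> a\<close>, and all weights are
  close to \<open>N\<close>.\<close>

lemma near_isometry_frame:
  assumes G: "near_isometry N r \<delta> G" and \<delta>: "\<delta> < 1" and N: "0 < N" and r: "r \<le> N"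
  obtains U where "orthonormal N N U"
    "\<And>u. (1 - \<delta>) * real N * (\<Sum>k<r. (rot N U u k)\<^sup>2) \<le> glen N r G u"
    "\<And>u. glen N r G u \<le> (1 + \<delta>) * real N * (\<Sum>k<r. (rot N U u k)\<^sup>2)"
proof -
  define M where "M k l = ip N (\<lambda>j. G (j, k)) (\<lambda>j. G (j, l))" for k l
  have "M k l = M l k" for k l by (simp add: M_def ip_commute)
  then obtain c \<mu> where c: "orthonormal r r c" and \<mu>: "\<And>a i. a < r \<Longrightarrow> i < r \<Longrightarrow> mv r M (c a) i = \<mu> a * c a i"
    using spectral_theorem[of r M] by metis
  define V where "V a = (\<lambda>j. ip r (\<lambda>k. G (j, k)) (c a))" for a
  have V_alt: "V a = (\<lambda>j. \<Sum>k<r. c a k * G (j, k))" for a by (simp add: V_def ip_def mult.commute)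
  have VV: "ip N (V a) (V b) = \<mu> b * (if a = b then 1 else 0)" if "a < r" "b < r" for a b
  proof -
    have "ip N (V a) (V b) = ip r (c a) (mv r M (c b))"
      unfolding V_alt ip_sum_left ip_sum_right ip_scale_left ip_scale_right
      by (simp add: ip_def[of r] mv_def M_def sum_distrib_left mult_ac)
    also have "\<dots> = ip r (c a) (\<lambda>i. \<mu> b * c b i)" using \<mu>[OF that(2)] by (intro ip_cong) auto
    also have "\<dots> = \<mu> b * (if a = b then 1 else 0)" using c that by (simp add: ip_simps orthonormal_def)
    finally show ?thesis .
  qed
  have \<mu>_bounds: "(1 - \<delta>) * real N \<le> \<mu> a \<and> \<mu> a \<le> (1 + \<delta>) * real N" if a: "a < r" for a
  proof -
    have "(\<Sum>j<N. (ip r (\<lambda>k. G (j, k)) (c a))\<^sup>2) = \<mu> a"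
      using VV[OF a a] by (simp add: V_def ip_def[of N] power2_eq_square)
    moreover have "ip r (c a) (c a) = 1" using c a by (simp add: orthonormal_def)
    ultimately show ?thesis using G[unfolded near_isometry_def, rule_format, of "c a"] by simp
  qed
  have \<mu>_pos: "\<mu> a > 0" if "a < r" for a
    using \<mu>_bounds[OF that] mult_pos_pos[of "1 - \<delta>" "real N"] \<delta> N by linarith
  define W where "W a = (\<lambda>j. 1 / sqrt (\<mu> a) * V a j)" for a
  have "orthonormal N r W"
    unfolding orthonormal_def W_def ip_scale_left ip_scale_right
  proof (intro allI impI)
    fix a b assume ab: "a < r" "b < r"
    show "1 / sqrt (\<mu> a) * (1 / sqrt (\<mu> b) * ip N (V a) (V b)) = (if a = b then 1 else 0)"
      using VV[OF ab] \<mu>_pos[OF ab(1)] by auto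
  qed
  then obtain U where U: "orthonormal N N U" "\<And>a. a < r \<Longrightarrow> U a = W a" using orthonormal_extend r by metis
  have g: "glen N r G u = (\<Sum>a<r. \<mu> a * (rot N U u a)\<^sup>2)" for u
  proof -
    have "glen N r G u = (\<Sum>a<r. (ip r (c a) (\<lambda>k. ip N (\<lambda>j. G (j, k)) u))\<^sup>2)"
      unfolding orthonormal_parseval[OF c] by (simp add: glen_def ip_def[of r] power2_eq_square)
    also have "\<dots> = (\<Sum>a<r. \<mu> a * (rot N U u a)\<^sup>2)"
    proof (rule sum.cong[OF refl])
      fix a assume a: "a \<in> {..<r}"
      have "ip r (c a) (\<lambda>k. ip N (\<lambda>j. G (j, k)) u) = ip N (V a) u"
        unfolding V_alt ip_sum_left ip_scale_left by (simp add: ip_def[of r])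
      moreover have "rot N U u a = 1 / sqrt (\<mu> a) * ip N (V a) u"
        using a by (simp add: rot_def U(2) W_def ip_scale_left del: times_divide_eq_left)
      ultimately show "(ip r (c a) (\<lambda>k. ip N (\<lambda>j. G (j, k)) u))\<^sup>2 = \<mu> a * (rot N U u a)\<^sup>2"
        using \<mu>_pos[of a] a by (simp add: power_divide)
    qed
    finally show ?thesis .
  qed
  show ?thesis
  proof (rule that[OF U(1)])
    show "(1 - \<delta>) * real N * (\<Sum>k<r. (rot N U u k)\<^sup>2) \<le> glen N r G u" for u
      unfolding g sum_distrib_left using \<mu>_bounds by (intro sum_mono mult_right_mono) auto
    show "glen N r G u \<le> (1 + \<delta>) * real N * (\<Sum>k<r. (rot N U u k)\<^sup>2)" for u
      unfolding g sum_distrib_left using \<mu>_bounds by (intro sum_mono mult_right_mono) auto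
  qed
qed

definition overlap_le :: "nat \<Rightarrow> nat \<Rightarrow> real \<Rightarrow> (nat \<Rightarrow> nat \<Rightarrow> real) \<Rightarrow> bool" where
  "overlap_le N r y H \<longleftrightarrow> (\<forall>l u. eigvec N H l u \<longrightarrow> real N * (\<Sum>k<r. (u k)\<^sup>2) \<le> y)"

lemma quad_form_diag_proj:
  assumes "r \<le> N"
  shows "quad_form N (diag_proj N r) u = (\<Sum>k<r. (u k)\<^sup>2)"
proof -
  have "quad_form N (diag_proj N r) u = (\<Sum>i<N. \<Sum>j<N. if j = i then (if i < r then (u i)\<^sup>2 else 0) else 0)"
    unfolding quad_form_def by (intro sum.cong refl) (auto simp: diag_proj_def power2_eq_square)
  also have "\<dots> = (\<Sum>i<N. if i < r then (u i)\<^sup>2 else 0)" by simp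
  also have "\<dots> = (\<Sum>k<r. (u k)\<^sup>2)"
    by (rule sum.mono_neutral_cong_right) (use assms in auto)
  finally show ?thesis .
qed

text \<open>\<open>Sup\<close> on the reals has its meaning only for nonempty bounded sets: the
  spectral theorem provides an eigenvector, and unit length bounds the values by
  \<open>N\<close>.\<close>

lemma max_overlap_le_iff:
  assumes N: "0 < N" and r: "r \<le> N" and sym: "\<And>i j. i < N \<Longrightarrow> j < N \<Longrightarrow> H i j = H j i"
  shows "max_overlap N (diag_proj N r) H \<le> y \<longleftrightarrow> overlap_le N r y H"
proof -
  define S where "S = {real N * quad_form N (diag_proj N r) u | u. unit_eigenvector N H u}"
  obtain w l where w: "orthonormal N N w" "\<And>a i. a < N \<Longrightarrow> i < N \<Longrightarrow> mv N H (w a) i = l a * w a i"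
    using spectral_theorem[of N H] sym by metis
  have "eigvec N H (l 0) (w 0)" using w N by (simp add: eigvec_def orthonormal_def)
  then have ne: "S \<noteq> {}" by (auto simp: S_def unit_eigenvector_iff)
  have "x \<le> real N" if x: "x \<in> S" for x
  proof -
    obtain u where u: "x = real N * quad_form N (diag_proj N r) u" "ip N u u = 1"
      using x by (auto simp: S_def unit_eigenvector_iff eigvec_def)
    have "(\<Sum>k<r. (u k)\<^sup>2) \<le> (\<Sum>k<N. (u k)\<^sup>2)" using r by (intro sum_mono2) auto
    then have "(\<Sum>k<r. (u k)\<^sup>2) \<le> 1" using u(2) by (simp add: ip_def power2_eq_square)
    then show ?thesis using u(1) mult_left_mono[of "\<Sum>k<r. (u k)\<^sup>2" 1 "real N"]
      by (simp add: quad_form_diag_proj[OF r])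
  qed
  then have "bdd_above S" unfolding bdd_above_def by blast
  then have "Sup S \<le> y \<longleftrightarrow> (\<forall>x\<in>S. x \<le> y)" using ne by (rule cSup_le_iff[rotated])
  then show ?thesis
    by (auto simp: max_overlap_def S_def overlap_le_def quad_form_diag_proj[OF r] unit_eigenvector_iff)
qed

text \<open>The complement asks for an eigenvector with \<open>c < f \<omega> u\<close>. This strict
  condition is not closed, but it is the countable union over \<open>m\<close> of the conditions
  \<open>c + 1 / real (Suc m) \<le> f \<omega> u\<close>, each closed by compactness of the
  sphere.\<close>

lemma borel_all_eigvec:
  fixes f :: "'a::topological_space \<Rightarrow> (nat \<Rightarrow> real) \<Rightarrow> real"
  assumes H: "\<And>i j. continuous_on UNIV (\<lambda>x :: 'a \<times> (nat \<Rightarrow> real). H (fst x) i j)"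
    and f: "continuous_on UNIV (\<lambda>x. f (fst x) (snd x))"
    and cong: "\<And>\<omega> u v. (\<And>i. i < n \<Longrightarrow> u i = v i) \<Longrightarrow> f \<omega> u = f \<omega> v"
  shows "{\<omega>. \<forall>l u. eigvec n (H \<omega>) l u \<longrightarrow> f \<omega> u \<le> c} \<in> sets borel"
proof -
  have cl: "closed {\<omega>. \<exists>u l. eigvec n (H \<omega>) l u \<and> d \<le> f \<omega> u}" for d
  proof -
    have "closed {x :: 'a \<times> (nat \<Rightarrow> real).
       (\<forall>i\<in>{..<n}. mv n (H (fst x)) (snd x) i = ip n (snd x) (mv n (H (fst x)) (snd x)) * snd x i)
       \<and> d \<le> f (fst x) (snd x)}"
      unfolding Collect_conj_eq Collect_ball_eq
      by (intro closed_Int closed_INT ballI closed_Collect_eq closed_Collect_le continuous_on_mult continuous_on_ip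
          continuous_on_mv2 H f continuous_on_snd_apply continuous_on_const)
    from closed_compact_exists[OF compact_sphere_fun[of n] this]
    have "closed {\<omega>. \<exists>v\<in>sphere_fun n. (\<forall>i\<in>{..<n}. mv n (H \<omega>) v i = ip n v (mv n (H \<omega>) v) * v i) \<and> d \<le> f \<omega> v}"
      by simp
    moreover have "(\<exists>u l. eigvec n (H \<omega>) l u \<and> d \<le> f \<omega> u) \<longleftrightarrow>
      (\<exists>v\<in>sphere_fun n. (\<forall>i\<in>{..<n}. mv n (H \<omega>) v i = ip n v (mv n (H \<omega>) v) * v i) \<and> d \<le> f \<omega> v)" for \<omega>
      by (rule ex_eigvec_sphere) (use cong in metis)
    ultimately show ?thesis by simp
  qed
  have "(\<exists>u l. eigvec n (H \<omega>) l u \<and> c < f \<omega> u) \<longleftrightarrow> (\<exists>m. \<exists>u l. eigvec n (H \<omega>) l u \<and> c + 1 / real (Suc m) \<le> f \<omega> u)" for \<omega>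
  proof
    assume "\<exists>u l. eigvec n (H \<omega>) l u \<and> c < f \<omega> u"
    then obtain u l where u: "eigvec n (H \<omega>) l u" "c < f \<omega> u" by blast
    then obtain m where "1 / real (Suc m) < f \<omega> u - c"
      using nat_approx_posE[of "f \<omega> u - c"] by auto
    then show "\<exists>m. \<exists>u l. eigvec n (H \<omega>) l u \<and> c + 1 / real (Suc m) \<le> f \<omega> u"
      using u(1) by (intro exI[of _ m] exI[of _ u] exI[of _ l]) auto
  next
    assume "\<exists>m. \<exists>u l. eigvec n (H \<omega>) l u \<and> c + 1 / real (Suc m) \<le> f \<omega> u"
    then obtain m u l where u: "eigvec n (H \<omega>) l u" "c + 1 / real (Suc m) \<le> f \<omega> u" by blast
    moreover have "1 / real (Suc m) > 0" by simp
    ultimately have "c < f \<omega> u" by linarith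
    then show "\<exists>u l. eigvec n (H \<omega>) l u \<and> c < f \<omega> u" using u(1) by blast
  qed
  moreover have "(\<forall>l u. eigvec n (H \<omega>) l u \<longrightarrow> f \<omega> u \<le> c) \<longleftrightarrow> \<not> (\<exists>u l. eigvec n (H \<omega>) l u \<and> c < f \<omega> u)" for \<omega>
    unfolding not_le[symmetric] by blast
  ultimately have "{\<omega>. \<forall>l u. eigvec n (H \<omega>) l u \<longrightarrow> f \<omega> u \<le> c}
     = - (\<Union>m. {\<omega>. \<exists>u l. eigvec n (H \<omega>) l u \<and> c + 1 / real (Suc m) \<le> f \<omega> u})"
    by (simp only: set_eq_iff mem_Collect_eq Compl_iff UN_iff) simp
  moreover have "(\<Union>m. {\<omega>. \<exists>u l. eigvec n (H \<omega>) l u \<and> c + 1 / real (Suc m) \<le> f \<omega> u}) \<in> sets borel"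
    by (rule sets.countable_UN, rule image_subsetI, rule borel_closed, rule cl)
  ultimately show ?thesis by (simp only: borel_comp)
qed

lemma glen_cong: "(\<And>i. i < N \<Longrightarrow> u i = v i) \<Longrightarrow> glen N r G u = glen N r G v"
  by (simp add: glen_def ip_def)

lemma sets_overlap_le:
  assumes "r \<le> N"
  shows "{g \<in> space (gaussian (goe_index N)). overlap_le N r y (goe_matrix N g)} \<in> sets (gaussian (goe_index N))"
proof -
  have "{g. \<forall>l u. eigvec N (goe_matrix N g) l u \<longrightarrow> real N * (\<Sum>k<r. (u k)\<^sup>2) \<le> y} \<in> sets borel"
    by (rule borel_all_eigvec)
       (use assms in \<open>auto intro!: continuous_on_goe_matrix continuous_on_fst_apply continuous_on_mult
          continuous_on_sum continuous_on_power continuous_on_snd_apply continuous_on_const sum.cong\<close>)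
  from measurable_sets[OF measurable_gaussian_borel this]
  show ?thesis by (simp add: overlap_le_def vimage_def Int_def conj_commute)
qed

lemma sets_glen_le:
  "{z \<in> space (gaussian I \<Otimes>\<^sub>M gaussian (goe_index N)).
      \<forall>l u. eigvec N (goe_matrix N (snd z)) l u \<longrightarrow> glen N r (fst z) u \<le> c}
    \<in> sets (gaussian I \<Otimes>\<^sub>M gaussian (goe_index N))"
proof -
  have c1: "continuous_on UNIV (\<lambda>x :: ((nat \<times> nat \<Rightarrow> real) \<times> (nat \<times> nat \<Rightarrow> real)) \<times> (nat \<Rightarrow> real). fst (fst x) p)"
    for p by (rule continuous_on_product_then_coordinatewise) (intro continuous_on_fst continuous_on_id)
  have c2: "continuous_on UNIV (\<lambda>x :: ((nat \<times> nat \<Rightarrow> real) \<times> (nat \<times> nat \<Rightarrow> real)) \<times> (nat \<Rightarrow> real). snd (fst x) p)"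
    for p by (rule continuous_on_product_then_coordinatewise) (intro continuous_on_fst continuous_on_snd continuous_on_id)
  have "{z :: (nat \<times> nat \<Rightarrow> real) \<times> (nat \<times> nat \<Rightarrow> real).
      \<forall>l u. eigvec N (goe_matrix N (snd z)) l u \<longrightarrow> glen N r (fst z) u \<le> c} \<in> sets borel"
  proof (rule borel_all_eigvec)
    show "continuous_on UNIV (\<lambda>x :: ((nat \<times> nat \<Rightarrow> real) \<times> (nat \<times> nat \<Rightarrow> real)) \<times> (nat \<Rightarrow> real). glen N r (fst (fst x)) (snd x))"
      unfolding glen_def by (intro continuous_on_sum continuous_on_power continuous_on_ip c1 continuous_on_snd_apply)
  qed (auto intro!: continuous_on_goe_matrix c2 glen_cong)
  moreover have "(\<lambda>z. (fst z, snd z)) \<in> borel_measurable (gaussian I \<Otimes>\<^sub>M gaussian (goe_index N))"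
    by (intro borel_measurable_Pair measurable_compose[OF measurable_fst measurable_gaussian_borel]
        measurable_compose[OF measurable_snd measurable_gaussian_borel])
  ultimately have "(\<lambda>z. (fst z, snd z)) -` {z. \<forall>l u. eigvec N (goe_matrix N (snd z)) l u \<longrightarrow> glen N r (fst z) u \<le> c}
     \<inter> space (gaussian I \<Otimes>\<^sub>M gaussian (goe_index N)) \<in> sets (gaussian I \<Otimes>\<^sub>M gaussian (goe_index N))"
    by (rule measurable_sets[rotated])
  then show ?thesis by (simp add: vimage_def Int_def conj_commute)
qed

section \<open>Chi-squared laws of projected eigenvectors\<close>

definition chi_le :: "nat \<Rightarrow> real \<Rightarrow> real" where
  "chi_le r c = measure (gaussian {..<r}) {x \<in> space (gaussian {..<r}). (\<Sum>k<r. (x k)\<^sup>2) \<le> c}"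

lemma emeasure_all_rows_le:
  "emeasure (gauss_array N r) {G \<in> space (gauss_array N r). \<forall>j<N. (\<Sum>k<r. (G (j, k))\<^sup>2) \<le> c}
    = ennreal (chi_le r c ^ N)"
proof -
  interpret JK: product_prob_space "\<lambda>_. gaussian {..<r}" "{..<N}"
    by standard (rule prob_space.emeasure_space_1 prob_space_imp_sigma_finite prob_space_gaussian)+
  define S where "S = {x \<in> space (gaussian {..<r}). (\<Sum>k<r. (x k)\<^sup>2) \<le> c}"
  define E where "E = {G \<in> space (gauss_array N r). \<forall>j\<in>{..<N}. (\<Sum>k<r. (G (j, k))\<^sup>2) \<le> c}"
  define \<phi> :: "(nat \<Rightarrow> nat \<Rightarrow> real) \<Rightarrow> nat \<times> nat \<Rightarrow> real" where "\<phi> f = (\<lambda>p\<in>{..<N} \<times> {..<r}. f (fst p) (snd p))" for f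
  have S: "S \<in> sets (gaussian {..<r})" unfolding S_def by measurable
  have E: "E \<in> sets (gauss_array N r)" unfolding E_def
    by measurable
  have curry: "distr (PiM {..<N} (\<lambda>_. gaussian {..<r})) (gauss_array N r) \<phi> = gauss_array N r"
    unfolding \<phi>_def[abs_def] by (rule gaussian_curry) auto
  have m: "\<phi> \<in> measurable (PiM {..<N} (\<lambda>_. gaussian {..<r})) (gauss_array N r)"
    unfolding \<phi>_def[abs_def] by (rule measurable_curry)
  have "\<phi> -` E \<inter> space (PiM {..<N} (\<lambda>_. gaussian {..<r})) = Pi\<^sub>E {..<N} (\<lambda>_. S)"
    by (auto simp: E_def S_def \<phi>_def space_PiM PiE_iff extensional_def)
  then have "emeasure (gauss_array N r) E = emeasure (PiM {..<N} (\<lambda>_. gaussian {..<r})) (Pi\<^sub>E {..<N} (\<lambda>_. S))"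
    using emeasure_distr[OF m E] unfolding curry by simp
  also have "\<dots> = (\<Prod>j<N. emeasure (gaussian {..<r}) S)"
    by (rule JK.emeasure_PiM) (use S in auto)
  also have "\<dots> = ennreal (chi_le r c ^ N)"
    by (simp add: emeasure_gaussian_eq chi_le_def S_def ennreal_power)
  finally show ?thesis by (simp only: E_def Ball_def lessThan_iff)
qed

text \<open>By simplicity all unit eigenvectors are the \<open>w j\<close> up to sign, and
  \<open>glen\<close> is even, so only \<open>N\<close> conditions remain. Rotating the first index
  of the array by \<open>w\<close> preserves its law and turns \<open>glen N r G (w j)\<close> into
  the squared length of row \<open>j\<close>; rows are independent.\<close>

lemma emeasure_glen_le_fixed:
  assumes simple: "simple_spectrum N H" and sym: "\<And>i j. i < N \<Longrightarrow> j < N \<Longrightarrow> H i j = H j i"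
  shows "emeasure (gauss_array N r) {G \<in> space (gauss_array N r). \<forall>l u. eigvec N H l u \<longrightarrow> glen N r G u \<le> c}
    = ennreal (chi_le r c ^ N)"
proof -
  obtain w l where w: "orthonormal N N w" and l: "\<And>a i. a < N \<Longrightarrow> i < N \<Longrightarrow> mv N H (w a) i = l a * w a i"
    using spectral_theorem[of N H] sym by metis
  define \<phi> :: "(nat \<times> nat \<Rightarrow> real) \<Rightarrow> nat \<times> nat \<Rightarrow> real"
    where "\<phi> G = (\<lambda>p\<in>{..<N} \<times> {..<r}. rot N w (\<lambda>i. G (i, snd p)) (fst p))" for G
  define E where "E = {G \<in> space (gauss_array N r). \<forall>j\<in>{..<N}. (\<Sum>k<r. (G (j, k))\<^sup>2) \<le> c}"
  have E: "E \<in> sets (gauss_array N r)" unfolding E_def by measurable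
  have m: "\<phi> \<in> measurable (gauss_array N r) (gauss_array N r)"
    unfolding \<phi>_def rot_def ip_def measurable_cong_sets[OF sets_gaussian sets_gaussian]
    by (intro measurable_restrict borel_measurable_sum borel_measurable_times borel_measurable_const measurable_component_singleton) auto
  have rotate: "distr (gauss_array N r) (gauss_array N r) \<phi> = gauss_array N r"
    unfolding \<phi>_def[abs_def] by (rule gaussian_rotate_first[OF w]) auto
  have all: "(\<forall>l u. eigvec N H l u \<longrightarrow> glen N r G u \<le> c) \<longleftrightarrow> (\<forall>j<N. glen N r G (w j) \<le> c)" for G
  proof
    assume "\<forall>l u. eigvec N H l u \<longrightarrow> glen N r G u \<le> c"
    moreover have "eigvec N H (l j) (w j)" if "j < N" for j using w l that by (simp add: eigvec_def orthonormal_def)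
    ultimately show "\<forall>j<N. glen N r G (w j) \<le> c" by blast
  next
    assume le: "\<forall>j<N. glen N r G (w j) \<le> c"
    show "\<forall>l u. eigvec N H l u \<longrightarrow> glen N r G u \<le> c"
    proof (intro allI impI)
      fix m u assume u: "eigvec N H m u"
      obtain a d where a: "a < N" "d\<^sup>2 = 1" "\<forall>i<N. u i = d * w a i"
        using simple_spectrum_eigvec[OF sym simple w l u] by blast
      have "glen N r G u = glen N r G (\<lambda>i. d * w a i)" by (rule glen_cong) (use a in auto)
      also have "\<dots> = glen N r G (w a)" by (simp add: glen_def ip_scale_right power_mult_distrib a(2))
      finally show "glen N r G u \<le> c" using le a(1) by simp
    qed
  qed
  have gl: "glen N r G (w j) = (\<Sum>k<r. (\<phi> G (j, k))\<^sup>2)" if "j < N" for j G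
    using that by (simp add: glen_def \<phi>_def rot_def ip_commute[of N _ "w j"])
  have "{G \<in> space (gauss_array N r). \<forall>l u. eigvec N H l u \<longrightarrow> glen N r G u \<le> c}
      = \<phi> -` E \<inter> space (gauss_array N r)"
    unfolding all by (auto simp: E_def gl space_PiM) (auto simp: \<phi>_def)
  then have "emeasure (gauss_array N r) {G \<in> space (gauss_array N r). \<forall>l u. eigvec N H l u \<longrightarrow> glen N r G u \<le> c}
      = emeasure (gauss_array N r) E"
    using emeasure_distr[OF m E] unfolding rotate by simp
  also have "\<dots> = ennreal (chi_le r c ^ N)" using emeasure_all_rows_le[of N r c] by (simp only: E_def Ball_def lessThan_iff)
  finally show ?thesis .
qed

text \<open>After exchanging the integrals, the probability over \<open>G\<close> is the same
  constant for almost every GOE sample, because almost every sample has simple spectrum.\<close>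

lemma nn_integral_glen_le:
  "(\<integral>\<^sup>+G. emeasure (gaussian (goe_index N)) {g \<in> space (gaussian (goe_index N)).
      \<forall>l u. eigvec N (goe_matrix N g) l u \<longrightarrow> glen N r G u \<le> c} \<partial>gauss_array N r) = ennreal (chi_le r c ^ N)"
proof -
  let ?G = "gauss_array N r" and ?H = "gaussian (goe_index N)"
  interpret G: prob_space ?G by (rule prob_space_gaussian)
  interpret H: prob_space ?H by (rule prob_space_gaussian)
  interpret pair_sigma_finite ?G ?H by standard
  define W where "W = {z \<in> space (?G \<Otimes>\<^sub>M ?H). \<forall>l u. eigvec N (goe_matrix N (snd z)) l u \<longrightarrow> glen N r (fst z) u \<le> c}"
  have W: "W \<in> sets (?G \<Otimes>\<^sub>M ?H)" unfolding W_def by (rule sets_glen_le)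
  have "(\<integral>\<^sup>+G. emeasure ?H {g \<in> space ?H. \<forall>l u. eigvec N (goe_matrix N g) l u \<longrightarrow> glen N r G u \<le> c} \<partial>?G)
     = (\<integral>\<^sup>+G. emeasure ?H (Pair G -` W) \<partial>?G)"
    by (intro nn_integral_cong arg_cong2[where f = emeasure] refl) (auto simp: W_def space_pair_measure)
  also have "\<dots> = emeasure (?G \<Otimes>\<^sub>M ?H) W" by (rule sigma_finite_measure.emeasure_pair_measure_alt[OF prob_space_imp_sigma_finite[OF prob_space_gaussian] W, symmetric])
  also have "\<dots> = (\<integral>\<^sup>+g. emeasure ?G ((\<lambda>G. (G, g)) -` W) \<partial>?H)" by (rule emeasure_pair_measure_alt2[OF W])
  also have "\<dots> = (\<integral>\<^sup>+g. ennreal (chi_le r c ^ N) \<partial>?H)"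
  proof (rule nn_integral_cong_AE)
    have "AE g in ?H. simple_spectrum N (goe_matrix N g)" by (rule AE_simple_spectrum_minor) simp
    moreover have "AE g in ?H. g \<in> space ?H" by simp
    ultimately show "AE g in ?H. emeasure ?G ((\<lambda>G. (G, g)) -` W) = ennreal (chi_le r c ^ N)"
    proof eventually_elim
      case (elim g)
      have "(\<lambda>G. (G, g)) -` W = {G \<in> space ?G. \<forall>l u. eigvec N (goe_matrix N g) l u \<longrightarrow> glen N r G u \<le> c}"
        using elim(2) by (auto simp: W_def space_pair_measure)
      then show ?case using emeasure_glen_le_fixed[OF elim(1) goe_matrix_sym] by simp
    qed
  qed
  also have "\<dots> = ennreal (chi_le r c ^ N)" by (simp add: emeasure_space_gaussian)
  finally show ?thesis .
qed

lemma emeasure_overlap_le_conj: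
  assumes U: "orthonormal N N U" and r: "r \<le> N"
  shows "emeasure (gaussian (goe_index N)) {g \<in> space (gaussian (goe_index N)). overlap_le N r y (conj_mat N U (goe_matrix N g))}
     = emeasure (gaussian (goe_index N)) {g \<in> space (gaussian (goe_index N)). overlap_le N r y (goe_matrix N g)}"
proof -
  let ?H = "gaussian (goe_index N)"
  define \<phi> where "\<phi> g = goe_vec N (conj_mat N U (goe_matrix N g))" for g
  define E where "E = {g \<in> space ?H. overlap_le N r y (goe_matrix N g)}"
  have E: "E \<in> sets ?H" unfolding E_def by (rule sets_overlap_le[OF r])
  have m: "\<phi> \<in> measurable ?H ?H"
    unfolding \<phi>_def goe_vec_def conj_mat_def measurable_cong_sets[OF sets_gaussian sets_gaussian] by measurable
  have eq: "overlap_le N r y (goe_matrix N (\<phi> g)) = overlap_le N r y (conj_mat N U (goe_matrix N g))" for g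
  proof -
    have "eigvec N (goe_matrix N (\<phi> g)) l u = eigvec N (conj_mat N U (goe_matrix N g)) l u" for l u
      unfolding \<phi>_def by (rule eigvec_mat_cong) (rule goe_matrix_vec[OF conj_mat_sym[OF goe_matrix_sym]])
    then show ?thesis by (simp add: overlap_le_def)
  qed
  have "{g \<in> space ?H. overlap_le N r y (conj_mat N U (goe_matrix N g))} = \<phi> -` E \<inter> space ?H"
    using measurable_space[OF m] by (auto simp: E_def eq)
  then have "emeasure ?H {g \<in> space ?H. overlap_le N r y (conj_mat N U (goe_matrix N g))} = emeasure ?H E"
    using emeasure_distr[OF m E] unfolding \<phi>_def[abs_def] goe_orthogonal_invariant[OF U] by simp
  then show ?thesis by (simp add: E_def)
qed

lemma overlap_le_conj_iff:
  assumes U: "orthonormal N N U" and r: "r \<le> N"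
  shows "overlap_le N r y (conj_mat N U H) \<longleftrightarrow> (\<forall>l u. eigvec N H l u \<longrightarrow> real N * (\<Sum>k<r. (rot N U u k)\<^sup>2) \<le> y)"
  unfolding overlap_le_def by (rule all_eigvec_conj_mat[OF U]) (use r in simp)

text \<open>For a fixed good \<open>G\<close> the frame rotation \<open>U\<close> leaves the GOE law
  unchanged, so the same number \<open>p\<close> is the probability of a bound on the rotated
  coordinates, which \<open>glen\<close> brackets. Averaging over \<open>G\<close> replaces the
  \<open>glen\<close> events by powers of \<open>chi_le\<close>, and each \<open>G\<close> in
  \<open>Bad\<close> costs at most 1. \<open>Bad\<close> is any measurable set covering the arrays
  that are not near isometries.\<close>

theorem overlap_comparison:
  fixes N r :: nat and \<delta> y :: real
  assumes N: "0 < N" and r: "r \<le> N" and \<delta>: "0 \<le> \<delta>" "\<delta> < 1"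
    and Bad: "Bad \<in> sets (gauss_array N r)"
    and good: "\<And>G. G \<in> space (gauss_array N r) \<Longrightarrow> G \<notin> Bad \<Longrightarrow> near_isometry N r \<delta> G"
  defines "p \<equiv> measure (gaussian (goe_index N)) {g \<in> space (gaussian (goe_index N)). overlap_le N r y (goe_matrix N g)}"
    and "b \<equiv> measure (gauss_array N r) Bad"
  shows "chi_le r ((1 - \<delta>) * y) ^ N - b \<le> p" and "p \<le> chi_le r ((1 + \<delta>) * y) ^ N + b"
proof -
  let ?G = "gauss_array N r" and ?H = "gaussian (goe_index N)"
  define E where "E c G = {g \<in> space ?H. \<forall>l u. eigvec N (goe_matrix N g) l u \<longrightarrow> glen N r G u \<le> c}" for c G
  have E_int: "(\<integral>\<^sup>+G. emeasure ?H (E c G) \<partial>?G) = ennreal (chi_le r c ^ N)" for c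
    unfolding E_def by (rule nn_integral_glen_le)
  have E_sets: "E c G \<in> sets ?H" for c G
  proof -
    have "{g. \<forall>l u. eigvec N (goe_matrix N g) l u \<longrightarrow> glen N r G u \<le> c} \<in> sets borel"
      by (rule borel_all_eigvec)
         (auto intro!: continuous_on_goe_matrix continuous_on_fst_apply continuous_on_sum continuous_on_power
            continuous_on_mult continuous_on_const continuous_on_snd_apply simp: glen_def ip_def)
    from measurable_sets[OF measurable_gaussian_borel this]
    show ?thesis by (simp add: E_def vimage_def Int_def conj_commute)
  qed
  have p1: "p \<le> 1" by (simp add: p_def measure_gaussian_le_1)
  have sandwich: "emeasure ?H (E ((1 - \<delta>) * y) G) \<le> ennreal p" "ennreal p \<le> emeasure ?H (E ((1 + \<delta>) * y) G)"
    if G: "G \<in> space ?G" "G \<notin> Bad" for G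
  proof -
    obtain U where U: "orthonormal N N U"
      and lo: "\<And>u. (1 - \<delta>) * real N * (\<Sum>k<r. (rot N U u k)\<^sup>2) \<le> glen N r G u"
      and hi: "\<And>u. glen N r G u \<le> (1 + \<delta>) * real N * (\<Sum>k<r. (rot N U u k)\<^sup>2)"
      using near_isometry_frame[OF good[OF G] \<delta>(2) N r] by blast
    define F where "F = {g \<in> space ?H. overlap_le N r y (conj_mat N U (goe_matrix N g))}"
    have p: "ennreal p = emeasure ?H F"
      unfolding F_def emeasure_overlap_le_conj[OF U r] p_def by (simp add: emeasure_gaussian_eq)
    have F: "F \<in> sets ?H"
    proof -
      have "{g. \<forall>l u. eigvec N (goe_matrix N g) l u \<longrightarrow> real N * (\<Sum>k<r. (rot N U u k)\<^sup>2) \<le> y} \<in> sets borel"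
      proof (rule borel_all_eigvec)
        show "real N * (\<Sum>k<r. (rot N U u k)\<^sup>2) = real N * (\<Sum>k<r. (rot N U v k)\<^sup>2)"
          if "\<And>i. i < N \<Longrightarrow> u i = v i" for u v using rot_cong[of N u v U] that by simp
      qed (auto intro!: continuous_on_goe_matrix continuous_on_fst_apply continuous_on_sum continuous_on_power
            continuous_on_ip continuous_on_const continuous_on_snd_apply continuous_on_mult simp: rot_def[abs_def])
      from measurable_sets[OF measurable_gaussian_borel this]
      show ?thesis by (simp add: F_def overlap_le_conj_iff[OF U r] vimage_def Int_def conj_commute)
    qed
    have "E ((1 - \<delta>) * y) G \<subseteq> F"
    proof
      fix g assume g: "g \<in> E ((1 - \<delta>) * y) G"
      have "real N * (\<Sum>k<r. (rot N U u k)\<^sup>2) \<le> y" if "eigvec N (goe_matrix N g) l u" for l u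
      proof -
        have "(1 - \<delta>) * (real N * (\<Sum>k<r. (rot N U u k)\<^sup>2)) \<le> (1 - \<delta>) * y"
          using g that order_trans[OF lo[of u]] by (auto simp: E_def mult.assoc)
        then show ?thesis using \<delta> by (simp add: mult_le_cancel_left)
      qed
      then show "g \<in> F" using g by (auto simp: F_def E_def overlap_le_conj_iff[OF U r])
    qed
    then show "emeasure ?H (E ((1 - \<delta>) * y) G) \<le> ennreal p" unfolding p by (rule emeasure_mono[OF _ F])
    have "F \<subseteq> E ((1 + \<delta>) * y) G"
    proof
      fix g assume g: "g \<in> F"
      have "glen N r G u \<le> (1 + \<delta>) * y" if "eigvec N (goe_matrix N g) l u" for l u
      proof -
        have "real N * (\<Sum>k<r. (rot N U u k)\<^sup>2) \<le> y"
          using g that by (auto simp: F_def overlap_le_conj_iff[OF U r])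
        then have "(1 + \<delta>) * (real N * (\<Sum>k<r. (rot N U u k)\<^sup>2)) \<le> (1 + \<delta>) * y"
          using \<delta> by (intro mult_left_mono) auto
        then show ?thesis using hi[of u] by (simp add: mult.assoc)
      qed
      then show "g \<in> E ((1 + \<delta>) * y) G" using g by (auto simp: F_def E_def)
    qed
    then show "ennreal p \<le> emeasure ?H (E ((1 + \<delta>) * y) G)" unfolding p by (rule emeasure_mono[OF _ E_sets])
  qed
  have b: "(\<integral>\<^sup>+G. indicator Bad G \<partial>?G) = ennreal b" using Bad by (simp add: b_def emeasure_gaussian_eq)
  have b0: "0 \<le> b" and p0: "0 \<le> p" and c0: "0 \<le> chi_le r c" for c by (simp_all add: b_def p_def chi_le_def)
  have "ennreal (chi_le r ((1 - \<delta>) * y) ^ N) \<le> (\<integral>\<^sup>+G. ennreal p + indicator Bad G \<partial>?G)"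
    unfolding E_int[symmetric]
  proof (intro nn_integral_mono)
    fix G assume "G \<in> space ?G"
    then show "emeasure ?H (E ((1 - \<delta>) * y) G) \<le> ennreal p + indicator Bad G"
    proof (cases "G \<in> Bad")
      case True
      have "emeasure ?H (E ((1 - \<delta>) * y) G) \<le> ennreal p + 1"
        by (rule order_trans[OF emeasure_gaussian_le_1]) simp
      then show ?thesis using True by simp
    qed (use sandwich(1)[of G] in simp)
  qed
  also have "\<dots> = ennreal (p + b)"
    using Bad b b0 p0 by (subst nn_integral_add) (auto simp: emeasure_space_gaussian)
  finally have "chi_le r ((1 - \<delta>) * y) ^ N \<le> p + b"
    using b0 p0 by (subst (asm) ennreal_le_iff) simp_all
  then show "chi_le r ((1 - \<delta>) * y) ^ N - b \<le> p" by simp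
  \<comment> \<open>Measurability of the section probabilities in \<open>G\<close>, so that the
    integral of the upper bound may be split into a sum.\<close>
  have m: "(\<lambda>G. emeasure ?H (E ((1 + \<delta>) * y) G)) \<in> borel_measurable ?G"
  proof -
    have "(\<lambda>G. emeasure ?H (Pair G -` {z \<in> space (?G \<Otimes>\<^sub>M ?H). \<forall>l u. eigvec N (goe_matrix N (snd z)) l u \<longrightarrow> glen N r (fst z) u \<le> (1 + \<delta>) * y}))
       \<in> borel_measurable ?G"
      by (rule sigma_finite_measure.measurable_emeasure_Pair[OF prob_space_imp_sigma_finite[OF prob_space_gaussian] sets_glen_le])
    then show ?thesis
      by (rule measurable_cong[THEN iffD1, rotated])
         (auto simp: E_def space_pair_measure intro!: arg_cong2[where f = emeasure])
  qed
  have "ennreal p = (\<integral>\<^sup>+G. ennreal p \<partial>?G)" by (simp add: emeasure_space_gaussian)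
  also have "\<dots> \<le> (\<integral>\<^sup>+G. emeasure ?H (E ((1 + \<delta>) * y) G) + indicator Bad G \<partial>?G)"
  proof (intro nn_integral_mono)
    fix G assume "G \<in> space ?G"
    then show "ennreal p \<le> emeasure ?H (E ((1 + \<delta>) * y) G) + indicator Bad G"
    proof (cases "G \<in> Bad")
      case True
      have "ennreal p \<le> 1" using p1 by simp
      also have "1 \<le> emeasure ?H (E ((1 + \<delta>) * y) G) + 1" by simp
      finally show ?thesis using True by simp
    qed (use sandwich(2)[of G] in simp)
  qed
  also have "\<dots> = ennreal (chi_le r ((1 + \<delta>) * y) ^ N + b)"
    using Bad b b0 c0 m by (subst nn_integral_add) (auto simp: E_int)
  finally show "p \<le> chi_le r ((1 + \<delta>) * y) ^ N + b"
    using b0 p0 c0 by (subst (asm) ennreal_le_iff) simp_all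
qed

section \<open>Singular values of a rectangular Gaussian array\<close>

text \<open>The weighted density is \<open>\<sigma>\<close> times the centred normal density of
  variance \<open>1 / (1 - 2 * t)\<close>.\<close>

lemma nn_integral_std_normal_exp_square:
  fixes t :: real
  assumes t: "t < 1 / 2"
  shows "(\<integral>\<^sup>+x. ennreal (exp (t * x\<^sup>2)) \<partial>std_normal_distribution) = ennreal (1 / sqrt (1 - 2 * t))"
proof -
  define \<sigma> where "\<sigma> = 1 / sqrt (1 - 2 * t)"
  have \<sigma>: "\<sigma> > 0" using t by (simp add: \<sigma>_def)
  have s2: "1 / \<sigma>\<^sup>2 = 1 - 2 * t" using t by (simp add: \<sigma>_def power_divide)
  have e: "std_normal_density x * exp (t * x\<^sup>2) = \<sigma> * normal_density 0 \<sigma> x" for x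
  proof -
    have "- x\<^sup>2 / 2 + t * x\<^sup>2 = - x\<^sup>2 / 2 * (1 / \<sigma>\<^sup>2)" unfolding s2 by (simp add: field_simps)
    then show ?thesis using \<sigma>
      by (simp add: normal_density_def exp_add[symmetric] real_sqrt_mult mult.commute)
  qed
  have "(\<integral>\<^sup>+x. ennreal (exp (t * x\<^sup>2)) \<partial>std_normal_distribution)
      = (\<integral>\<^sup>+x. ennreal (std_normal_density x * exp (t * x\<^sup>2)) \<partial>lborel)"
    by (subst nn_integral_density) (auto simp: ennreal_mult)
  also have "\<dots> = ennreal \<sigma> * (\<integral>\<^sup>+x. ennreal (normal_density 0 \<sigma> x) \<partial>lborel)"
    unfolding e using \<sigma> by (subst nn_integral_cmult[symmetric]) (auto simp: ennreal_mult)
  also have "(\<integral>\<^sup>+x. ennreal (normal_density 0 \<sigma> x) \<partial>lborel) = 1"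
    using prob_space.emeasure_space_1[OF prob_space_normal_density[OF \<sigma>, of 0]] by (simp add: emeasure_density)
  finally show ?thesis by (simp add: \<sigma>_def)
qed

text \<open>The linear term \<open>t\<close> is the mean of the exponent and will cancel against
  centring, so only \<open>4 * t\<^sup>2\<close> enters the Chernoff bound. The range of
  \<open>t\<close> is where the quadratic estimate of the logarithm applies at
  \<open>- 2 * t\<close>.\<close>

lemma inverse_sqrt_le_exp:
  fixes t :: real
  assumes "\<bar>t\<bar> \<le> 1 / 4"
  shows "1 / sqrt (1 - 2 * t) \<le> exp (t + 4 * t\<^sup>2)"
proof -
  have pos: "1 - 2 * t > 0" using assms by (simp add: abs_le_iff)
  have "\<bar>ln (1 + (- 2 * t)) - (- 2 * t)\<bar> \<le> 2 * (- 2 * t)\<^sup>2"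
    by (rule abs_ln_one_plus_x_minus_x_bound) (use assms in auto)
  then have "- (ln (1 - 2 * t)) / 2 \<le> t + 4 * t\<^sup>2" by (simp add: abs_le_iff power2_eq_square)
  then have "exp (- (ln (1 - 2 * t)) / 2) \<le> exp (t + 4 * t\<^sup>2)" by simp
  also have "exp (- (ln (1 - 2 * t)) / 2) = 1 / sqrt (1 - 2 * t)"
    using pos by (simp add: exp_minus ln_sqrt[symmetric] inverse_eq_divide)
  finally show ?thesis .
qed

text \<open>Completing \<open>c\<close> to an orthonormal basis and rotating makes the inner product
  with \<open>c\<close> the first coordinate, which is standard normal.\<close>

lemma nn_integral_gaussian_exp_ip:
  fixes t :: real
  assumes c: "ip r c c = 1" and t: "t < 1 / 2"
  shows "(\<integral>\<^sup>+x. ennreal (exp (t * (ip r x c)\<^sup>2)) \<partial>gaussian {..<r}) = ennreal (1 / sqrt (1 - 2 * t))"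
proof -
  have r: "0 < r" using c by (cases r) (auto simp: ip_def)
  have "orthonormal r 1 (\<lambda>_. c)" using c by (simp add: orthonormal_def)
  then obtain w where w: "orthonormal r r w" "\<And>a. a < 1 \<Longrightarrow> w a = c"
    by (rule orthonormal_extend) (use r in auto)
  have w0: "w 0 = c" by (rule w(2)) simp
  define \<phi> where "\<phi> x = (\<lambda>i\<in>{..<r}. rot r w x i)" for x
  have m: "\<phi> \<in> measurable (gaussian {..<r}) (gaussian {..<r})"
    unfolding \<phi>_def rot_def ip_def measurable_cong_sets[OF sets_gaussian sets_gaussian]
    by (intro measurable_restrict borel_measurable_sum borel_measurable_times borel_measurable_const measurable_component_singleton) auto
  have m0: "(\<lambda>x. x 0) \<in> measurable (gaussian {..<r}) std_normal_distribution"
    by (rule measurable_component_singleton) (use r in simp)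
  have "(\<integral>\<^sup>+x. ennreal (exp (t * (ip r x c)\<^sup>2)) \<partial>gaussian {..<r}) = (\<integral>\<^sup>+x. ennreal (exp (t * (\<phi> x 0)\<^sup>2)) \<partial>gaussian {..<r})"
    using r by (simp add: \<phi>_def rot_def w0 ip_commute[of r _ c])
  also have "\<dots> = (\<integral>\<^sup>+x. ennreal (exp (t * (x 0)\<^sup>2)) \<partial>distr (gaussian {..<r}) (gaussian {..<r}) \<phi>)"
    using m0 r by (subst nn_integral_distr[OF m]) auto
  also have "\<dots> = (\<integral>\<^sup>+x. ennreal (exp (t * (x 0)\<^sup>2)) \<partial>gaussian {..<r})"
    unfolding \<phi>_def[abs_def] gaussian_rotate[OF w(1)] ..
  also have "\<dots> = (\<integral>\<^sup>+y. ennreal (exp (t * y\<^sup>2)) \<partial>distr (gaussian {..<r}) std_normal_distribution (\<lambda>x. x 0))"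
    by (subst nn_integral_distr[OF m0]) auto
  also have "distr (gaussian {..<r}) std_normal_distribution (\<lambda>x. x 0) = std_normal_distribution"
    by (rule distr_PiM_component) (use r std_normal.prob_space_axioms in auto)
  finally show ?thesis using nn_integral_std_normal_exp_square[OF t] by simp
qed

definition gform :: "nat \<Rightarrow> nat \<Rightarrow> (nat \<times> nat \<Rightarrow> real) \<Rightarrow> (nat \<Rightarrow> real) \<Rightarrow> real" where
  "gform N r G c = (\<Sum>j<N. (ip r (\<lambda>k. G (j, k)) c)\<^sup>2)"

lemma gform_measurable [measurable]:
  "(\<lambda>G. gform N r G c) \<in> borel_measurable (gauss_array N r)"
  unfolding gform_def ip_def measurable_gaussian_cong
  by (intro borel_measurable_sum borel_measurable_power borel_measurable_times borel_measurable_const measurable_component_singleton) auto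

lemma nn_integral_exp_gform:
  fixes t :: real
  assumes c: "ip r c c = 1" and t: "t < 1 / 2"
  shows "(\<integral>\<^sup>+G. ennreal (exp (t * gform N r G c)) \<partial>gauss_array N r) = ennreal ((1 / sqrt (1 - 2 * t)) ^ N)"
proof -
  interpret JK: product_prob_space "\<lambda>_. gaussian {..<r}" "{..<N}"
    by standard (rule prob_space.emeasure_space_1 prob_space_imp_sigma_finite prob_space_gaussian)+
  define \<phi> :: "(nat \<Rightarrow> nat \<Rightarrow> real) \<Rightarrow> nat \<times> nat \<Rightarrow> real" where "\<phi> f = (\<lambda>p\<in>{..<N} \<times> {..<r}. f (fst p) (snd p))" for f
  have curry: "distr (PiM {..<N} (\<lambda>_. gaussian {..<r})) (gauss_array N r) \<phi> = gauss_array N r"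
    unfolding \<phi>_def[abs_def] by (rule gaussian_curry) auto
  have m: "\<phi> \<in> measurable (PiM {..<N} (\<lambda>_. gaussian {..<r})) (gauss_array N r)"
    unfolding \<phi>_def[abs_def] by (rule measurable_curry)
  have e: "ennreal (exp (t * gform N r (\<phi> f) c)) = (\<Prod>j<N. ennreal (exp (t * (ip r (f j) c)\<^sup>2)))" for f
  proof -
    have "ip r (\<lambda>k. \<phi> f (j, k)) c = ip r (f j) c" if "j < N" for j
      by (rule ip_cong) (use that in \<open>auto simp: \<phi>_def\<close>)
    then have "gform N r (\<phi> f) c = (\<Sum>j<N. (ip r (f j) c)\<^sup>2)" by (simp add: gform_def)
    then show ?thesis by (simp add: prod_ennreal sum_distrib_left exp_sum)
  qed
  have mi: "(\<lambda>x. ennreal (exp (t * (ip r x c)\<^sup>2))) \<in> borel_measurable (gaussian {..<r})"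
    unfolding ip_def by measurable
  have "(\<integral>\<^sup>+G. ennreal (exp (t * gform N r G c)) \<partial>gauss_array N r)
      = (\<integral>\<^sup>+f. ennreal (exp (t * gform N r (\<phi> f) c)) \<partial>PiM {..<N} (\<lambda>_. gaussian {..<r}))"
    by (subst curry[symmetric], subst nn_integral_distr[OF m]) auto
  also have "\<dots> = (\<Prod>j<N. \<integral>\<^sup>+x. ennreal (exp (t * (ip r x c)\<^sup>2)) \<partial>gaussian {..<r})"
    unfolding e by (rule JK.product_nn_integral_prod) (use mi in auto)
  also have "\<dots> = ennreal ((1 / sqrt (1 - 2 * t)) ^ N)"
    unfolding nn_integral_gaussian_exp_ip[OF c t] using t by (simp add: ennreal_power)
  finally show ?thesis .
qed

text \<open>The exponential Markov inequality. The sign of \<open>t\<close> selects the upper or the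
  lower tail, so one statement serves both.\<close>

lemma gform_chernoff:
  fixes t a :: real
  assumes c: "ip r c c = 1" and t: "\<bar>t\<bar> \<le> 1 / 4"
  shows "measure (gauss_array N r) {G \<in> space (gauss_array N r). a \<le> t * (gform N r G c - real N)}
     \<le> exp (4 * t\<^sup>2 * real N - a)"
proof -
  let ?G = "gauss_array N r"
  have t2: "t < 1 / 2" using t by linarith
  have "emeasure ?G {G \<in> space ?G. a \<le> t * (gform N r G c - real N)}
      = (\<integral>\<^sup>+G. indicator {G \<in> space ?G. a \<le> t * (gform N r G c - real N)} G \<partial>?G)"
    by (rule nn_integral_indicator[symmetric]) measurable
  also have "\<dots> \<le> (\<integral>\<^sup>+G. ennreal (exp (- a - t * real N)) * ennreal (exp (t * gform N r G c)) \<partial>?G)"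
  proof (intro nn_integral_mono)
    fix G
    show "indicator {G \<in> space ?G. a \<le> t * (gform N r G c - real N)} G
      \<le> ennreal (exp (- a - t * real N)) * ennreal (exp (t * gform N r G c))"
      by (auto simp: indicator_def ennreal_mult[symmetric] exp_add[symmetric] algebra_simps)
  qed
  also have "\<dots> = ennreal (exp (- a - t * real N)) * ennreal ((1 / sqrt (1 - 2 * t)) ^ N)"
    by (subst nn_integral_cmult) (auto simp: nn_integral_exp_gform[OF c t2])
  also have "\<dots> \<le> ennreal (exp (- a - t * real N) * exp (t + 4 * t\<^sup>2) ^ N)"
    using t2 inverse_sqrt_le_exp[OF t] by (auto simp: ennreal_mult[symmetric] intro!: mult_left_mono power_mono)
  also have "exp (- a - t * real N) * exp (t + 4 * t\<^sup>2) ^ N = exp (4 * t\<^sup>2 * real N - a)"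
    by (simp add: exp_of_nat_mult[symmetric] exp_add[symmetric] algebra_simps)
  finally show ?thesis by (simp add: emeasure_gaussian_eq)
qed

lemma gform_concentration:
  fixes s :: real
  assumes c: "ip r c c > 0" and s: "0 < s" "s \<le> 1"
  shows "measure (gauss_array N r) {G \<in> space (gauss_array N r).
      s * real N * ip r c c \<le> \<bar>gform N r G c - real N * ip r c c\<bar>} \<le> 2 * exp (- (real N * s\<^sup>2 / 16))"
proof -
  let ?G = "gauss_array N r"
  note fm = prob_space.finite_measure[OF prob_space_gaussian]
  define u where "u = (\<lambda>k. 1 / sqrt (ip r c c) * c k)"
  have u1: "ip r u u = 1" using c unfolding u_def by (simp only: ip_scale_left ip_scale_right) (simp add: divide_simps)
  have g: "gform N r G c = ip r c c * gform N r G u" for G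
    using c unfolding gform_def u_def ip_scale_right by (simp add: power_divide sum_divide_distrib[symmetric] power_mult_distrib)
  \<comment> \<open>The values \<open>t = s / 8\<close> and \<open>t = - (s / 8)\<close> minimize
    \<open>4 * t\<^sup>2 * real N - \<bar>t\<bar> * s * real N\<close>; the minimum is
    \<open>- (real N * s\<^sup>2 / 16)\<close>.\<close>
  define E where "E t = {G \<in> space ?G. s\<^sup>2 * real N / 8 \<le> t * (gform N r G u - real N)}" for t
  have E: "E t \<in> sets ?G" for t unfolding E_def by measurable
  have "measure ?G (E t) \<le> exp (- (real N * s\<^sup>2 / 16))" if "\<bar>t\<bar> = s / 8" for t
  proof -
    have "t\<^sup>2 = (s / 8)\<^sup>2" using that by (metis power2_abs)
    then have t2: "t\<^sup>2 = s\<^sup>2 / 64" unfolding power_divide by simp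
    have "4 * t\<^sup>2 * real N - s\<^sup>2 * real N / 8 = - (real N * s\<^sup>2 / 16)" unfolding t2 by simp
    then show ?thesis using gform_chernoff[OF u1, of t N "s\<^sup>2 * real N / 8"] that s by (simp add: E_def)
  qed
  note E_le = this
  have sub: "{G \<in> space ?G. s * real N * ip r c c \<le> \<bar>gform N r G c - real N * ip r c c\<bar>} \<subseteq> E (s / 8) \<union> E (- (s / 8))"
  proof
    fix G assume "G \<in> {G \<in> space ?G. s * real N * ip r c c \<le> \<bar>gform N r G c - real N * ip r c c\<bar>}"
    then have G: "G \<in> space ?G" "s * real N * ip r c c \<le> \<bar>gform N r G c - real N * ip r c c\<bar>" by auto
    have "gform N r G c - real N * ip r c c = ip r c c * (gform N r G u - real N)" by (simp add: g algebra_simps)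
    then have "ip r c c * (s * real N) \<le> ip r c c * \<bar>gform N r G u - real N\<bar>"
      using G(2) c by (simp add: abs_mult mult_ac)
    then have "s * real N \<le> \<bar>gform N r G u - real N\<bar>" using c by (simp add: mult_le_cancel_left)
    then have "s / 8 * (s * real N) \<le> s / 8 * \<bar>gform N r G u - real N\<bar>" using s by (intro mult_left_mono) auto
    then show "G \<in> E (s / 8) \<union> E (- (s / 8))"
      using G(1) by (auto simp: E_def power2_eq_square abs_if algebra_simps split: if_splits)
  qed
  have "measure ?G {G \<in> space ?G. s * real N * ip r c c \<le> \<bar>gform N r G c - real N * ip r c c\<bar>}
     \<le> measure ?G (E (s / 8) \<union> E (- (s / 8)))"
    by (rule finite_measure.finite_measure_mono[OF fm sub]) (use E in auto)
  also have "\<dots> \<le> measure ?G (E (s / 8)) + measure ?G (E (- (s / 8)))"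
    by (rule measure_Un_le) (use E in auto)
  also have "\<dots> \<le> 2 * exp (- (real N * s\<^sup>2 / 16))"
    using E_le[of "s / 8"] E_le[of "- (s / 8)"] s by simp
  finally show ?thesis .
qed

section \<open>A finite grid controlling all directions\<close>

definition grid :: "nat \<Rightarrow> (nat \<Rightarrow> real) set" where
  "grid r = (\<lambda>p k. real_of_int (p k) / real (4 * r)) ` (\<Pi>\<^sub>E k\<in>{..<r}. {- int (4 * r)..int (4 * r)})"

lemma finite_grid: "finite (grid r)"
  unfolding grid_def by (intro finite_imageI finite_PiE) auto

lemma card_grid: "card (grid r) \<le> (8 * r + 1) ^ r"
proof -
  have "card (grid r) \<le> card (\<Pi>\<^sub>E k\<in>{..<r}. {- int (4 * r)..int (4 * r)})"
    unfolding grid_def by (intro card_image_le finite_PiE) auto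
  also have "\<dots> = (8 * r + 1) ^ r" by (simp add: card_PiE nat_add_distrib nat_mult_distrib)
  finally show ?thesis .
qed

text \<open>Rounding a coordinate down to a multiple of \<open>1 / (4 * r)\<close> costs at most
  that much, so the total squared error is at most \<open>r / (4 * r)\<^sup>2\<close>. Coordinates
  of a unit vector lie between -1 and 1, which fixes the range of integers in
  \<open>grid\<close>.\<close>

lemma grid_approx:
  assumes u: "ip r u u = 1"
  shows "\<exists>v\<in>grid r. ip r (\<lambda>k. v k - u k) (\<lambda>k. v k - u k) \<le> 1 / 16"
proof -
  have r: "0 < r" using u by (cases r) (auto simp: ip_def)
  define m where "m = real (4 * r)"
  have m: "m > 0" using r by (simp add: m_def)
  define p where "p = (\<lambda>k\<in>{..<r}. \<lfloor>m * u k\<rfloor>)"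
  have uk: "\<bar>u k\<bar> \<le> 1" if "k < r" for k
  proof -
    have "u k * u k \<le> (\<Sum>j<r. u j * u j)"
      using that by (intro member_le_sum[of k "{..<r}" "\<lambda>j. u j * u j"]) auto
    then have "(u k)\<^sup>2 \<le> 1\<^sup>2" using u by (simp add: ip_def power2_eq_square)
    then show ?thesis by (simp only: power2_le_iff_abs_le zero_le_one)
  qed
  have "p \<in> (\<Pi>\<^sub>E k\<in>{..<r}. {- int (4 * r)..int (4 * r)})"
  proof (rule PiE_I)
    fix k assume k: "k \<in> {..<r}"
    have "\<bar>m * u k\<bar> \<le> m" using uk[of k] k m by (simp add: abs_mult mult_le_cancel_left1)
    then have "- m \<le> m * u k" "m * u k \<le> m" by (auto simp: abs_le_iff)
    then have "of_int (- int (4 * r)) \<le> m * u k" "m * u k \<le> of_int (int (4 * r))" by (simp_all add: m_def)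
    then have "- int (4 * r) \<le> \<lfloor>m * u k\<rfloor>" "\<lfloor>m * u k\<rfloor> \<le> int (4 * r)"
      using floor_mono[of "m * u k" "of_int (int (4 * r))"] by (simp_all only: le_floor_iff floor_of_int)
    then show "p k \<in> {- int (4 * r)..int (4 * r)}" using k by (simp add: p_def)
  qed (simp add: p_def)
  then have v: "(\<lambda>k. real_of_int (p k) / real (4 * r)) \<in> grid r" unfolding grid_def by (rule imageI)
  have d: "(real_of_int (p k) / m - u k) * (real_of_int (p k) / m - u k) \<le> 1 / m\<^sup>2" if "k < r" for k
  proof -
    have "real_of_int (p k) \<le> m * u k" "m * u k \<le> real_of_int (p k) + 1"
      using that by (simp_all add: p_def)
    then have "\<bar>(real_of_int (p k) - m * u k) / m\<bar> \<le> 1 / m"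
      unfolding abs_divide using m by (intro divide_mono) (auto simp: abs_le_iff)
    moreover have "(real_of_int (p k) - m * u k) / m = real_of_int (p k) / m - u k" using m by (simp add: diff_divide_distrib)
    ultimately have "\<bar>real_of_int (p k) / m - u k\<bar> \<le> 1 / m" by simp
    then have "\<bar>real_of_int (p k) / m - u k\<bar>\<^sup>2 \<le> (1 / m)\<^sup>2" by (intro power_mono) auto
    then show ?thesis by (simp add: power2_eq_square)
  qed
  have "ip r (\<lambda>k. real_of_int (p k) / m - u k) (\<lambda>k. real_of_int (p k) / m - u k) \<le> (\<Sum>k<r. 1 / m\<^sup>2)"
    unfolding ip_def using d by (intro sum_mono) auto
  also have "\<dots> = real r / m\<^sup>2" by simp
  also have "\<dots> \<le> 1 / 16" using r by (simp add: m_def power2_eq_square field_simps)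
  finally show ?thesis using v by (auto simp: m_def intro!: bexI[of _ "\<lambda>k. real_of_int (p k) / real (4 * r)"])
qed

text \<open>The coarse grid suffices: at a grid point near an eigenvector for the largest modulus \<open>m\<close> of an
  eigenvalue of \<open>G\<^sup>T G - N\<close>, the error terms are themselves bounded by a multiple of \<open>m\<close> less than \<open>m\<close>.\<close>

lemma near_isometry_of_grid:
  assumes s: "0 \<le> s"
    and net: "\<And>v. v \<in> grid r \<Longrightarrow> \<bar>gform N r G v - real N * ip r v v\<bar> \<le> s * real N * ip r v v"
  shows "near_isometry N r (4 * s) G"
proof -
  define B where "B k l = ip N (\<lambda>j. G (j, k)) (\<lambda>j. G (j, l)) - (if k = l then real N else 0)" for k l
  have "B k l = B l k" for k l by (simp add: B_def ip_commute)
  then obtain c \<beta> where c: "orthonormal r r c" and \<beta>: "\<And>a i. a < r \<Longrightarrow> i < r \<Longrightarrow> mv r B (c a) i = \<beta> a * c a i"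
    using spectral_theorem[of r B] by metis
  have form: "gform N r G v - real N * ip r v v = ip r v (mv r B v)" for v
  proof -
    have "gform N r G v = ip N (\<lambda>j. \<Sum>k<r. v k * G (j, k)) (\<lambda>j. \<Sum>l<r. v l * G (j, l))"
      by (simp add: gform_def ip_def power2_eq_square mult.commute)
    also have "\<dots> = (\<Sum>k<r. v k * (\<Sum>l<r. v l * ip N (\<lambda>j. G (j, k)) (\<lambda>j. G (j, l))))"
      by (simp only: ip_sum_left ip_sum_right ip_scale_left ip_scale_right sum_distrib_left)
    also have "\<dots> - real N * ip r v v = ip r v (mv r B v)"
    proof -
      have "mv r B v k = (\<Sum>l<r. v l * ip N (\<lambda>j. G (j, k)) (\<lambda>j. G (j, l))) - real N * v k" if "k < r" for k
      proof -
        have "mv r B v k = (\<Sum>l<r. v l * ip N (\<lambda>j. G (j, k)) (\<lambda>j. G (j, l)) - (if l = k then real N * v l else 0))"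
          unfolding mv_def by (intro sum.cong refl) (auto simp: B_def algebra_simps)
        then show ?thesis using that by (simp add: sum_subtractf)
      qed
      then show ?thesis by (simp add: ip_def right_diff_distrib sum_subtractf sum_distrib_left mult_ac)
    qed
    finally show ?thesis .
  qed
  have diag: "ip r v (mv r B v) = (\<Sum>a<r. \<beta> a * (ip r (c a) v)\<^sup>2)" for v
  proof -
    have "ip r v (mv r B v) = ip r (mv r B v) (\<lambda>i. \<Sum>a<r. ip r (c a) v * c a i)"
      unfolding ip_commute[of r v "mv r B v"] by (intro ip_cong refl) (rule orthonormal_expand[OF c])
    also have "\<dots> = (\<Sum>a<r. ip r (c a) v * ip r v (mv r B (c a)))"
      unfolding ip_sum_right ip_scale_right
      using ip_mv_sym[of r B v] \<open>\<And>l k. B k l = B l k\<close> by simp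
    also have "\<dots> = (\<Sum>a<r. ip r (c a) v * ip r v (\<lambda>i. \<beta> a * c a i))"
      using \<beta> by (intro sum.cong arg_cong2[where f = "(*)"] ip_cong) auto
    also have "\<dots> = (\<Sum>a<r. \<beta> a * (ip r (c a) v)\<^sup>2)"
      by (simp add: ip_scale_right ip_commute[of r v "c _"] power2_eq_square mult_ac)
    finally show ?thesis .
  qed
  have \<beta>_le: "\<bar>\<beta> a\<bar> \<le> 4 * s * real N" if a: "a < r" for a
  proof -
    define m where "m = Max ((\<lambda>a. \<bar>\<beta> a\<bar>) ` {..<r})"
    have "m \<in> (\<lambda>a. \<bar>\<beta> a\<bar>) ` {..<r}" unfolding m_def using a by (intro Max_in) auto
    then obtain b where b: "b < r" "m = \<bar>\<beta> b\<bar>" by auto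
    have m_ge: "\<bar>\<beta> a\<bar> \<le> m" if "a < r" for a unfolding m_def using that by (intro Max_ge) auto
    have cb: "ip r (c b) (c b) = 1" using c b by (simp add: orthonormal_def)
    obtain v where v: "v \<in> grid r" and d16: "ip r (\<lambda>k. v k - c b k) (\<lambda>k. v k - c b k) \<le> 1 / 16"
      using grid_approx[OF cb] by blast
    define d where "d = (\<lambda>k. v k - c b k)"
    define x where "x a = ip r (c a) d" for a
    have xs: "(\<Sum>a<r. (x a)\<^sup>2) \<le> 1 / 16" using orthonormal_parseval[OF c, of d] d16 by (simp add: x_def d_def)
    have "(x b)\<^sup>2 \<le> (\<Sum>a<r. (x a)\<^sup>2)" using b(1) by (intro member_le_sum) auto
    then have "(x b)\<^sup>2 \<le> (1 / 4)\<^sup>2" using xs by (simp add: power_divide)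
    then have xb: "\<bar>x b\<bar> \<le> 1 / 4" by (simp only: power2_le_iff_abs_le)
    have iv: "ip r (c a) v = (if a = b then 1 else 0) + x a" if "a < r" for a
    proof -
      have "ip r (c a) v = ip r (c a) (c b) + ip r (c a) d" by (simp add: d_def ip_diff_right)
      then show ?thesis using c that b by (simp add: x_def orthonormal_def)
    qed
    \<comment> \<open>Written as \<open>c b + d\<close>, the grid point has squared component
      \<open>1 + 2 * x b + (x b)\<^sup>2\<close> along \<open>c b\<close>; the last summand joins
      the sum over the error \<open>d\<close>.\<close>
    have split: "(\<Sum>a<r. g a * (ip r (c a) v)\<^sup>2) = g b * (1 + 2 * x b) + (\<Sum>a<r. g a * (x a)\<^sup>2)" for g
    proof -
      have "(\<Sum>a<r. g a * (ip r (c a) v)\<^sup>2) = (\<Sum>a<r. (if a = b then g b * (1 + 2 * x b) else 0) + g a * (x a)\<^sup>2)"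
        by (intro sum.cong refl) (auto simp: iv power2_eq_square algebra_simps)
      then show ?thesis using b(1) by (simp add: sum.distrib)
    qed
    have vv: "ip r v v \<le> 25 / 16"
      using split[of "\<lambda>_. 1"] orthonormal_parseval[OF c, of v] xs xb by (simp add: abs_le_iff)
    \<comment> \<open>The chain reads m/2 \<le> (25/16) s N + m/16, since |x b| \<le> 1/4 bounds the
      factor at \<open>c b\<close> from below by 1/2. It gives m \<le> (25/7) s N, which explains
      the 4 in \<open>near_isometry N r (4 * s) G\<close>.\<close>
    have "m * (1 / 2) \<le> m * \<bar>1 + 2 * x b\<bar>" using xb b by (intro mult_left_mono) (auto simp: abs_le_iff)
    also have "\<dots> = \<bar>\<beta> b * (1 + 2 * x b)\<bar>" by (simp add: b abs_mult)
    also have "\<dots> \<le> \<bar>ip r v (mv r B v)\<bar> + \<bar>\<Sum>a<r. \<beta> a * (x a)\<^sup>2\<bar>"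
      unfolding diag split by linarith
    also have "\<bar>\<Sum>a<r. \<beta> a * (x a)\<^sup>2\<bar> \<le> (\<Sum>a<r. m * (x a)\<^sup>2)"
      by (rule order_trans[OF sum_abs]) (auto intro!: sum_mono mult_right_mono simp: abs_mult m_ge)
    also have "\<dots> \<le> m * (1 / 16)" unfolding sum_distrib_left[symmetric] using xs b by (intro mult_left_mono) auto
    also have "\<bar>ip r v (mv r B v)\<bar> \<le> s * real N * ip r v v" using net[OF v] by (simp add: form)
    also have "\<dots> \<le> s * real N * (25 / 16)" using vv s by (intro mult_left_mono) auto
    finally have "m \<le> 25 / 7 * (s * real N)" by simp
    also have "\<dots> \<le> 4 * s * real N" using s by simp
    finally show ?thesis using m_ge[OF a] by simp
  qed
  show ?thesis
    unfolding near_isometry_def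
  proof
    fix v
    have "\<bar>gform N r G v - real N * ip r v v\<bar> \<le> (\<Sum>a<r. \<bar>\<beta> a * (ip r (c a) v)\<^sup>2\<bar>)"
      unfolding form diag by (rule sum_abs)
    also have "\<dots> \<le> (\<Sum>a<r. 4 * s * real N * (ip r (c a) v)\<^sup>2)"
      using \<beta>_le by (intro sum_mono) (auto simp: abs_mult intro!: mult_right_mono)
    also have "\<dots> = 4 * s * real N * ip r v v" unfolding sum_distrib_left[symmetric] orthonormal_parseval[OF c] ..
    finally have "\<bar>gform N r G v - real N * ip r v v\<bar> \<le> 4 * s * real N * ip r v v" .
    then show "(1 - 4 * s) * real N * ip r v v \<le> (\<Sum>j<N. (ip r (\<lambda>k. G (j, k)) v)\<^sup>2) \<and>
      (\<Sum>j<N. (ip r (\<lambda>k. G (j, k)) v)\<^sup>2) \<le> (1 + 4 * s) * real N * ip r v v"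
      unfolding gform_def[symmetric] abs_le_iff by (auto simp: algebra_simps)
  qed
qed

text \<open>A union bound over the grid points of positive length. At a grid point of length 0 the
  estimate demanded by \<open>near_isometry_of_grid\<close> reads 0 \<le> 0, and
  \<open>gform_concentration\<close> does not cover it, so \<open>S\<close> leaves such points
  out.\<close>

lemma ex_bad_set:
  fixes s :: real
  assumes s: "0 < s" "s \<le> 1"
  obtains Bad where "Bad \<in> sets (gauss_array N r)"
    "\<And>G. G \<in> space (gauss_array N r) \<Longrightarrow> G \<notin> Bad \<Longrightarrow> near_isometry N r (4 * s) G"
    "measure (gauss_array N r) Bad \<le> 2 * (8 * real r + 1) ^ r * exp (- (real N * s\<^sup>2 / 16))"
proof -
  let ?G = "gauss_array N r"
  note fm = prob_space.finite_measure[OF prob_space_gaussian]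
  define S where "S = {v \<in> grid r. ip r v v > 0}"
  define B where "B v = {G \<in> space ?G. s * real N * ip r v v \<le> \<bar>gform N r G v - real N * ip r v v\<bar>}" for v
  have B: "B v \<in> sets ?G" for v unfolding B_def by measurable
  have S: "finite S" unfolding S_def using finite_grid by simp
  show ?thesis
  proof (rule that[of "\<Union>v\<in>S. B v"])
    show "(\<Union>v\<in>S. B v) \<in> sets ?G" using S B by (intro sets.finite_UN) auto
    fix G assume G: "G \<in> space ?G" "G \<notin> (\<Union>v\<in>S. B v)"
    show "near_isometry N r (4 * s) G"
    proof (rule near_isometry_of_grid)
      fix v assume v: "v \<in> grid r"
      show "\<bar>gform N r G v - real N * ip r v v\<bar> \<le> s * real N * ip r v v"
      proof (cases "ip r v v > 0")
        case True
        then have "v \<in> S" using v by (simp add: S_def)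
        then show ?thesis using G by (auto simp: B_def)
      next
        case False
        then have "ip r v v = 0" using ip_nonneg[of r v] by simp
        then have "v k = 0" if "k < r" for k using ip_self_eq_0D that by blast
        then have "ip r x v = 0" for x by (simp add: ip_def)
        then show ?thesis by (simp add: gform_def)
      qed
    qed (use s in simp)
  next
    have "measure ?G (\<Union>v\<in>S. B v) \<le> (\<Sum>v\<in>S. measure ?G (B v))"
      by (rule finite_measure.finite_measure_subadditive_finite[OF fm]) (use S B in auto)
    also have "\<dots> \<le> (\<Sum>v\<in>S. 2 * exp (- (real N * s\<^sup>2 / 16)))"
      unfolding B_def by (intro sum_mono gform_concentration) (use s in \<open>auto simp: S_def\<close>)
    also have "\<dots> = real (card S) * (2 * exp (- (real N * s\<^sup>2 / 16)))" by simp
    also have "\<dots> \<le> (8 * real r + 1) ^ r * (2 * exp (- (real N * s\<^sup>2 / 16)))"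
    proof (intro mult_right_mono)
      have "card S \<le> card (grid r)" unfolding S_def by (intro card_mono finite_grid) auto
      also have "\<dots> \<le> (8 * r + 1) ^ r" by (rule card_grid)
      finally have "real (card S) \<le> real ((8 * r + 1) ^ r)" by (rule of_nat_mono)
      then show "real (card S) \<le> (8 * real r + 1) ^ r" by (simp add: add.commute)
    qed simp
    finally show "measure ?G (\<Union>v\<in>S. B v) \<le> 2 * (8 * real r + 1) ^ r * exp (- (real N * s\<^sup>2 / 16))" by simp
  qed
qed

section \<open>The chi-squared tail\<close>

lemma ln_one_plus_le_quadratic:
  fixes u :: real
  assumes u: "u > -1"
  shows "ln (1 + u) - u \<le> - (u\<^sup>2 / (2 * (1 + \<bar>u\<bar>)))"
proof (cases "u \<ge> 0")
  case True
  define h where "h u = u - u\<^sup>2 / (2 * (1 + u)) - ln (1 + u)" for u :: real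
  have "h 0 \<le> h u"
  proof (rule DERIV_nonneg_imp_nondecreasing[OF True])
    fix x :: real assume "0 \<le> x" "x \<le> u"
    then have x: "1 + x > 0" by simp
    have "(h has_real_derivative 1 - (2 * x * (2 * (1 + x)) - x\<^sup>2 * 2) / (2 * (1 + x))\<^sup>2 - 1 / (1 + x)) (at x)"
      unfolding h_def using x by (auto intro!: derivative_eq_intros simp: power2_eq_square)
    moreover have "1 - (2 * x * (2 * (1 + x)) - x\<^sup>2 * 2) / (2 * (1 + x))\<^sup>2 - 1 / (1 + x) = x\<^sup>2 / (2 * (1 + x)\<^sup>2)"
    proof -
      define y where "y = 1 + x"
      have y: "y > 0" "x = y - 1" using x by (simp_all add: y_def)
      show ?thesis unfolding y(2) using y(1) by (simp add: field_simps power2_eq_square)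
    qed
    ultimately show "\<exists>y. (h has_real_derivative y) (at x) \<and> 0 \<le> y"
      by (metis divide_nonneg_nonneg zero_le_power2 mult_nonneg_nonneg zero_le_numeral)
  qed
  then show ?thesis using True by (simp add: h_def)
next
  case False
  define h where "h u = u - u\<^sup>2 / 2 - ln (1 + u)" for u :: real
  have "h 0 \<le> h u"
  proof (rule DERIV_nonpos_imp_nonincreasing[of u 0 h])
    fix x :: real assume x: "u \<le> x" "x \<le> 0"
    then have "1 + x > 0" using u by simp
    then show "\<exists>y. (h has_real_derivative y) (at x) \<and> y \<le> 0"
      unfolding h_def
      by (intro exI[of _ "- (x\<^sup>2 / (1 + x))"] conjI)
         (auto intro!: derivative_eq_intros simp: field_simps power2_eq_square)
  qed (use False in simp)
  then have "ln (1 + u) - u \<le> - (u\<^sup>2 / 2)" by (simp add: h_def)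
  also have "\<dots> \<le> - (u\<^sup>2 / (2 * (1 + \<bar>u\<bar>)))"
    by (intro le_imp_neg_le divide_left_mono) auto
  finally show ?thesis .
qed

text \<open>With \<open>t = x + sqrt x * s\<close> in the Gamma integral, this is
  \<open>t powr x * exp (- t)\<close> divided by its maximum \<open>x powr x * exp (- x)\<close>.
  The exponent tends to \<open>- s\<^sup>2 / 2\<close>, whence the constant
  \<open>sqrt (2 * pi)\<close>.\<close>

definition stirling_integrand :: "real \<Rightarrow> real \<Rightarrow> real" where
  "stirling_integrand x s = (if s > - sqrt x then exp (x * (ln (1 + s / sqrt x) - s / sqrt x)) else 0)"

text \<open>The bound \<open>- (u\<^sup>2 / (2 * (1 + \<bar>u\<bar>)))\<close> on
  \<open>ln (1 + u) - u\<close> is quadratic near 0 and linear at infinity. At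
  \<open>u = s / sqrt x\<close> with \<open>x \<ge> 1\<close> it yields an exponentially decaying
  majorant independent of \<open>x\<close>, as dominated convergence requires.\<close>

lemma stirling_integrand_le:
  assumes x: "x \<ge> 1"
  shows "stirling_integrand x s \<le> exp (1 / 2) * exp (- \<bar>s\<bar> / 2)"
proof (cases "s > - sqrt x")
  case True
  have sx: "sqrt x > 0" "sqrt x * sqrt x = x" "sqrt x \<ge> 1" using x by auto
  have "s / sqrt x > -1" using True sx by (simp add: field_simps)
  then have "x * (ln (1 + s / sqrt x) - s / sqrt x) \<le> x * - ((s / sqrt x)\<^sup>2 / (2 * (1 + \<bar>s / sqrt x\<bar>)))"
    using x by (intro mult_left_mono ln_one_plus_le_quadratic) auto
  also have "\<dots> = - (s\<^sup>2 / (2 * (1 + \<bar>s\<bar> / sqrt x)))"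
    using sx x by (simp add: power_divide abs_divide)
  also have "\<dots> \<le> - (s\<^sup>2 / (2 * (1 + \<bar>s\<bar>)))"
  proof -
    have "\<bar>s\<bar> / sqrt x \<le> \<bar>s\<bar> / 1" using sx by (intro divide_left_mono) auto
    then have "s\<^sup>2 / (2 * (1 + \<bar>s\<bar>)) \<le> s\<^sup>2 / (2 * (1 + \<bar>s\<bar> / sqrt x))"
      using sx by (intro divide_left_mono mult_pos_pos add_pos_nonneg) auto
    then show ?thesis by simp
  qed
  also have "\<dots> \<le> 1 / 2 + - \<bar>s\<bar> / 2"
  proof -
    have "\<bar>s\<bar> * \<bar>s\<bar> = s * s" by simp
    then have "(\<bar>s\<bar> - 1) * (1 + \<bar>s\<bar>) \<le> s\<^sup>2" by (simp add: power2_eq_square algebra_simps)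
    then have "\<bar>s\<bar> - 1 \<le> s\<^sup>2 / (1 + \<bar>s\<bar>)" by (simp add: pos_le_divide_eq)
    then show ?thesis by (simp add: field_simps)
  qed
  finally show ?thesis using True by (simp add: stirling_integrand_def exp_add[symmetric])
qed (simp add: stirling_integrand_def)

text \<open>Twice the exponential density of rate 1/2, added to its mirror image, is an integrable
  majorant.\<close>

lemma integrable_exp_neg_abs: "integrable lborel (\<lambda>s::real. exp (- \<bar>s\<bar> / 2))"
proof -
  define e where "e = exponential_density (1 / 2)"
  have "(\<integral>\<^sup>+s. ennreal (e s) \<partial>lborel) = 1"
    using prob_space.emeasure_space_1[OF prob_space_exponential_density[of "1/2"]]
    by (simp add: emeasure_density e_def)
  then have e: "integrable lborel e"
    by (intro integrableI_nonneg) (auto simp: e_def exponential_density_def)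
  have "integrable lborel (\<lambda>s. 2 * (e s + e (0 + (-1) * s)))"
    using lborel_integrable_real_affine[OF e, of "-1" 0] e by simp
  then show ?thesis
    by (rule Bochner_Integration.integrable_bound) (auto simp: e_def exponential_density_def)
qed

lemma stirling_integral_tendsto:
  "((\<lambda>x. \<integral>s. stirling_integrand x s \<partial>lborel) \<longlongrightarrow> sqrt (2 * pi)) at_top"
proof -
  have meas: "stirling_integrand x \<in> borel_measurable lborel" for x
    unfolding stirling_integrand_def[abs_def] by measurable
  have "((\<lambda>x. \<integral>s. stirling_integrand x s \<partial>lborel) \<longlongrightarrow> (\<integral>s. exp (- s\<^sup>2 / 2) \<partial>lborel)) at_top"
  proof (rule integral_dominated_convergence_at_top[where w = "\<lambda>s. exp (1 / 2) * exp (- \<bar>s\<bar> / 2)"])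
    show "integrable lborel (\<lambda>s::real. exp (1 / 2) * exp (- \<bar>s\<bar> / 2))"
      by (intro integrable_mult_right integrable_exp_neg_abs)
    show "\<forall>\<^sub>F x in at_top. AE s in lborel. norm (stirling_integrand x s) \<le> exp (1 / 2) * exp (- \<bar>s\<bar> / 2)"
      using eventually_ge_at_top[of 1]
      by eventually_elim (use stirling_integrand_le in \<open>auto simp: stirling_integrand_def\<close>)
    show "AE s in lborel. ((\<lambda>x. stirling_integrand x s) \<longlongrightarrow> exp (- s\<^sup>2 / 2)) at_top"
    proof (rule AE_I2)
      fix s :: real
      have "((\<lambda>x. exp (x * (ln (1 + s / sqrt x) - s / sqrt x))) \<longlongrightarrow> exp (- s\<^sup>2 / 2)) at_top"
        by real_asymp (simp add: power2_eq_square)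
      moreover have "\<forall>\<^sub>F x in at_top. s > - sqrt x" by real_asymp
      then have "\<forall>\<^sub>F x in at_top. exp (x * (ln (1 + s / sqrt x) - s / sqrt x)) = stirling_integrand x s"
        by eventually_elim (simp add: stirling_integrand_def)
      ultimately show "((\<lambda>x. stirling_integrand x s) \<longlongrightarrow> exp (- s\<^sup>2 / 2)) at_top"
        by (rule Lim_transform_eventually)
    qed
  qed (use meas in auto)
  also have "(\<integral>s. exp (- s\<^sup>2 / 2) \<partial>lborel) = sqrt (2 * pi)"
  proof -
    have "(\<integral>s. exp (- s\<^sup>2 / 2) \<partial>lborel) = (\<integral>s. sqrt (2 * pi) * std_normal_density s \<partial>lborel)"
      by (simp add: std_normal_density_def)
    also have "\<dots> = sqrt (2 * pi) * 1"
      using integral_normal_density[of 1 0] by (subst integral_mult_right_zero) auto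
    finally show ?thesis by simp
  qed
  finally show ?thesis .
qed

lemma Gamma_eq_stirling_integral:
  fixes x :: real
  assumes x: "x > 0"
  shows "Gamma (x + 1) = sqrt x * (x powr x * exp (- x)) * (\<integral>s. stirling_integrand x s \<partial>lborel)"
proof -
  define f where "f t = t powr x / exp t" for t :: real
  have [measurable]: "f \<in> borel_measurable borel" unfolding f_def by measurable
  have sx: "sqrt x > 0" "sqrt x * sqrt x = x" using x by auto
  have [measurable]: "stirling_integrand x \<in> borel_measurable borel" unfolding stirling_integrand_def[abs_def] by measurable
  have nonneg: "stirling_integrand x s \<ge> 0" for s by (simp add: stirling_integrand_def)
  have pt: "ennreal (f (x + sqrt x * s)) * indicator {0..} (x + sqrt x * s)
     = ennreal (x powr x * exp (- x)) * ennreal (stirling_integrand x s)" for s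
  proof (cases "s > - sqrt x")
    case True
    then have u: "1 + s / sqrt x > 0" using sx by (simp add: field_simps)
    have e: "x + sqrt x * s = x * (1 + s / sqrt x)" using sx by (simp add: field_simps)
    have pos: "x + sqrt x * s > 0" unfolding e using x u by simp
    have "f (x + sqrt x * s) = x powr x * (1 + s / sqrt x) powr x * exp (- (x + sqrt x * s))"
    proof -
      have "f (x + sqrt x * s) = (x + sqrt x * s) powr x * exp (- (x + sqrt x * s))"
        by (simp only: f_def exp_minus divide_inverse)
      also have "(x + sqrt x * s) powr x = x powr x * (1 + s / sqrt x) powr x"
        unfolding e by (subst powr_mult) (use x u in auto)
      finally show ?thesis .
    qed
    also have "(1 + s / sqrt x) powr x = exp (x * ln (1 + s / sqrt x))" using u by (simp add: powr_def)
    also have "x powr x * exp (x * ln (1 + s / sqrt x)) * exp (- (x + sqrt x * s))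
      = x powr x * exp (- x) * exp (x * (ln (1 + s / sqrt x) - s / sqrt x))"
    proof -
      have "x * (s / sqrt x) = sqrt x * s" using sx by (simp add: field_simps)
      then show ?thesis by (simp add: mult.assoc exp_add[symmetric] right_diff_distrib)
    qed
    finally show ?thesis using True pos by (simp add: stirling_integrand_def ennreal_mult)
  next
    case False
    then have "x + sqrt x * s \<le> 0" using sx mult_left_mono[of s "- sqrt x" "sqrt x"] by simp
    then have "f (x + sqrt x * s) * indicator {0..} (x + sqrt x * s) = 0"
      using x by (auto simp: indicator_def f_def)
    then show ?thesis using False by (auto simp: stirling_integrand_def indicator_def f_def split: if_splits)
  qed
  have "ennreal (Gamma (x + 1)) = (\<integral>\<^sup>+t. ennreal (f t) * indicator {0..} t \<partial>lborel)"
    using Gamma_integral_real[of "x + 1"] x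
    by (subst nn_integral_has_integral_lebesgue'[where I = "Gamma (x + 1)"]) (auto simp: f_def[abs_def])
  also have "\<dots> = ennreal (sqrt x) * (\<integral>\<^sup>+s. ennreal (f (x + sqrt x * s)) * indicator {0..} (x + sqrt x * s) \<partial>lborel)"
    using sx by (subst nn_integral_real_affine[where c = "sqrt x" and t = x]) auto
  also have "\<dots> = ennreal (sqrt x * (x powr x * exp (- x))) * (\<integral>\<^sup>+s. ennreal (stirling_integrand x s) \<partial>lborel)"
    unfolding pt using sx by (subst nn_integral_cmult) (auto simp: ennreal_mult mult.assoc)
  finally have "Gamma (x + 1) = sqrt x * (x powr x * exp (- x)) * enn2real (\<integral>\<^sup>+s. ennreal (stirling_integrand x s) \<partial>lborel)"
    using sx x Gamma_real_pos[of "x + 1"]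
    by (metis enn2real_ennreal enn2real_mult less_imp_le add_pos_pos zero_less_one mult_nonneg_nonneg powr_ge_zero exp_ge_zero)
  also have "enn2real (\<integral>\<^sup>+s. ennreal (stirling_integrand x s) \<partial>lborel) = (\<integral>s. stirling_integrand x s \<partial>lborel)"
    by (rule integral_eq_nn_integral[symmetric]) (auto simp: nonneg)
  finally show ?thesis .
qed

lemma Gamma_stirling:
  "((\<lambda>x. Gamma (x + 1) / (sqrt (2 * pi * x) * (x powr x * exp (- x)))) \<longlongrightarrow> 1) at_top"
proof -
  have "((\<lambda>x. (\<integral>s. stirling_integrand x s \<partial>lborel) / sqrt (2 * pi)) \<longlongrightarrow> sqrt (2 * pi) / sqrt (2 * pi)) at_top"
    by (intro tendsto_divide stirling_integral_tendsto tendsto_const) auto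
  moreover have "\<forall>\<^sub>F x in at_top. (\<integral>s. stirling_integrand x s \<partial>lborel) / sqrt (2 * pi)
      = Gamma (x + 1) / (sqrt (2 * pi * x) * (x powr x * exp (- x)))"
    using eventually_gt_at_top[of 0]
    by eventually_elim (simp add: Gamma_eq_stirling_integral real_sqrt_mult field_simps)
  ultimately show ?thesis by (simp add: tendsto_cong)
qed

section \<open>Chi-squared tails through volumes of balls\<close>

lemma gaussian_eq_density:
  assumes I: "finite I"
  shows "gaussian I = density (PiM I (\<lambda>_. lborel)) (\<lambda>x. \<Prod>i\<in>I. ennreal (std_normal_density (x i)))"
proof (rule gaussian.PiM_eqI[symmetric])
  interpret lb: product_sigma_finite "\<lambda>_. lborel :: real measure" by standard
  show "finite I" by fact
  show "sets (density (PiM I (\<lambda>_. lborel)) (\<lambda>x. \<Prod>i\<in>I. ennreal (std_normal_density (x i)))) = sets (gaussian I)"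
    unfolding sets_density by (rule sets_PiM_cong) auto
  fix A :: "_ \<Rightarrow> real set" assume A: "\<And>i. i \<in> I \<Longrightarrow> A i \<in> sets std_normal_distribution"
  have "emeasure (density (PiM I (\<lambda>_. lborel)) (\<lambda>x. \<Prod>i\<in>I. ennreal (std_normal_density (x i)))) (Pi\<^sub>E I A)
     = (\<integral>\<^sup>+x. (\<Prod>i\<in>I. ennreal (std_normal_density (x i))) * indicator (Pi\<^sub>E I A) x \<partial>PiM I (\<lambda>_. lborel))"
    using A I by (intro emeasure_density) (auto intro!: sets_PiM_I_finite)
  also have "\<dots> = (\<integral>\<^sup>+x. (\<Prod>i\<in>I. ennreal (std_normal_density (x i)) * indicator (A i) (x i)) \<partial>PiM I (\<lambda>_. lborel))"
  proof (rule nn_integral_cong)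
    fix x :: "_ \<Rightarrow> real" assume x: "x \<in> space (PiM I (\<lambda>_. lborel))"
    have "(\<Prod>i\<in>I. indicator (A i) (x i) :: ennreal) = (if \<forall>i\<in>I. x i \<in> A i then 1 else 0)"
      using I by induction auto
    also have "\<dots> = indicator (Pi\<^sub>E I A) x" using x by (auto simp: space_PiM PiE_iff indicator_def)
    finally show "(\<Prod>i\<in>I. ennreal (std_normal_density (x i))) * indicator (Pi\<^sub>E I A) x
      = (\<Prod>i\<in>I. ennreal (std_normal_density (x i)) * indicator (A i) (x i))" by (simp add: prod.distrib)
  qed
  also have "\<dots> = (\<Prod>i\<in>I. \<integral>\<^sup>+x. ennreal (std_normal_density x) * indicator (A i) x \<partial>lborel)"
    using A by (intro lb.product_nn_integral_prod I) auto
  also have "\<dots> = (\<Prod>i\<in>I. emeasure std_normal_distribution (A i))"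
    using A by (intro prod.cong refl emeasure_density[symmetric]) auto
  finally show "emeasure (density (PiM I (\<lambda>_. lborel)) (\<lambda>x. \<Prod>i\<in>I. ennreal (std_normal_density (x i)))) (Pi\<^sub>E I A)
     = (\<Prod>i\<in>I. emeasure std_normal_distribution (A i))" .
qed

lemma emeasure_shell:
  fixes n :: nat and z w :: real
  assumes z: "0 < z" "z \<le> w"
  shows "emeasure (PiM {..<n} (\<lambda>_. lborel)) {x \<in> space (PiM {..<n} (\<lambda>_. lborel)). z < (\<Sum>k<n. (x k)\<^sup>2) \<and> (\<Sum>k<n. (x k)\<^sup>2) \<le> w}
    = ennreal (unit_ball_vol n * (w powr (n / 2) - z powr (n / 2)))"
proof -
  let ?P = "PiM {..<n} (\<lambda>_. lborel :: real measure)"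
  define C where "C t = {x \<in> space ?P. (\<Sum>k<n. (x k)\<^sup>2) \<le> t}" for t
  have C: "C t \<in> sets ?P" for t unfolding C_def by measurable
  have eC: "emeasure ?P (C t) = ennreal (unit_ball_vol n * t powr (n / 2))" if t: "t > 0" for t
  proof -
    have "C t = {f. sqrt (\<Sum>i\<in>{..<n}. (f i)\<^sup>2) \<le> sqrt t} \<inter> space ?P" by (auto simp: C_def)
    moreover have "sqrt t ^ n = t powr (n / 2)"
      using t by (simp add: powr_half_sqrt[symmetric] powr_realpow[symmetric] powr_powr)
    ultimately show ?thesis using emeasure_cball_aux[of "{..<n}" "sqrt t"] t by simp
  qed
  have "{x \<in> space ?P. z < (\<Sum>k<n. (x k)\<^sup>2) \<and> (\<Sum>k<n. (x k)\<^sup>2) \<le> w} = C w - C z"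
    by (auto simp: C_def)
  moreover have "emeasure ?P (C w - C z) = emeasure ?P (C w) - emeasure ?P (C z)"
    using z C by (intro emeasure_Diff) (auto simp: eC, auto simp: C_def)
  ultimately show ?thesis using z
    by (simp add: eC ennreal_minus right_diff_distrib)
qed

lemma nn_integral_exp_half_tail:
  fixes z :: real
  shows "(\<integral>\<^sup>+w. ennreal (exp (- w / 2) / 2) * indicator {z..} w \<partial>lborel) = ennreal (exp (- z / 2))"
proof -
  have "((\<lambda>w::real. - exp (- w / 2)) \<longlongrightarrow> 0) at_top" by real_asymp
  then have "(\<integral>\<^sup>+w. ennreal (exp (- w / 2) / 2) * indicator {z..} w \<partial>lborel) = ennreal (0 - - exp (- z / 2))"
    by (intro nn_integral_FTC_atLeast) (auto intro!: derivative_eq_intros)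
  then show ?thesis by simp
qed

text \<open>Writing \<open>exp (- q / 2)\<close> as an integral over \<open>{q..}\<close> expresses the Gaussian measure through volumes
  of balls.\<close>

lemma chi_tail_integral:
  fixes n :: nat and z :: real
  assumes z: "0 < z"
  shows "ennreal (1 - chi_le n z) = ennreal (1 / (2 powr (n / 2) * Gamma (n / 2 + 1))) *
    (\<integral>\<^sup>+w. ennreal (exp (- w / 2) / 2 * (w powr (n / 2) - z powr (n / 2))) * indicator {z..} w \<partial>lborel)"
proof -
  let ?P = "PiM {..<n} (\<lambda>_. lborel :: real measure)"
  interpret lb: product_sigma_finite "\<lambda>_::nat. lborel :: real measure" by standard
  interpret lbI: finite_product_sigma_finite "\<lambda>_::nat. lborel :: real measure" "{..<n}" by standard simp
  interpret ps: pair_sigma_finite ?P "lborel :: real measure" by standard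
  define q where "q x = (\<Sum>k<n. (x k)\<^sup>2)" for x :: "nat \<Rightarrow> real"
  have [measurable]: "q \<in> borel_measurable ?P" unfolding q_def by measurable
  have qg[measurable]: "q \<in> borel_measurable (gaussian {..<n})" unfolding q_def by measurable
  define c where "c = 1 / (2 * pi) powr (n / 2)"
  have c0: "c \<ge> 0" by (simp add: c_def)
  have dens: "(\<Prod>i<n. ennreal (std_normal_density (x i))) = ennreal c * ennreal (exp (- q x / 2))" for x :: "nat \<Rightarrow> real"
  proof -
    have "(\<Prod>i<n. std_normal_density (x i)) = (1 / sqrt (2 * pi)) ^ n * exp (\<Sum>i<n. - (x i)\<^sup>2 / 2)"
      by (simp add: std_normal_density_def prod.distrib exp_sum prod_dividef power_divide)
    also have "(1 / sqrt (2 * pi)) ^ n = c"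
      by (simp add: c_def powr_half_sqrt[symmetric] power_divide powr_realpow[symmetric] powr_powr)
    also have "(\<Sum>i<n. - (x i)\<^sup>2 / 2) = - q x / 2" by (simp add: q_def sum_divide_distrib sum_negf)
    finally show ?thesis using c0 by (simp add: prod_ennreal ennreal_mult)
  qed
  have "ennreal (1 - chi_le n z) = emeasure (gaussian {..<n}) {x \<in> space (gaussian {..<n}). z < q x}"
  proof -
    have "{x \<in> space (gaussian {..<n}). z < q x} = space (gaussian {..<n}) - {x \<in> space (gaussian {..<n}). q x \<le> z}" by auto
    moreover have "{x \<in> space (gaussian {..<n}). q x \<le> z} \<in> sets (gaussian {..<n})" by measurable
    ultimately have "measure (gaussian {..<n}) {x \<in> space (gaussian {..<n}). z < q x} = 1 - chi_le n z"
      by (simp add: prob_space.prob_compl[OF prob_space_gaussian] chi_le_def q_def)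
    then show ?thesis by (simp add: emeasure_gaussian_eq)
  qed
  also have "\<dots> = emeasure (density ?P (\<lambda>x. \<Prod>i<n. ennreal (std_normal_density (x i)))) {x \<in> space ?P. z < q x}"
    by (subst gaussian_eq_density) (auto simp: space_PiM)
  also have "\<dots> = (\<integral>\<^sup>+x. (\<Prod>i<n. ennreal (std_normal_density (x i))) * indicator {x \<in> space ?P. z < q x} x \<partial>?P)"
    by (rule emeasure_density) measurable
  also have "\<dots> = (\<integral>\<^sup>+x. (\<integral>\<^sup>+w. ennreal c * (ennreal (exp (- w / 2) / 2) * indicator {q x..} w * indicator {z<..} (q x)) \<partial>lborel) \<partial>?P)"
  proof (rule nn_integral_cong)
    fix x assume x: "x \<in> space ?P"
    have "(\<integral>\<^sup>+w. ennreal c * (ennreal (exp (- w / 2) / 2) * indicator {q x..} w * indicator {z<..} (q x)) \<partial>lborel)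
       = ennreal c * ((\<integral>\<^sup>+w. ennreal (exp (- w / 2) / 2) * indicator {q x..} w \<partial>lborel) * indicator {z<..} (q x))"
      by (subst nn_integral_cmult, measurable, subst nn_integral_multc) auto
    then show "(\<Prod>i<n. ennreal (std_normal_density (x i))) * indicator {x \<in> space ?P. z < q x} x
       = (\<integral>\<^sup>+w. ennreal c * (ennreal (exp (- w / 2) / 2) * indicator {q x..} w * indicator {z<..} (q x)) \<partial>lborel)"
      using x unfolding dens nn_integral_exp_half_tail by (auto simp: indicator_def)
  qed
  also have "\<dots> = (\<integral>\<^sup>+w. (\<integral>\<^sup>+x. ennreal c * (ennreal (exp (- w / 2) / 2) * indicator {q x..} w * indicator {z<..} (q x)) \<partial>?P) \<partial>lborel)"
  proof (rule ps.Fubini'[symmetric])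
    have "(\<lambda>p. ennreal c * (ennreal (exp (- snd p / 2) / 2) * indicator {p. q (fst p) \<le> snd p} p * indicator {z<..} (q (fst p))))
      \<in> borel_measurable (?P \<Otimes>\<^sub>M lborel)" by measurable
    then show "(\<lambda>(x, w). ennreal c * (ennreal (exp (- w / 2) / 2) * indicator {q x..} w * indicator {z<..} (q x)))
      \<in> borel_measurable (?P \<Otimes>\<^sub>M lborel)"
      by (rule measurable_cong[THEN iffD1, rotated]) (auto simp: indicator_def)
  qed
  also have "\<dots> = (\<integral>\<^sup>+w. ennreal (c * unit_ball_vol n) * (ennreal (exp (- w / 2) / 2 * (w powr (n / 2) - z powr (n / 2))) * indicator {z..} w) \<partial>lborel)"
  proof (rule nn_integral_cong)
    fix w :: real
    show "(\<integral>\<^sup>+x. ennreal c * (ennreal (exp (- w / 2) / 2) * indicator {q x..} w * indicator {z<..} (q x)) \<partial>?P)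
      = ennreal (c * unit_ball_vol n) * (ennreal (exp (- w / 2) / 2 * (w powr (n / 2) - z powr (n / 2))) * indicator {z..} w)"
    proof (cases "z \<le> w")
      case True
      have "(\<integral>\<^sup>+x. ennreal c * (ennreal (exp (- w / 2) / 2) * indicator {q x..} w * indicator {z<..} (q x)) \<partial>?P)
        = (\<integral>\<^sup>+x. ennreal (c * (exp (- w / 2) / 2)) * indicator {x \<in> space ?P. z < q x \<and> q x \<le> w} x \<partial>?P)"
      proof (rule nn_integral_cong)
        fix x assume x: "x \<in> space ?P"
        define E where "E = exp (- w / 2) / 2"
        have "E \<ge> 0" by (simp add: E_def)
        then show "ennreal c * (ennreal (exp (- w / 2) / 2) * indicator {q x..} w * indicator {z<..} (q x))
          = ennreal (c * (exp (- w / 2) / 2)) * indicator {x \<in> space ?P. z < q x \<and> q x \<le> w} x"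
          unfolding E_def[symmetric] using c0 x by (auto simp: indicator_def ennreal_mult)
      qed
      also have "\<dots> = ennreal (c * (exp (- w / 2) / 2)) * emeasure ?P {x \<in> space ?P. z < q x \<and> q x \<le> w}"
        by (rule nn_integral_cmult_indicator) measurable
      also have "\<dots> = ennreal (c * (exp (- w / 2) / 2)) * ennreal (unit_ball_vol n * (w powr (n / 2) - z powr (n / 2)))"
        unfolding q_def by (subst emeasure_shell[OF z True]) simp
      finally show ?thesis using True c0 z
        by (simp add: ennreal_mult[symmetric] powr_mono2 mult_ac)
    next
      case False
      then have "(\<integral>\<^sup>+x. ennreal c * (ennreal (exp (- w / 2) / 2) * indicator {q x..} w * indicator {z<..} (q x)) \<partial>?P) = (\<integral>\<^sup>+x. 0 \<partial>?P)"
        by (intro nn_integral_cong) (auto simp: indicator_def)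
      then show ?thesis using False by simp
    qed
  qed
  also have "\<dots> = ennreal (c * unit_ball_vol n) * (\<integral>\<^sup>+w. ennreal (exp (- w / 2) / 2 * (w powr (n / 2) - z powr (n / 2))) * indicator {z..} w \<partial>lborel)"
    by (rule nn_integral_cmult) measurable
  also have "c * unit_ball_vol n = 1 / (2 powr (n / 2) * Gamma (n / 2 + 1))"
    by (simp add: c_def unit_ball_vol_def powr_mult)
  finally show ?thesis .
qed

text \<open>The antiderivative used for the bounds produces the factor \<open>z / (z - n)\<close>,
  and the boundary term of the tail integral subtracts 1 from it; what is left is
  \<open>n / (z - n)\<close>.\<close>

definition chi_tail_approx :: "nat \<Rightarrow> real \<Rightarrow> real" where
  "chi_tail_approx n z = z powr (n / 2) * exp (- z / 2) / (2 powr (n / 2) * Gamma (n / 2 + 1)) * (n / (z - n))"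

text \<open>Up to the factor \<open>1 + 2 n / (w - n)\<^sup>2\<close>, which is at least \<open>1\<close> and decreasing, the integrand
  \<open>w powr (n / 2) * exp (- w / 2) / 2\<close> has the antiderivative \<open>- w / (w - n) * w powr (n / 2) * exp (- w / 2)\<close>.\<close>

lemma chi_tail_bounds:
  fixes n :: nat and z :: real
  assumes n: "0 < n" and z: "n < z"
  shows "1 - chi_le n z \<le> chi_tail_approx n z"
    and "chi_tail_approx n z * ((1 - 2 / (z - n)) / (1 + 2 * n / (z - n)\<^sup>2)) \<le> 1 - chi_le n z"
proof -
  define b where "b = n / 2"
  have b: "b > 0" "real n = 2 * b" using n by (simp_all add: b_def)
  have z0: "z > 0" using z by (rule le_less_trans[rotated]) simp
  define h where "h w = w powr b * exp (- w / 2)" for w :: real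
  have h0: "h w \<ge> 0" for w by (simp add: h_def)
  have [measurable]: "h \<in> borel_measurable borel" unfolding h_def by measurable
  define A where "A = (\<integral>\<^sup>+w. ennreal (h w / 2) * indicator {z..} w \<partial>lborel)"
  define J where "J = (\<integral>\<^sup>+w. ennreal (exp (- w / 2) / 2 * (w powr b - z powr b)) * indicator {z..} w \<partial>lborel)"
  \<comment> \<open>Subtracting the constant \<open>z powr b\<close> under the integral costs
    exactly \<open>h z\<close>, because the exponential weight has total mass
    \<open>exp (- z / 2)\<close> on the half-line from \<open>z\<close>.\<close>
  have AJ: "A = J + ennreal (h z)"
  proof -
    have "A = (\<integral>\<^sup>+w. ennreal (exp (- w / 2) / 2 * (w powr b - z powr b)) * indicator {z..} w
       + ennreal (z powr b) * (ennreal (exp (- w / 2) / 2) * indicator {z..} w) \<partial>lborel)"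
      unfolding A_def
    proof (rule nn_integral_cong)
      fix w :: real
      have "z \<le> w \<Longrightarrow> z powr b \<le> w powr b" using z0 b by (intro powr_mono2) auto
      define E where "E = exp (- w / 2) / 2"
      have E: "E \<ge> 0" "h w / 2 = w powr b * E" by (simp_all add: E_def h_def)
      have "ennreal (w powr b * E) = ennreal (E * (w powr b - z powr b)) + ennreal (z powr b) * ennreal E" if "z \<le> w"
      proof -
        have "ennreal (w powr b * E) = ennreal (E * (w powr b - z powr b) + z powr b * E)" by (simp add: algebra_simps)
        also have "\<dots> = ennreal (E * (w powr b - z powr b)) + ennreal (z powr b * E)"
          using E(1) \<open>z \<le> w \<Longrightarrow> z powr b \<le> w powr b\<close>[OF that] by (intro ennreal_plus) auto
        finally show ?thesis using E(1) by (simp add: ennreal_mult)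
      qed
      then show "ennreal (h w / 2) * indicator {z..} w = ennreal (exp (- w / 2) / 2 * (w powr b - z powr b)) * indicator {z..} w
       + ennreal (z powr b) * (ennreal (exp (- w / 2) / 2) * indicator {z..} w)"
        unfolding E_def[symmetric] E(2) by (auto simp: indicator_def)
    qed
    also have "\<dots> = J + ennreal (z powr b) * ennreal (exp (- z / 2))"
    proof -
      have "(\<integral>\<^sup>+w. ennreal (z powr b) * (ennreal (exp (- w / 2) / 2) * indicator {z..} w) \<partial>lborel)
        = ennreal (z powr b) * ennreal (exp (- z / 2))"
        by (subst nn_integral_cmult, measurable, simp only: nn_integral_exp_half_tail)
      then show ?thesis unfolding J_def by (subst nn_integral_add, measurable)
    qed
    finally show ?thesis by (simp add: h_def ennreal_mult)
  qed
  define \<eta> where "\<eta> = 4 * b / (z - 2 * b)\<^sup>2"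
  have zb: "z - 2 * b > 0" using z b by simp
  have \<eta>: "\<eta> \<ge> 0" using b by (simp add: \<eta>_def)
  have exact: "(\<integral>\<^sup>+w. ennreal (h w / 2 * (1 + 4 * b / (w - 2 * b)\<^sup>2)) * indicator {z..} w \<partial>lborel) = ennreal (z / (z - 2 * b) * h z)"
  proof -
    define F where "F w = - (w / (w - 2 * b) * (w powr b * exp (- w / 2)))" for w
    have lim: "(F \<longlongrightarrow> 0) at_top" unfolding F_def using b(1) by real_asymp
    have "(\<integral>\<^sup>+w. ennreal (h w / 2 * (1 + 4 * b / (w - 2 * b)\<^sup>2)) * indicator {z..} w \<partial>lborel) = ennreal (0 - F z)"
    proof (rule nn_integral_FTC_atLeast)
      fix w assume w: "z \<le> w"
      then have w2: "w > 0" "w - 2 * b > 0" using z0 zb by auto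
      define y where "y = w - 2 * b"
      have y: "y > 0" "w = y + 2 * b" using w2 by (simp_all add: y_def)
      have p: "w powr b = w * w powr (b - 1)" using w2 by (simp add: powr_diff)
      have "(F has_real_derivative
         - ((1 * (w - 2 * b) - w * 1) / (w - 2 * b)\<^sup>2 * (w powr b * exp (- w / 2))
           + w / (w - 2 * b) * (b * w powr (b - 1) * exp (- w / 2) + w powr b * (exp (- w / 2) * (- 1 / 2))))) (at w)"
      proof -
        have d1: "((\<lambda>w. w / (w - 2 * b)) has_real_derivative (1 * (w - 2 * b) - w * 1) / (w - 2 * b)\<^sup>2) (at w)"
          using w2 by (auto intro!: derivative_eq_intros simp: power2_eq_square)
        have d2: "((\<lambda>w. w powr b * exp (- w / 2)) has_real_derivative
            b * w powr (b - 1) * exp (- w / 2) + w powr b * (exp (- w / 2) * (- 1 / 2))) (at w)"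
          using w2 by (auto intro!: derivative_eq_intros)
        show ?thesis unfolding F_def
          by (rule DERIV_cong[OF DERIV_minus[OF DERIV_mult[OF d1 d2]]]) (simp only: mult.commute[of _ "w / (w - 2 * b)"])
      qed
      also have "- ((1 * (w - 2 * b) - w * 1) / (w - 2 * b)\<^sup>2 * (w powr b * exp (- w / 2))
           + w / (w - 2 * b) * (b * w powr (b - 1) * exp (- w / 2) + w powr b * (exp (- w / 2) * (- 1 / 2))))
         = h w / 2 * (1 + 4 * b / (w - 2 * b)\<^sup>2)"
      proof -
        have "w / (w - 2 * b) * (b * w powr (b - 1) * exp (- w / 2) + w powr b * (exp (- w / 2) * (- 1 / 2)))
          = (b - w / 2) / (w - 2 * b) * h w"
          unfolding h_def p by (simp add: algebra_simps add_divide_distrib diff_divide_distrib)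
        also have "(b - w / 2) / (w - 2 * b) = - 1 / 2" using w2 by (simp add: field_simps)
        finally show ?thesis
          unfolding h_def by (simp add: power2_eq_square algebra_simps)
      qed
      finally show "(F has_real_derivative h w / 2 * (1 + 4 * b / (w - 2 * b)\<^sup>2)) (at w)" .
      show "0 \<le> h w / 2 * (1 + 4 * b / (w - 2 * b)\<^sup>2)" using h0 b by simp
    qed (use lim in auto)
    then show ?thesis by (simp add: F_def h_def)
  qed
  have A_le: "A \<le> ennreal (z / (z - 2 * b) * h z)"
    unfolding exact[symmetric] A_def
  proof (intro nn_integral_mono mult_right_mono ennreal_leI)
    fix w
    have "h w / 2 * 1 \<le> h w / 2 * (1 + 4 * b / (w - 2 * b)\<^sup>2)"
      using h0[of w] b by (intro mult_left_mono) auto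
    then show "h w / 2 \<le> h w / 2 * (1 + 4 * b / (w - 2 * b)\<^sup>2)" by simp
  qed auto
  have A_ge: "ennreal (z / (z - 2 * b) * h z) \<le> ennreal (1 + \<eta>) * A"
  proof -
    have "(\<integral>\<^sup>+w. ennreal (h w / 2 * (1 + 4 * b / (w - 2 * b)\<^sup>2)) * indicator {z..} w \<partial>lborel)
       \<le> (\<integral>\<^sup>+w. ennreal (1 + \<eta>) * (ennreal (h w / 2) * indicator {z..} w) \<partial>lborel)"
    proof (rule nn_integral_mono)
      fix w :: real
      show "ennreal (h w / 2 * (1 + 4 * b / (w - 2 * b)\<^sup>2)) * indicator {z..} w \<le> ennreal (1 + \<eta>) * (ennreal (h w / 2) * indicator {z..} w)"
      proof (cases "z \<le> w")
        case True
        then have "4 * b / (w - 2 * b)\<^sup>2 \<le> \<eta>" unfolding \<eta>_def using b zb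
          by (intro divide_left_mono power_mono mult_pos_pos) auto
        then have "h w / 2 * (1 + 4 * b / (w - 2 * b)\<^sup>2) \<le> (1 + \<eta>) * (h w / 2)"
          using h0[of w] by (subst mult.commute[of "1 + \<eta>"]) (intro mult_left_mono, auto)
        then have "ennreal (h w / 2 * (1 + 4 * b / (w - 2 * b)\<^sup>2)) \<le> ennreal ((1 + \<eta>) * (h w / 2))" by (rule ennreal_leI)
        also have "\<dots> = ennreal (1 + \<eta>) * ennreal (h w / 2)" using h0[of w] \<eta> by (intro ennreal_mult) auto
        finally have le: "ennreal (h w / 2 * (1 + 4 * b / (w - 2 * b)\<^sup>2)) \<le> ennreal (1 + \<eta>) * ennreal (h w / 2)" .
        have i: "indicator {z..} w = (1 :: ennreal)" using True by simp
        show ?thesis unfolding i mult_1_right by (rule le)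
      qed simp
    qed
    then show ?thesis unfolding exact A_def by (subst (asm) nn_integral_cmult) auto
  qed
  define a where "a = enn2real A"
  have "A < \<top>" using A_le by (rule le_less_trans) simp
  then have A: "A = ennreal a" by (simp add: a_def)
  have a0: "a \<ge> 0" by (simp add: a_def)
  have hz0: "z / (z - 2 * b) * h z \<ge> 0" using zb z0 h0 by simp
  have a1: "a \<le> z / (z - 2 * b) * h z" using A_le hz0 a0 unfolding A by simp
  have a2: "z / (z - 2 * b) * h z \<le> (1 + \<eta>) * a" 
  proof -
    have "ennreal (z / (z - 2 * b) * h z) \<le> ennreal ((1 + \<eta>) * a)"
      using A_ge \<eta> a0 unfolding A by (subst ennreal_mult) auto
    then show ?thesis using \<eta> a0 by (subst (asm) ennreal_le_iff) auto
  qed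
  define j where "j = enn2real J"
  have J: "J = ennreal j"
  proof -
    have "J \<le> A" unfolding AJ by simp
    then have "J < \<top>" unfolding A by (rule le_less_trans) simp
    then show ?thesis by (simp add: j_def)
  qed
  have j0: "j \<ge> 0" by (simp add: j_def)
  have aj: "a = j + h z"
    using AJ j0 a0 h0[of z] unfolding A J by (simp add: ennreal_plus[symmetric] del: ennreal_plus)
  define c where "c = 1 / (2 powr b * Gamma (b + 1))"
  have c: "c > 0" using b by (simp add: c_def)
  have tail: "1 - chi_le n z = c * j"
  proof -
    have "ennreal (1 - chi_le n z) = ennreal c * ennreal j"
      unfolding J[symmetric] c_def J_def b_def by (rule chi_tail_integral[OF z0])
    then have "ennreal (1 - chi_le n z) = ennreal (c * j)" using c j0 by (simp only: ennreal_mult less_imp_le)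
    moreover have "0 \<le> 1 - chi_le n z" by (simp add: chi_le_def measure_gaussian_le_1)
    ultimately show ?thesis using c j0 by (simp add: ennreal_inj)
  qed
  have approx: "chi_tail_approx n z = c * (h z * (2 * b / (z - 2 * b)))"
    by (simp add: chi_tail_approx_def c_def h_def b_def)
  have zz: "z / (z - 2 * b) = 1 + 2 * b / (z - 2 * b)" using zb by (simp add: field_simps)
  show "1 - chi_le n z \<le> chi_tail_approx n z"
    unfolding tail approx using c a1 aj unfolding zz
    by (intro mult_left_mono) (auto simp: algebra_simps)
  have "h z * (2 * b / (z - 2 * b)) * ((1 - 2 / (z - 2 * b)) / (1 + \<eta>)) \<le> j"
  proof -
    define y where "y = z - 2 * b"
    have y: "y > 0" using zb by (simp add: y_def)
    \<comment> \<open>\<open>\<eta> = 4 * b / y\<^sup>2\<close> is the fraction \<open>2 / y\<close>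
      of the main term \<open>2 * b / y\<close>, so subtracting it amounts to the factor
      \<open>1 - 2 / y\<close>.\<close>
    have "\<eta> * y = 4 * b / y" using y by (simp add: \<eta>_def y_def[symmetric] power2_eq_square)
    then have "h z * (2 * b / y) * (1 - 2 / y) = h z * (2 * b / y - \<eta>)"
      using y by (simp add: field_simps)
    also have "\<dots> \<le> (1 + \<eta>) * j"
    proof -
      have "(1 + 2 * b / y) * h z \<le> (1 + \<eta>) * (j + h z)" using a2 unfolding zz aj by (simp only: y_def)
      then show ?thesis by (simp add: algebra_simps)
    qed
    finally have "h z * (2 * b / y) * (1 - 2 / y) \<le> j * (1 + \<eta>)" by (simp add: mult.commute)
    then have "h z * (2 * b / y) * (1 - 2 / y) / (1 + \<eta>) \<le> j" using \<eta> by (subst pos_divide_le_eq) auto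
    then show ?thesis by (simp add: y_def)
  qed
  then have "c * (h z * (2 * b / (z - 2 * b)) * ((1 - 2 / (z - 2 * b)) / (1 + \<eta>))) \<le> c * j"
    using c by (intro mult_left_mono) auto
  then show "chi_tail_approx n z * ((1 - 2 / (z - n)) / (1 + 2 * n / (z - n)\<^sup>2)) \<le> 1 - chi_le n z"
    unfolding tail approx using b by (simp add: \<eta>_def mult_ac)
qed

text \<open>The law has mean n and variance 2n, so \<open>D\<close> is the deviation in standard
  units divided by sqrt 2, and the limit is the tail equivalent of the normal law. The hypothesis on
  the cube of \<open>D\<close> removes the third-order term of \<open>n / 2 * ln (1 + u)\<close> at
  u = 2D / sqrt n, so that the normal approximation still holds at the distances used later.\<close>

lemma chi_tail_asymptotics:
  fixes n :: "nat \<Rightarrow> nat" and z D :: "nat \<Rightarrow> real"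
  defines "D \<equiv> \<lambda>N. (z N - n N) / (2 * sqrt (n N))"
  assumes n: "filterlim (\<lambda>N. real (n N)) at_top sequentially"
    and D: "filterlim D at_top sequentially"
    and D3: "(\<lambda>N. D N ^ 3 / sqrt (n N)) \<longlonglongrightarrow> 0"
  shows "(\<lambda>N. (1 - chi_le (n N) (z N)) * (2 * sqrt pi * D N * exp ((D N)\<^sup>2))) \<longlonglongrightarrow> 1"
proof -
  define S where "S x = Gamma (x + 1) / (sqrt (2 * pi * x) * (x powr x * exp (- x)))" for x :: real
  define \<rho> where "\<rho> N = 2 * D N / sqrt (n N)" for N
  \<comment> \<open>The third-order remainder of \<open>ln (1 + u)\<close>, divided by
    \<open>u ^ 3\<close>. As it stays bounded near 0, the error \<open>E\<close> of the exponent has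
    the order of \<open>D N ^ 3 / sqrt (n N)\<close>.\<close>
  define g where "g u = (ln (1 + u) - u + u\<^sup>2 / 2) / u ^ 3" for u :: real
  have n0: "\<forall>\<^sub>F N in sequentially. real (n N) > 0" using n unfolding filterlim_at_top_dense by blast
  have D0: "\<forall>\<^sub>F N in sequentially. D N > 0" using D unfolding filterlim_at_top_dense by blast
  have nhalf: "filterlim (\<lambda>N. n N / 2) at_top sequentially"
    using n by (rule filterlim_compose[rotated]) real_asymp
  have S_lim: "(\<lambda>N. 1 / S (n N / 2)) \<longlonglongrightarrow> 1 / 1"
    by (intro tendsto_divide tendsto_const filterlim_compose[OF Gamma_stirling nhalf, folded S_def]) auto
  have sqrt_n: "filterlim (\<lambda>N. sqrt (n N)) at_top sequentially"
    by (rule filterlim_compose[OF sqrt_at_top n])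
  have \<rho>0: "\<rho> \<longlonglongrightarrow> 0"
  proof (rule tendsto_sandwich)
    have ev: "\<forall>\<^sub>F N in sequentially. 1 \<le> D N" using D by (simp add: filterlim_at_top)
    show "\<forall>\<^sub>F N in sequentially. 0 \<le> \<rho> N" using D0 by eventually_elim (simp add: \<rho>_def)
    show "\<forall>\<^sub>F N in sequentially. \<rho> N \<le> 2 * (D N ^ 3 / sqrt (n N))"
      using ev
    proof eventually_elim
      case (elim N)
      then have "D N \<le> D N ^ 3" by (simp add: self_le_power)
      then have "2 * D N / sqrt (n N) \<le> 2 * D N ^ 3 / sqrt (n N)" by (intro divide_right_mono) auto
      then show ?case by (simp add: \<rho>_def)
    qed
    show "(\<lambda>N. 2 * (D N ^ 3 / sqrt (n N))) \<longlonglongrightarrow> 0" using tendsto_mult[OF tendsto_const D3, of 2] by simp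
  qed auto
  have \<rho>_pos: "\<forall>\<^sub>F N in sequentially. \<rho> N > 0"
    using D0 n0 by eventually_elim (simp add: \<rho>_def)
  have \<rho>_right: "filterlim \<rho> (at_right 0) sequentially"
    unfolding filterlim_at using \<rho>0 \<rho>_pos by (auto elim!: eventually_mono)
  have g_lim: "(\<lambda>N. g (\<rho> N)) \<longlonglongrightarrow> 1 / 3"
  proof (rule filterlim_compose[OF _ \<rho>_right])
    show "(g \<longlongrightarrow> 1 / 3) (at_right 0)" unfolding g_def by real_asymp
  qed
  define E where "E N = 4 * (D N ^ 3 / sqrt (n N)) * g (\<rho> N)" for N
  have E_lim: "E \<longlonglongrightarrow> 0"
    unfolding E_def using tendsto_mult[OF tendsto_mult[OF tendsto_const D3, of 4] g_lim] by simp
  have main: "\<forall>\<^sub>F N in sequentially. chi_tail_approx (n N) (z N) * (2 * sqrt pi * D N * exp ((D N)\<^sup>2))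
      = 1 / S (n N / 2) * exp (E N)"
    using n0 D0 \<rho>_pos
  proof eventually_elim
    case (elim N)
    define m where "m = real (n N)"
    define d where "d = D N"
    define r where "r = \<rho> N"
    have m: "m > 0" "sqrt m * sqrt m = m" "sqrt m > 0" using elim by (auto simp: m_def)
    have d: "d > 0" and r: "r > 0" "r = 2 * d / sqrt m" using elim by (auto simp: d_def r_def \<rho>_def m_def)
    have zm: "z N - m = 2 * sqrt m * d" using m by (simp add: d_def D_def m_def)
    have zr: "z N = m * (1 + r)" using zm m by (simp add: r(2) field_simps)
    have dr: "d\<^sup>2 = m / 4 * r\<^sup>2" using m by (simp add: r(2) power_divide power_mult_distrib)
    have Er: "E N = m / 2 * r ^ 3 * g r"
    proof -
      have "m / 2 * r ^ 3 = 4 * (d ^ 3 / sqrt m)"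
        using m by (simp add: r(2) power_divide power_mult_distrib power3_eq_cube field_simps)
      then show ?thesis by (simp add: E_def d_def m_def r_def)
    qed
    have "E N = m / 2 * (ln (1 + r) - r + r\<^sup>2 / 2)" unfolding Er g_def using r by simp
    then have Ed: "E N = m / 2 * (ln (1 + r) - r) + d\<^sup>2" unfolding dr by (simp add: algebra_simps)
    have e1: "z N powr (m / 2) = m powr (m / 2) * exp (m / 2 * ln (1 + r))"
      unfolding zr using m r by (subst powr_mult) (auto simp: powr_def)
    have e2: "exp (- z N / 2) = exp (- (m / 2)) * exp (- (m / 2 * r))"
    proof -
      have "- (m * (1 + r)) / 2 = - (m / 2) + - (m / 2 * r)" by (simp add: field_simps)
      then show ?thesis unfolding zr by (simp only: exp_add)
    qed
    have e3: "Gamma (m / 2 + 1) = S (m / 2) * (sqrt (pi * m) * ((m / 2) powr (m / 2) * exp (- (m / 2))))"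
      using m by (simp add: S_def)
    have e4: "2 powr (m / 2) * (m / 2) powr (m / 2) = m powr (m / 2)"
      using m by (subst powr_mult[symmetric]) auto
    have e5: "m / (z N - m) = sqrt m / (2 * d)" unfolding zm using m d by (simp add: field_simps)
    have "chi_tail_approx (n N) (z N) = m powr (m / 2) * exp (m / 2 * ln (1 + r)) * (exp (- (m / 2)) * exp (- (m / 2 * r)))
       / (2 powr (m / 2) * (S (m / 2) * (sqrt (pi * m) * ((m / 2) powr (m / 2) * exp (- (m / 2)))))) * (sqrt m / (2 * d))"
      unfolding chi_tail_approx_def m_def[symmetric] e1 e2 e3 e5 ..
    also have "2 powr (m / 2) * (S (m / 2) * (sqrt (pi * m) * ((m / 2) powr (m / 2) * exp (- (m / 2)))))
       = m powr (m / 2) * (S (m / 2) * (sqrt (pi * m) * exp (- (m / 2))))"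
      unfolding e4[symmetric] by (simp add: mult_ac)
    also have "m powr (m / 2) * exp (m / 2 * ln (1 + r)) * (exp (- (m / 2)) * exp (- (m / 2 * r)))
       / (m powr (m / 2) * (S (m / 2) * (sqrt (pi * m) * exp (- (m / 2))))) * (sqrt m / (2 * d))
       = exp (m / 2 * ln (1 + r)) * exp (- (m / 2 * r)) / (S (m / 2) * (2 * sqrt pi * d))"
      using m by (simp add: real_sqrt_mult)
    also have "exp (m / 2 * ln (1 + r)) * exp (- (m / 2 * r)) = exp (E N) / exp (d\<^sup>2)"
      unfolding Ed by (simp add: exp_diff[symmetric] exp_add[symmetric] algebra_simps)
    finally have "chi_tail_approx (n N) (z N) = exp (E N) / exp (d\<^sup>2) / (S (m / 2) * (2 * sqrt pi * d))" .
    then show ?case using d by (simp add: d_def m_def)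
  qed
  have approx: "(\<lambda>N. chi_tail_approx (n N) (z N) * (2 * sqrt pi * D N * exp ((D N)\<^sup>2))) \<longlonglongrightarrow> 1"
  proof -
    have "(\<lambda>N. 1 / S (n N / 2) * exp (E N)) \<longlonglongrightarrow> 1 / 1 * exp 0"
      by (intro tendsto_mult S_lim tendsto_exp E_lim)
    then show ?thesis using main by (simp add: tendsto_cong)
  qed
  \<comment> \<open>The correction factor of the lower tail bound, rewritten with
    \<open>z N - n N = 2 * sqrt (n N) * D N\<close>.\<close>
  define c where "c N = (1 - 1 / (sqrt (n N) * D N)) / (1 + 1 / (2 * (D N)\<^sup>2))" for N
  have c_lim: "c \<longlonglongrightarrow> (1 - 0) / (1 + 0)"
  proof -
    have "filterlim (\<lambda>N. sqrt (n N) * D N) at_top sequentially"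
      by (rule filterlim_at_top_mult_at_top[OF sqrt_n D])
    then have "(\<lambda>N. 1 / (sqrt (n N) * D N)) \<longlonglongrightarrow> 0"
      by (intro tendsto_divide_0[OF tendsto_const] filterlim_at_top_imp_at_infinity)
    moreover have "(\<lambda>N. 1 / (2 * (D N)\<^sup>2)) \<longlonglongrightarrow> 0"
      by (rule filterlim_compose[OF _ D]) real_asymp
    ultimately show ?thesis unfolding c_def by (intro tendsto_divide tendsto_diff tendsto_add tendsto_const) auto
  qed
  show ?thesis
  proof (rule tendsto_sandwich)
    have ev: "\<forall>\<^sub>F N in sequentially. n N > 0 \<and> real (n N) < z N \<and> D N > 0 \<and>
      (1 - 2 / (z N - n N)) / (1 + 2 * n N / (z N - n N)\<^sup>2) = c N"
      using n0 D0
    proof eventually_elim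
      case (elim N)
      have s: "sqrt (n N) > 0" "(sqrt (n N))\<^sup>2 = n N" using elim by auto
      have zn: "z N - n N = 2 * sqrt (n N) * D N" using s by (simp add: D_def)
      then have "z N - n N > 0" using s elim by simp
      moreover have "2 / (z N - n N) = 1 / (sqrt (n N) * D N)" unfolding zn by simp
      moreover have "2 * n N / (z N - n N)\<^sup>2 = 1 / (2 * (D N)\<^sup>2)"
        unfolding zn power_mult_distrib s(2) using elim by simp
      ultimately show ?case using elim by (simp add: c_def)
    qed
    show "\<forall>\<^sub>F N in sequentially. (1 - chi_le (n N) (z N)) * (2 * sqrt pi * D N * exp ((D N)\<^sup>2))
       \<le> chi_tail_approx (n N) (z N) * (2 * sqrt pi * D N * exp ((D N)\<^sup>2))"
      using ev by eventually_elim (intro mult_right_mono chi_tail_bounds, auto)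
    show "\<forall>\<^sub>F N in sequentially. chi_tail_approx (n N) (z N) * (2 * sqrt pi * D N * exp ((D N)\<^sup>2)) * c N
       \<le> (1 - chi_le (n N) (z N)) * (2 * sqrt pi * D N * exp ((D N)\<^sup>2))"
      using ev
    proof eventually_elim
      case (elim N)
      then have "chi_tail_approx (n N) (z N) * c N \<le> 1 - chi_le (n N) (z N)"
        using chi_tail_bounds(2)[of "n N" "z N"] by simp
      then have "(chi_tail_approx (n N) (z N) * c N) * (2 * sqrt pi * D N * exp ((D N)\<^sup>2))
        \<le> (1 - chi_le (n N) (z N)) * (2 * sqrt pi * D N * exp ((D N)\<^sup>2))"
        using elim by (intro mult_right_mono) auto
      then show ?case by (simp add: mult_ac)
    qed
    show "(\<lambda>N. chi_tail_approx (n N) (z N) * (2 * sqrt pi * D N * exp ((D N)\<^sup>2))) \<longlonglongrightarrow> 1" by (rule approx)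
    show "(\<lambda>N. chi_tail_approx (n N) (z N) * (2 * sqrt pi * D N * exp ((D N)\<^sup>2)) * c N) \<longlonglongrightarrow> 1"
      using tendsto_mult[OF approx c_lim] by simp
  qed
qed

lemma power_one_minus_tendsto:
  fixes t :: "nat \<Rightarrow> real"
  assumes t: "(\<lambda>N. real N * t N) \<longlonglongrightarrow> l" and l: "l > 0"
  shows "(\<lambda>N. (1 - t N) ^ N) \<longlonglongrightarrow> exp (- l)"
proof -
  have pos: "\<forall>\<^sub>F N in sequentially. real N * t N > 0" by (rule order_tendstoD(1)[OF t l])
  have t0: "t \<longlonglongrightarrow> 0"
  proof -
    have "(\<lambda>N. real N * t N * (1 / real N)) \<longlonglongrightarrow> l * 0" by (intro tendsto_mult t lim_1_over_n)
    moreover have "\<forall>\<^sub>F N in sequentially. real N * t N * (1 / real N) = t N"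
      using eventually_gt_at_top[of 0] by eventually_elim simp
    ultimately show ?thesis by (simp add: tendsto_cong)
  qed
  have tpos: "\<forall>\<^sub>F N in sequentially. t N > 0"
    using pos by eventually_elim (simp add: zero_less_mult_iff)
  have right: "filterlim t (at_right 0) sequentially"
    unfolding filterlim_at using t0 tpos by (auto elim!: eventually_mono)
  have "((\<lambda>u::real. ln (1 - u) / u) \<longlongrightarrow> -1) (at_right 0)" by real_asymp
  from filterlim_compose[OF this right] have "(\<lambda>N. ln (1 - t N) / t N) \<longlonglongrightarrow> -1" .
  then have "(\<lambda>N. exp (real N * t N * (ln (1 - t N) / t N))) \<longlonglongrightarrow> exp (l * -1)"
    by (intro tendsto_exp tendsto_mult t)
  moreover have "\<forall>\<^sub>F N in sequentially. exp (real N * t N * (ln (1 - t N) / t N)) = (1 - t N) ^ N"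
    using tpos order_tendstoD(2)[OF t0 zero_less_one]
  proof eventually_elim
    case (elim N)
    have "(1 - t N) ^ N = exp (real N * ln (1 - t N))"
      using elim by (simp add: exp_of_nat_mult)
    then show ?case using elim by simp
  qed
  ultimately show ?thesis by (simp add: tendsto_cong)
qed

text \<open>Obtained by solving N / (2 sqrt(pi) D exp(D^2)) -> exp(-x) for D = sqrt(ln N) + c /
  sqrt(ln N). Here D^2 is about ln N + 2c and ln(2 sqrt(pi) D) is about (ln(4 pi) + ln ln N) / 2, so
  2c = x - (ln ln N + ln(4 pi)) / 2.\<close>

definition gumbel_shift :: "real \<Rightarrow> nat \<Rightarrow> real" where
  "gumbel_shift x N = (x - (ln (ln (real N)) + ln (4 * pi)) / 2) / 2"

text \<open>An error \<open>w\<close> at the scale \<open>1 / sqrt (ln N)\<close> enters the square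
  of \<open>D\<close> as \<open>2 * w\<close>, so convergence of \<open>w\<close> to 0 is what a
  perturbation of the threshold has to satisfy. The expected number of exceedances then tends to
  \<open>exp (- x)\<close>, and the power to the Gumbel value.\<close>

lemma chi_power_tendsto_gumbel:
  fixes n :: "nat \<Rightarrow> nat" and z D w :: "nat \<Rightarrow> real" and x :: real
  defines "D \<equiv> \<lambda>N. (z N - n N) / (2 * sqrt (n N))"
  assumes n: "filterlim (\<lambda>N. real (n N)) at_top sequentially"
    and Ln: "(\<lambda>N. sqrt (ln N) ^ 3 / sqrt (n N)) \<longlonglongrightarrow> 0"
    and w: "w \<longlonglongrightarrow> 0"
    and D_eq: "\<forall>\<^sub>F N in sequentially. D N = sqrt (ln N) + (gumbel_shift x N + w N) / sqrt (ln N)"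
  shows "(\<lambda>N. chi_le (n N) (z N) ^ N) \<longlonglongrightarrow> exp (- exp (- x))"
proof -
  define e where "e N = gumbel_shift x N + w N" for N
  have L0: "\<forall>\<^sub>F N in sequentially. ln (real N) > 0" by real_asymp
  have inv_sqrt: "(\<lambda>N. 1 / sqrt (ln (real N))) \<longlonglongrightarrow> 0" by real_asymp
  have e_sqrt: "(\<lambda>N. e N / sqrt (ln N)) \<longlonglongrightarrow> 0"
  proof -
    have "(\<lambda>N. gumbel_shift x N / sqrt (ln N)) \<longlonglongrightarrow> 0" unfolding gumbel_shift_def by real_asymp
    from tendsto_add[OF this tendsto_mult[OF w inv_sqrt]] show ?thesis
      by (simp add: e_def add_divide_distrib)
  qed
  have e_L: "(\<lambda>N. e N / ln N) \<longlonglongrightarrow> 0"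
  proof -
    have "\<forall>\<^sub>F N in sequentially. e N / sqrt (ln N) * (1 / sqrt (ln N)) = e N / ln N"
      using L0 by eventually_elim simp
    from Lim_transform_eventually[OF tendsto_mult[OF e_sqrt inv_sqrt] this] show ?thesis by simp
  qed
  have D_ratio: "(\<lambda>N. D N / sqrt (ln N)) \<longlonglongrightarrow> 1"
  proof -
    have "\<forall>\<^sub>F N in sequentially. 1 + e N / ln N = D N / sqrt (ln N)"
      using L0 D_eq
    proof eventually_elim
      case (elim N)
      define s where "s = sqrt (ln (real N))"
      have s: "s > 0" "ln (real N) = s * s" using elim by (simp_all add: s_def)
      have "D N = s + e N / s" using elim by (simp add: s_def e_def)
      then show ?case unfolding s(2) using s(1) by (simp add: field_simps)
    qed
    moreover have "(\<lambda>N. 1 + e N / ln N) \<longlonglongrightarrow> 1 + 0" by (intro tendsto_add tendsto_const e_L)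
    ultimately show ?thesis by (simp add: tendsto_cong)
  qed
  have D: "filterlim D at_top sequentially"
  proof -
    have "filterlim (\<lambda>N. D N / sqrt (ln N) * sqrt (ln (real N))) at_top sequentially"
      by (rule filterlim_tendsto_pos_mult_at_top[OF D_ratio]) (simp, real_asymp)
    moreover have "\<forall>\<^sub>F N in sequentially. D N / sqrt (ln N) * sqrt (ln (real N)) = D N"
      using L0 by eventually_elim simp
    ultimately show ?thesis by (simp add: filterlim_cong)
  qed
  have D3: "(\<lambda>N. D N ^ 3 / sqrt (n N)) \<longlonglongrightarrow> 0"
  proof -
    have "(\<lambda>N. (D N / sqrt (ln N)) ^ 3 * (sqrt (ln N) ^ 3 / sqrt (n N))) \<longlonglongrightarrow> 1 ^ 3 * 0"
      by (intro tendsto_mult tendsto_power D_ratio Ln)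
    moreover have "\<forall>\<^sub>F N in sequentially. (D N / sqrt (ln N)) ^ 3 * (sqrt (ln N) ^ 3 / sqrt (n N)) = D N ^ 3 / sqrt (n N)"
      using L0 by eventually_elim (simp add: power_divide)
    ultimately have "(\<lambda>N. D N ^ 3 / sqrt (n N)) \<longlonglongrightarrow> 1 ^ 3 * 0" by (rule Lim_transform_eventually)
    then show ?thesis by simp
  qed
  have tail: "(\<lambda>N. (1 - chi_le (n N) (z N)) * (2 * sqrt pi * D N * exp ((D N)\<^sup>2))) \<longlonglongrightarrow> 1"
    using chi_tail_asymptotics[of n z] n D D3 unfolding D_def by blast
  have "(\<lambda>N. real N / (2 * sqrt pi * D N * exp ((D N)\<^sup>2))) \<longlonglongrightarrow> exp (- x)"
  proof -
    \<comment> \<open>The logarithm of the quotient below is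
      \<open>ln N - ln (2 * sqrt pi) - ln (D N) - (D N)\<^sup>2\<close>. Inserting \<open>D\<close>
      cancels everything except \<open>- x\<close> and three vanishing terms.\<close>
    have "(\<lambda>N. exp (- x - 2 * w N - (e N / sqrt (ln N))\<^sup>2 - ln (1 + e N / ln N))) \<longlonglongrightarrow> exp (- x - 2 * 0 - 0\<^sup>2 - ln (1 + 0))"
      by (intro tendsto_exp tendsto_diff tendsto_const tendsto_mult w tendsto_power e_sqrt tendsto_ln tendsto_add e_L) auto
    moreover have "\<forall>\<^sub>F N in sequentially. exp (- x - 2 * w N - (e N / sqrt (ln N))\<^sup>2 - ln (1 + e N / ln N))
      = real N / (2 * sqrt pi * D N * exp ((D N)\<^sup>2))"
    proof -
      have "\<forall>\<^sub>F N in sequentially. D N > 0" using D unfolding filterlim_at_top_dense by blast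
      then show ?thesis using L0 D_eq eventually_gt_at_top[of 0]
      proof eventually_elim
        case (elim N)
        define L where "L = ln (real N)"
        have L: "L > 0" "sqrt L * sqrt L = L" "sqrt L > 0" using elim by (auto simp: L_def)
        have DN: "D N = sqrt L + e N / sqrt L" using elim by (simp add: e_def L_def)
        have fac: "D N = sqrt L * (1 + e N / L)" unfolding DN using L by (simp add: field_simps)
        have pos: "1 + e N / L > 0" using elim(1) L unfolding fac by (simp add: zero_less_mult_iff)
        have "(D N)\<^sup>2 = L + 2 * e N + (e N / sqrt L)\<^sup>2"
          unfolding DN using L by (simp add: power2_eq_square algebra_simps)
        moreover have "ln (D N) = ln L / 2 + ln (1 + e N / L)" unfolding fac using L pos by (simp add: ln_mult ln_sqrt)
        moreover have "ln (2 * sqrt pi) = ln (4 * pi) / 2"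
        proof -
          have "2 * sqrt pi = sqrt (4 * pi)" by (simp add: real_sqrt_mult)
          then show ?thesis by (simp add: ln_sqrt)
        qed
        ultimately have "- x - 2 * w N - (e N / sqrt L)\<^sup>2 - ln (1 + e N / L) = L - (ln (2 * sqrt pi) + ln (D N) + (D N)\<^sup>2)"
          by (simp add: e_def gumbel_shift_def L_def field_simps)
        then have "exp (- x - 2 * w N - (e N / sqrt L)\<^sup>2 - ln (1 + e N / L))
          = exp L / (exp (ln (2 * sqrt pi)) * exp (ln (D N)) * exp ((D N)\<^sup>2))"
          by (simp only: exp_diff exp_add)
        then show ?case using elim by (simp add: L_def)
      qed
    qed
    ultimately show ?thesis by (simp add: tendsto_cong)
  qed
  from tendsto_mult[OF tail this]
  have "(\<lambda>N. (1 - chi_le (n N) (z N)) * (2 * sqrt pi * D N * exp ((D N)\<^sup>2)) * (real N / (2 * sqrt pi * D N * exp ((D N)\<^sup>2)))) \<longlonglongrightarrow> exp (- x)"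
    by simp
  moreover have "\<forall>\<^sub>F N in sequentially. (1 - chi_le (n N) (z N)) * (2 * sqrt pi * D N * exp ((D N)\<^sup>2)) * (real N / (2 * sqrt pi * D N * exp ((D N)\<^sup>2)))
     = real N * (1 - chi_le (n N) (z N))"
  proof -
    have "\<forall>\<^sub>F N in sequentially. D N > 0" using D unfolding filterlim_at_top_dense by blast
    then show ?thesis by eventually_elim simp
  qed
  ultimately have "(\<lambda>N. real N * (1 - chi_le (n N) (z N))) \<longlonglongrightarrow> exp (- x)" by (simp add: tendsto_cong)
  from power_one_minus_tendsto[OF this] show ?thesis by simp
qed

section \<open>The Gumbel limit\<close>

lemma overlap_probability_bounds:
  fixes N r :: nat and s y :: real
  assumes N: "0 < N" and r: "r \<le> N" and s: "0 < s" "4 * s < 1"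
  defines "p \<equiv> measure (gaussian (goe_index N)) {g \<in> space (gaussian (goe_index N)). overlap_le N r y (goe_matrix N g)}"
    and "b \<equiv> 2 * (8 * real r + 1) ^ r * exp (- (real N * s\<^sup>2 / 16))"
  shows "chi_le r ((1 - 4 * s) * y) ^ N - b \<le> p \<and> p \<le> chi_le r ((1 + 4 * s) * y) ^ N + b"
proof -
  obtain Bad where Bad: "Bad \<in> sets (gauss_array N r)"
    "\<And>G. G \<in> space (gauss_array N r) \<Longrightarrow> G \<notin> Bad \<Longrightarrow> near_isometry N r (4 * s) G"
    "measure (gauss_array N r) Bad \<le> b"
    unfolding b_def using ex_bad_set[of s N r] s by auto
  have \<delta>: "0 \<le> 4 * s" using s by simp
  show ?thesis
    using overlap_comparison[OF N r \<delta> s(2) Bad(1,2), of y] Bad(3) unfolding p_def by linarith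
qed

text \<open>The Gumbel normalization solved for the maximum. It has the form R + 2 sqrt(R) D with R
  = \<open>real N powr \<alpha>\<close> in place of the rank and D = sqrt(ln N) + c / sqrt(ln
  N).\<close>

definition threshold :: "real \<Rightarrow> real \<Rightarrow> nat \<Rightarrow> real" where
  "threshold \<alpha> x N = real N powr \<alpha> + 2 * real N powr (\<alpha> / 2) * sqrt (ln N)
     + 2 * real N powr (\<alpha> / 2) / sqrt (ln N) * gumbel_shift x N"

lemma threshold_iff:
  assumes N: "N \<ge> 2"
  shows "(sqrt (ln N) / real N powr (\<alpha> / 2)) * F - real N powr (\<alpha> / 2) * sqrt (ln N) - 2 * ln N
      + ln (ln N) / 2 + ln (4 * pi) / 2 \<le> x \<longleftrightarrow> F \<le> threshold \<alpha> x N"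
proof -
  define P where "P = real N powr (\<alpha> / 2)"
  define S where "S = sqrt (ln (real N))"
  define c where "c = gumbel_shift x N"
  have "ln (real N) > 0" using N by simp
  then have S: "S > 0" "ln (real N) = S * S" by (simp_all add: S_def)
  have P: "P > 0" using N by (simp add: P_def)
  have R: "real N powr \<alpha> = P * P" using N by (simp add: P_def powr_add[symmetric])
  have c: "x = 2 * c + ln (ln (real N)) / 2 + ln (4 * pi) / 2"
    by (simp add: c_def gumbel_shift_def field_simps)
  have "S / P * F - P * S - 2 * ln N + ln (ln N) / 2 + ln (4 * pi) / 2 \<le> x
    \<longleftrightarrow> S / P * F \<le> S / P * (P * P + 2 * P * S + 2 * P / S * c)"
  proof -
    have "S / P * (P * P + 2 * P * S + 2 * P / S * c) = P * S + 2 * (S * S) + 2 * c"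
      using S P by (simp add: field_simps)
    then show ?thesis unfolding S(2)[symmetric] using c by linarith
  qed
  also have "\<dots> \<longleftrightarrow> F \<le> P * P + 2 * P * S + 2 * P / S * c"
    using S P by (intro mult_le_cancel_left_pos) auto
  finally show ?thesis by (simp add: threshold_def P_def[symmetric] S_def[symmetric] R c_def)
qed

locale near_power_rank =
  fixes \<alpha> \<epsilon> :: real and r :: "nat \<Rightarrow> nat"
  assumes \<alpha>: "0 < \<alpha>" "\<alpha> < 1 / 2" and \<epsilon>: "0 < \<epsilon>"
    and rank: "\<And>N. N \<ge> 1 \<Longrightarrow> \<bar>real (r N) - real N powr \<alpha>\<bar> \<le> real N powr (\<alpha> / 2 - \<epsilon>)"
begin

lemma rank_between:
  "\<forall>\<^sub>F N in sequentially. real N powr \<alpha> / 2 \<le> real (r N) \<and> real (r N) \<le> 2 * real N powr \<alpha>"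
proof -
  have "\<forall>\<^sub>F N in sequentially. real N powr (- \<alpha> / 2 - \<epsilon>) \<le> 1 / 2"
  proof -
    have "(\<lambda>N. real N powr (- (\<alpha> / 2 + \<epsilon>))) \<longlonglongrightarrow> 0" using \<alpha> \<epsilon> by real_asymp
    from order_tendstoD(2)[OF this, of "1 / 2"] show ?thesis by (auto elim!: eventually_mono)
  qed
  then show ?thesis using eventually_ge_at_top[of 1]
  proof eventually_elim
    case (elim N)
    have "real N powr (\<alpha> / 2 - \<epsilon>) = real N powr (- \<alpha> / 2 - \<epsilon>) * real N powr \<alpha>"
      by (simp add: powr_add[symmetric])
    also have "\<dots> \<le> 1 / 2 * real N powr \<alpha>" using elim by (intro mult_right_mono) auto
    finally have *: "\<bar>real (r N) - real N powr \<alpha>\<bar> \<le> real N powr \<alpha> / 2" using rank[OF elim(2)] by simp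
    show ?case using abs_le_D1[OF *] abs_le_D2[OF *] by linarith
  qed
qed

lemma rank_at_top: "filterlim (\<lambda>N. real (r N)) at_top sequentially"
proof (rule filterlim_at_top_mono)
  show "filterlim (\<lambda>N. real N powr \<alpha> / 2) at_top sequentially" using \<alpha> by real_asymp
  show "\<forall>\<^sub>F N in sequentially. real N powr \<alpha> / 2 \<le> real (r N)"
    using rank_between by eventually_elim simp
qed

text \<open>The ratio between the scale in the normalization and the scale \<open>sqrt (r N)\<close>
  natural to the chi-squared law.\<close>

definition q :: "nat \<Rightarrow> real" where
  "q N = real N powr (\<alpha> / 2) / sqrt (r N)"

text \<open>A rate is wanted beyond the limit 1, because \<open>q N - 1\<close> will be multiplied
  by \<open>ln N\<close>.\<close>

lemma q_bound: "\<forall>\<^sub>F N in sequentially. \<bar>q N - 1\<bar> \<le> 2 * real N powr (- (\<alpha> / 2 + \<epsilon>))"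
  using rank_between eventually_ge_at_top[of 1]
proof eventually_elim
  case (elim N)
  define R where "R = real N powr \<alpha>"
  have R: "R > 0" "R / 2 \<le> r N" using elim by (auto simp: R_def)
  then have r: "real (r N) > 0" by linarith
  have q0: "q N \<ge> 0" by (simp add: q_def)
  have "(real N powr (\<alpha> / 2))\<^sup>2 = R" using elim by (simp add: R_def power2_eq_square powr_add[symmetric])
  then have q2: "(q N)\<^sup>2 - 1 = (R - r N) / r N" using r by (simp add: q_def power_divide diff_divide_distrib)
  \<comment> \<open>Multiplying by \<open>q N + 1\<close>, which is at least 1, replaces
    \<open>q N\<close> by its square and so removes the root of the rank.\<close>
  have "\<bar>q N - 1\<bar> * 1 \<le> \<bar>q N - 1\<bar> * (q N + 1)" using q0 by (intro mult_left_mono) auto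
  also have "\<dots> = \<bar>(q N)\<^sup>2 - 1\<bar>"
  proof -
    have "(q N)\<^sup>2 - 1 = (q N - 1) * (q N + 1)" by (simp add: power2_eq_square algebra_simps)
    then show ?thesis using q0 by (simp add: abs_mult)
  qed
  also have "\<dots> = \<bar>real (r N) - R\<bar> / r N" unfolding q2 using r by (simp add: abs_divide abs_minus_commute)
  also have "\<dots> \<le> real N powr (\<alpha> / 2 - \<epsilon>) / (R / 2)"
    using rank[OF elim(2)] R r by (intro frac_le) (auto simp: R_def)
  also have "\<dots> = 2 * real N powr (- (\<alpha> / 2 + \<epsilon>))"
  proof -
    have "\<alpha> / 2 - \<epsilon> - \<alpha> = - (\<alpha> / 2 + \<epsilon>)" by simp
    then have "real N powr (\<alpha> / 2 - \<epsilon>) / R = real N powr (- (\<alpha> / 2 + \<epsilon>))"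
      unfolding R_def powr_diff[symmetric] by (simp only:)
    moreover have "real N powr (\<alpha> / 2 - \<epsilon>) / (R / 2) = 2 * (real N powr (\<alpha> / 2 - \<epsilon>) / R)" by simp
    ultimately show ?thesis by (simp only:)
  qed
  finally show ?case by simp
qed

lemma q_lim: "q \<longlonglongrightarrow> 1"
proof -
  have "(\<lambda>N. q N - 1) \<longlonglongrightarrow> 0"
  proof (rule Lim_null_comparison)
    show "\<forall>\<^sub>F N in sequentially. norm (q N - 1) \<le> 2 * real N powr (- (\<alpha> / 2 + \<epsilon>))"
      using q_bound by simp
    show "(\<lambda>N. 2 * real N powr (- (\<alpha> / 2 + \<epsilon>))) \<longlonglongrightarrow> 0" using \<alpha> \<epsilon> by real_asymp
  qed
  then show ?thesis by (simp add: LIM_zero_iff)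
qed

text \<open>The sign \<tau> covers the lower and the upper comparison at once. The error
  \<open>w\<close> splits by origin: \<open>A\<close> from the scale
  \<open>real N powr (\<alpha> / 2)\<close> in place of \<open>sqrt (r N)\<close>, \<open>B\<close>
  from the centre \<open>real N powr \<alpha>\<close> in place of \<open>r N\<close>, and
  \<open>C\<close> from the factor of the near isometry.\<close>

lemma chi_power_limit:
  fixes \<tau> x :: real
  assumes \<tau>: "\<bar>\<tau>\<bar> = 1"
  shows "(\<lambda>N. chi_le (r N) ((1 + \<tau> * real N powr (- 1 / 4)) * threshold \<alpha> x N) ^ N) \<longlonglongrightarrow> exp (- exp (- x))"
proof -
  define z where "z N = (1 + \<tau> * real N powr (- 1 / 4)) * threshold \<alpha> x N" for N
  define D where "D N = (z N - r N) / (2 * sqrt (r N))" for N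
  define w where "w N = sqrt (ln N) * (D N - sqrt (ln N)) - gumbel_shift x N" for N
  \<comment> \<open>The relative error \<open>real N powr (- 1 / 4)\<close> of the centre, measured
    in units of \<open>real N powr (\<alpha> / 2)\<close>, is
    \<open>real N powr (- \<kappa>)\<close>. It vanishes because \<alpha> < 1/2.\<close>
  define \<kappa> where "\<kappa> = 1 / 4 - \<alpha> / 2"
  have \<kappa>: "\<kappa> > 0" using \<alpha> by (simp add: \<kappa>_def)
  define A where "A N = (q N - 1) * (ln N + gumbel_shift x N)" for N
  define B where "B N = sqrt (ln N) * ((real N powr \<alpha> - r N) / (2 * real N powr (\<alpha> / 2)))" for N
  define C where "C N = sqrt (ln N) * (real N powr (- \<kappa>) / 2 + real N powr (- 1 / 4) * sqrt (ln N)
    + real N powr (- 1 / 4) / sqrt (ln N) * gumbel_shift x N)" for N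
  have A: "A \<longlonglongrightarrow> 0"
  proof (rule Lim_null_comparison)
    show "\<forall>\<^sub>F N in sequentially. norm (A N) \<le> 2 * real N powr (- (\<alpha> / 2 + \<epsilon>)) * \<bar>ln N + gumbel_shift x N\<bar>"
      using q_bound by eventually_elim (simp add: A_def abs_mult mult_right_mono)
    define d where "d = \<alpha> / 2 + \<epsilon>"
    have "d > 0" using \<alpha> \<epsilon> by (simp add: d_def)
    then have "(\<lambda>N. 2 * real N powr (- d) * (ln N + gumbel_shift x N)) \<longlonglongrightarrow> 0"
      unfolding gumbel_shift_def by real_asymp
    from tendsto_rabs[OF this] show "(\<lambda>N. 2 * real N powr (- (\<alpha> / 2 + \<epsilon>)) * \<bar>ln N + gumbel_shift x N\<bar>) \<longlonglongrightarrow> 0"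
      by (simp add: abs_mult d_def)
  qed
  have B: "B \<longlonglongrightarrow> 0"
  proof (rule Lim_null_comparison)
    show "\<forall>\<^sub>F N in sequentially. norm (B N) \<le> sqrt (ln (real N)) * (real N powr (- \<epsilon>) / 2)"
      using eventually_ge_at_top[of 1]
    proof eventually_elim
      case (elim N)
      have "\<bar>real N powr \<alpha> - r N\<bar> / (2 * real N powr (\<alpha> / 2)) \<le> real N powr (\<alpha> / 2 - \<epsilon>) / (2 * real N powr (\<alpha> / 2))"
        using rank[OF elim] by (intro divide_right_mono) (auto simp: abs_minus_commute)
      also have "\<dots> = real N powr (- \<epsilon>) / 2" using elim by (simp add: powr_diff powr_minus_divide)
      finally have "sqrt (ln (real N)) * (\<bar>real N powr \<alpha> - r N\<bar> / (2 * real N powr (\<alpha> / 2))) \<le> sqrt (ln (real N)) * (real N powr (- \<epsilon>) / 2)"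
        using elim by (intro mult_left_mono) auto
      moreover have "norm (B N) = sqrt (ln (real N)) * (\<bar>real N powr \<alpha> - r N\<bar> / (2 * real N powr (\<alpha> / 2)))"
        using elim by (simp add: B_def abs_mult abs_divide)
      ultimately show ?case by simp
    qed
    show "(\<lambda>N. sqrt (ln (real N)) * (real N powr (- \<epsilon>) / 2)) \<longlonglongrightarrow> 0" using \<epsilon> by real_asymp
  qed
  have C: "C \<longlonglongrightarrow> 0"
  proof -
    have "(\<lambda>N. sqrt (ln N) * (real N powr (- \<kappa>) / 2)) \<longlonglongrightarrow> 0" using \<kappa> by real_asymp
    moreover have "(\<lambda>N. sqrt (ln N) * (real N powr (- 1 / 4) * sqrt (ln N))) \<longlonglongrightarrow> 0" by real_asymp
    moreover have "(\<lambda>N. sqrt (ln N) * (real N powr (- 1 / 4) / sqrt (ln N) * gumbel_shift x N)) \<longlonglongrightarrow> 0"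
      unfolding gumbel_shift_def by real_asymp
    ultimately have "(\<lambda>N. sqrt (ln N) * (real N powr (- \<kappa>) / 2) + sqrt (ln N) * (real N powr (- 1 / 4) * sqrt (ln N))
      + sqrt (ln N) * (real N powr (- 1 / 4) / sqrt (ln N) * gumbel_shift x N)) \<longlonglongrightarrow> 0 + 0 + 0"
      by (intro tendsto_add)
    then show ?thesis by (simp add: C_def[abs_def] distrib_left)
  qed
  have w_eq: "\<forall>\<^sub>F N in sequentially. A N + q N * (B N + \<tau> * C N) = w N"
    using rank_between eventually_ge_at_top[of 2]
  proof eventually_elim
    case (elim N)
    define P where "P = real N powr (\<alpha> / 2)"
    define S where "S = sqrt (ln (real N))"
    define c where "c = gumbel_shift x N"
    define t where "t = real N powr (- 1 / 4)"
    define m where "m = real (r N)"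
    have "ln (real N) > 0" using elim by simp
    then have S: "S > 0" "ln (real N) = S * S" by (simp_all add: S_def)
    have P: "P > 0" using elim by (simp add: P_def)
    have R: "real N powr \<alpha> = P * P" using elim by (simp add: P_def powr_add[symmetric])
    have m: "m > 0" "sqrt m > 0"
    proof -
      have "real N powr \<alpha> > 0" using elim by simp
      then show "m > 0" using elim unfolding m_def by linarith
      then show "sqrt m > 0" by simp
    qed
    have k: "real N powr (- \<kappa>) = t * P" by (simp add: t_def P_def \<kappa>_def powr_add[symmetric])
    have qN: "q N = P / sqrt m" by (simp add: q_def P_def m_def)
    have zN: "z N = (1 + \<tau> * t) * (P * P + 2 * P * S + 2 * P / S * c)"
      by (simp add: z_def threshold_def t_def P_def S_def c_def R[unfolded P_def])
    have "(z N - m) / (2 * P) = S + c / S + (P * P - m) / (2 * P) + \<tau> * (t * P / 2 + t * S + t / S * c)"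
      unfolding zN using P S(1) by (simp add: field_simps)
    then have "S * (q N * ((z N - m) / (2 * P))) = q N * (S * S + c + S * ((P * P - m) / (2 * P)) + \<tau> * (S * (t * P / 2 + t * S + t / S * c)))"
      using S(1) by (simp add: distrib_left) (simp add: algebra_simps)
    moreover have "D N = q N * ((z N - m) / (2 * P))"
      using P m by (simp add: D_def qN m_def)
    ultimately have "w N = q N * (S * S + c + S * ((P * P - m) / (2 * P)) + \<tau> * (S * (t * P / 2 + t * S + t / S * c))) - S * S - c"
      by (simp add: w_def S_def[symmetric] c_def[symmetric] right_diff_distrib)
    moreover have "A N = (q N - 1) * (S * S + c)" by (simp add: A_def S(2) c_def)
    moreover have "B N = S * ((P * P - m) / (2 * P))" by (simp add: B_def S_def R m_def P_def)
    moreover have "C N = S * (t * P / 2 + t * S + t / S * c)"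
      unfolding C_def k by (simp add: S_def t_def c_def)
    ultimately show ?case by (simp only:) (simp add: algebra_simps)
  qed
  have w: "w \<longlonglongrightarrow> 0"
  proof -
    have "(\<lambda>N. A N + q N * (B N + \<tau> * C N)) \<longlonglongrightarrow> 0 + 1 * (0 + \<tau> * 0)"
      by (intro tendsto_add tendsto_mult A B C q_lim tendsto_const)
    then have "w \<longlonglongrightarrow> 0 + 1 * (0 + \<tau> * 0)" using w_eq by (rule Lim_transform_eventually)
    then show ?thesis by simp
  qed
  have Ln: "(\<lambda>N. sqrt (ln N) ^ 3 / sqrt (r N)) \<longlonglongrightarrow> 0"
  proof -
    have "(\<lambda>N. sqrt (ln (real N)) ^ 3 * real N powr (- (\<alpha> / 2))) \<longlonglongrightarrow> 0" using \<alpha> by real_asymp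
    from tendsto_mult[OF this q_lim]
    have "(\<lambda>N. sqrt (ln N) ^ 3 * real N powr (- (\<alpha> / 2)) * q N) \<longlonglongrightarrow> 0" by simp
    moreover have "\<forall>\<^sub>F N in sequentially. sqrt (ln N) ^ 3 * real N powr (- (\<alpha> / 2)) * q N = sqrt (ln N) ^ 3 / sqrt (r N)"
      using eventually_ge_at_top[of 1]
    proof eventually_elim
      case (elim N)
      have "real N powr (- (\<alpha> / 2)) * real N powr (\<alpha> / 2) = 1" using elim by (simp add: powr_add[symmetric])
      then have "real N powr (- (\<alpha> / 2)) * q N = 1 / sqrt (r N)" by (simp add: q_def)
      then show ?case by (simp only: mult.assoc) simp
    qed
    ultimately show ?thesis by (rule Lim_transform_eventually)
  qed
  have D_eq: "\<forall>\<^sub>F N in sequentially. D N = sqrt (ln N) + (gumbel_shift x N + w N) / sqrt (ln N)"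
    using eventually_ge_at_top[of 2]
  proof eventually_elim
    case (elim N)
    then have "sqrt (ln (real N)) > 0" by simp
    then show ?case by (simp add: w_def)
  qed
  show ?thesis
    using chi_power_tendsto_gumbel[OF rank_at_top Ln w D_eq[unfolded D_def]] by (simp add: z_def)
qed

text \<open>At s = N^(-1/4) / 4 the deviation exponent N s^2 / 16 equals sqrt(N) / 256, while the
  logarithm of the number of grid points has order at most N^\<alpha> ln N. As \<alpha> < 1/2, the
  deviation exponent wins.\<close>

lemma bad_probability_limit:
  "(\<lambda>N. 2 * (8 * real (r N) + 1) ^ r N * exp (- (real N * (real N powr (- 1 / 4) / 4)\<^sup>2 / 16))) \<longlonglongrightarrow> 0"
proof (rule Lim_null_comparison)
  define \<kappa> where "\<kappa> = 1 / 2 - \<alpha>"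
  have \<kappa>: "\<kappa> > 0" using \<alpha> by (simp add: \<kappa>_def)
  show "\<forall>\<^sub>F N in sequentially. norm (2 * (8 * real (r N) + 1) ^ r N * exp (- (real N * (real N powr (- 1 / 4) / 4)\<^sup>2 / 16)))
     \<le> 2 * exp (sqrt N * (2 * real N powr (- \<kappa>) * ln (16 * sqrt N + 1) - 1 / 256))"
    using rank_between eventually_ge_at_top[of 1]
  proof eventually_elim
    case (elim N)
    define R where "R = real N powr \<alpha>"
    have r: "real (r N) \<le> 2 * R" using elim by (simp add: R_def)
    have R: "R \<le> sqrt N" using elim \<alpha> by (simp add: R_def powr_half_sqrt[symmetric] powr_mono)
    have Rk: "R = sqrt N * real N powr (- \<kappa>)"
      using elim by (simp add: R_def \<kappa>_def powr_half_sqrt[symmetric] powr_add[symmetric])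
    have "(8 * real (r N) + 1) ^ r N = exp (real (r N) * ln (8 * real (r N) + 1))"
      by (subst exp_of_nat_mult) (simp add: add_nonneg_pos)
    also have "\<dots> \<le> exp (2 * R * ln (16 * sqrt N + 1))"
      using r R by (auto intro!: mult_mono ln_ge_zero)
    finally have 1: "(8 * real (r N) + 1) ^ r N \<le> exp (2 * R * ln (16 * sqrt N + 1))" .
    have 2: "real N * (real N powr (- 1 / 4) / 4)\<^sup>2 / 16 = sqrt N / 256"
    proof -
      have "real N * (real N powr (- 1 / 4))\<^sup>2 = sqrt N"
        using elim by (simp add: power2_eq_square powr_add[symmetric] powr_half_sqrt[symmetric] powr_mult_base)
      then show ?thesis by (simp add: power_divide)
    qed
    have "2 * (8 * real (r N) + 1) ^ r N * exp (- (sqrt N / 256))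
      \<le> 2 * exp (2 * R * ln (16 * sqrt N + 1)) * exp (- (sqrt N / 256))"
      using 1 by (intro mult_right_mono mult_left_mono) auto
    also have "\<dots> = 2 * exp (sqrt N * (2 * real N powr (- \<kappa>) * ln (16 * sqrt N + 1) - 1 / 256))"
      unfolding Rk by (simp add: exp_add[symmetric] algebra_simps)
    finally show ?case unfolding 2 by (simp add: abs_mult)
  qed
  show "(\<lambda>N. 2 * exp (sqrt N * (2 * real N powr (- \<kappa>) * ln (16 * sqrt N + 1) - 1 / 256))) \<longlonglongrightarrow> 0"
  proof -
    have l1: "(\<lambda>N. 2 * real N powr (- \<kappa>) * ln (16 * sqrt (real N) + 1) - 1 / 256) \<longlonglongrightarrow> - 1 / 256"
      using \<kappa> by real_asymp
    have l2: "filterlim (\<lambda>N. sqrt (real N)) at_top sequentially" by real_asymp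
    have "filterlim (\<lambda>N. (2 * real N powr (- \<kappa>) * ln (16 * sqrt (real N) + 1) - 1 / 256) * sqrt (real N)) at_bot sequentially"
      by (rule filterlim_tendsto_neg_mult_at_bot[OF l1 _ l2]) simp
    then have "(\<lambda>N. 2 * exp ((2 * real N powr (- \<kappa>) * ln (16 * sqrt (real N) + 1) - 1 / 256) * sqrt (real N))) \<longlonglongrightarrow> 2 * 0"
      by (intro tendsto_mult tendsto_const filterlim_compose[OF exp_at_bot])
    then show ?thesis by (simp add: mult.commute)
  qed
qed

end

theorem theorem2p9:
  fixes \<alpha> :: real and r :: "nat \<Rightarrow> nat"
  assumes "0 < \<alpha>" and "\<alpha> < 1/2"
    and "\<And>N. r N \<le> N"
    and "\<exists>\<epsilon>>0. \<forall>N\<ge>1. \<bar>real (r N) - real N powr \<alpha>\<bar> \<le> real N powr (\<alpha>/2 - \<epsilon>)"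
  shows "\<forall>x::real. (\<lambda>N. measure (goe_space N)
            {g \<in> space (goe_space N).
               (sqrt (ln (real N)) / real N powr (\<alpha>/2))
                 * max_overlap N (diag_proj N (r N)) (goe_matrix N g)
               - real N powr (\<alpha>/2) * sqrt (ln (real N)) - 2 * ln (real N)
               + ln (ln (real N)) / 2 + ln (4 * pi) / 2 \<le> x})
          \<longlonglongrightarrow> exp (- exp (- x))"
proof
  fix x :: real
  obtain \<epsilon> where \<epsilon>: "\<epsilon> > 0" "\<forall>N\<ge>1. \<bar>real (r N) - real N powr \<alpha>\<bar> \<le> real N powr (\<alpha>/2 - \<epsilon>)"
    using assms(4) by blast
  interpret near_power_rank \<alpha> \<epsilon> r
    by standard (use assms \<epsilon> in auto)
  define p where "p N = measure (gaussian (goe_index N)) {g \<in> space (gaussian (goe_index N)).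
    overlap_le N (r N) (threshold \<alpha> x N) (goe_matrix N g)}" for N
  define b where "b N = 2 * (8 * real (r N) + 1) ^ r N * exp (- (real N * (real N powr (- 1 / 4) / 4)\<^sup>2 / 16))" for N
  define f where "f \<tau> N = chi_le (r N) ((1 + \<tau> * real N powr (- 1 / 4)) * threshold \<alpha> x N) ^ N" for \<tau> N
  have b: "b \<longlonglongrightarrow> 0" unfolding b_def by (rule bad_probability_limit)
  have f: "f \<tau> \<longlonglongrightarrow> exp (- exp (- x))" if "\<bar>\<tau>\<bar> = 1" for \<tau>
    unfolding f_def by (rule chi_power_limit[OF that])
  have bounds: "\<forall>\<^sub>F N in sequentially. f (-1) N - b N \<le> p N \<and> p N \<le> f 1 N + b N"
    using eventually_ge_at_top[of 2]
  proof eventually_elim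
    case (elim N)
    \<comment> \<open>This is the condition \<open>4 * s < 1\<close> for
      \<open>s = real N powr (- 1 / 4) / 4\<close>. The quarter offsets the factor 4 that the grid
      argument loses, so that the resulting isometry constant is
      \<open>real N powr (- 1 / 4)\<close>.\<close>
    have "real N powr (- 1 / 4) < 1" using elim by (subst powr_less_one) auto
    then show ?case
      using overlap_probability_bounds[of N "r N" "real N powr (- 1 / 4) / 4" "threshold \<alpha> x N"] elim assms(3)
      by (simp add: f_def b_def p_def)
  qed
  have "p \<longlonglongrightarrow> exp (- exp (- x))"
  proof (rule tendsto_sandwich)
    show "\<forall>\<^sub>F N in sequentially. f (-1) N - b N \<le> p N" "\<forall>\<^sub>F N in sequentially. p N \<le> f 1 N + b N"
      using bounds by (auto elim!: eventually_mono)
    show "(\<lambda>N. f (-1) N - b N) \<longlonglongrightarrow> exp (- exp (- x))" using tendsto_diff[OF f b] by simp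
    show "(\<lambda>N. f 1 N + b N) \<longlonglongrightarrow> exp (- exp (- x))" using tendsto_add[OF f b] by simp
  qed
  moreover have "\<forall>\<^sub>F N in sequentially. p N = measure (goe_space N) {g \<in> space (goe_space N).
     (sqrt (ln (real N)) / real N powr (\<alpha>/2)) * max_overlap N (diag_proj N (r N)) (goe_matrix N g)
       - real N powr (\<alpha>/2) * sqrt (ln (real N)) - 2 * ln (real N) + ln (ln (real N)) / 2 + ln (4 * pi) / 2 \<le> x}"
    using eventually_ge_at_top[of 2]
  proof eventually_elim
    case (elim N)
    then have "0 < N" by simp
    show ?case
      unfolding p_def goe_space_eq threshold_iff[OF elim]
        max_overlap_le_iff[OF \<open>0 < N\<close> assms(3) goe_matrix_sym] ..
  qed
  ultimately show "(\<lambda>N. measure (goe_space N) {g \<in> space (goe_space N).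
     (sqrt (ln (real N)) / real N powr (\<alpha>/2)) * max_overlap N (diag_proj N (r N)) (goe_matrix N g)
       - real N powr (\<alpha>/2) * sqrt (ln (real N)) - 2 * ln (real N) + ln (ln (real N)) / 2 + ln (4 * pi) / 2 \<le> x})
     \<longlonglongrightarrow> exp (- exp (- x))"
    by (rule Lim_transform_eventually)
qed

end
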